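(* There is a polynomial-time parsimonious transformation from the problem 3-SAT to the problem Width6–Valency2–Maximal–Routing. Here 3-SAT is: given a Boolean formula which is a conjunction of clauses, each a disjunction of at most three (possibly negated) variables, decide whether it is satisfiable; and Width6–Valency2–Maximal–Routing is: given a polarised switching circuit $(G,T)$ in which every vertex has in- and out-valency at most $2$ and every class of $T$ has at most $6$ vertices, and a positive integer $K$, decide whether there is a routing respecting $T$ whose associated cycle decomposition of the edge set has at least $K$ cycles.
   Context: A switching circuit is a finite directed graph $G=(V,E)$ (loops and multiple edges allowed) such that every vertex $v$ has equal in- and out-valency $\partial(v)$, together with, for every vertex $v$, bijective labellings of the edges into $v$ and of the edges out of $v$ by $\{1,\dots,\partial(v)\}$. A routing is a choice of $\rho(v)\in S_{\partial(v)}$ for each vertex $v$; it determines the permutation of $E$ sending an edge into $v$ with in-label $i$ to the edge out of $v$ with out-label $\rho(v)(i)$, whose cycles form a decomposition of $E$ into directed cycles. A polarisation $T$ is an equivalence relation on $V$ with equivalent vertices having equal valency; a routing respects $T$ if $\rho(x)=\rho(y)$ for $T$-equivalent $x,y$; the width of $T$ is the maximal class size. A transformation is parsimonious if it maps each instance to an instance with the same answer and the number of solutions (satisfying assignments for 3-SAT; $T$-respecting routings with at least $K$ cycles for the routing problem) is preserved. *)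

theory Defs
  imports
    "HOL-Computational_Algebra.Polynomial"
    "HOL-Combinatorics.Orbits"
    "Graph_Theory.Digraph"
begin

section \<open>Switching circuits, routings and polarisations\<close>

record ('v, 'e) circuit =
  graph :: "('v, 'e) pre_digraph"
  in_label :: "'e \<Rightarrow> nat"
  out_label :: "'e \<Rightarrow> nat"

abbreviation valency :: "('v, 'e) circuit \<Rightarrow> 'v \<Rightarrow> nat" where
  "valency C v \<equiv> in_degree (graph C) v"

definition switching_circuit :: "('v, 'e) circuit \<Rightarrow> bool" where
  "switching_circuit C \<longleftrightarrow>
     fin_digraph (graph C) \<and>
     (\<forall>v \<in> verts (graph C).
        in_degree (graph C) v = out_degree (graph C) v \<and>
        bij_betw (in_label C) (in_arcs (graph C) v) {1..valency C v} \<and>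
        bij_betw (out_label C) (out_arcs (graph C) v) {1..valency C v})"

text \<open>Routings are extensional functions on the vertex set, so that they can be counted.\<close>

definition routings :: "('v, 'e) circuit \<Rightarrow> ('v \<Rightarrow> nat \<Rightarrow> nat) set" where
  "routings C = (\<Pi>\<^sub>E v \<in> verts (graph C). {p. p permutes {1..valency C v}})"

definition next_arc :: "('v, 'e) circuit \<Rightarrow> ('v \<Rightarrow> nat \<Rightarrow> nat) \<Rightarrow> 'e \<Rightarrow> 'e" where
  "next_arc C \<rho> e =
     (let v = head (graph C) e
      in THE e'. e' \<in> out_arcs (graph C) v \<and> out_label C e' = \<rho> v (in_label C e))"

definition cycle_decomposition ::
    "('v, 'e) circuit \<Rightarrow> ('v \<Rightarrow> nat \<Rightarrow> nat) \<Rightarrow> 'e set set" where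
  "cycle_decomposition C \<rho> = orbit (next_arc C \<rho>) ` arcs (graph C)"

definition polarisation :: "('v, 'e) circuit \<Rightarrow> ('v \<times> 'v) set \<Rightarrow> bool" where
  "polarisation C T \<longleftrightarrow>
     equiv (verts (graph C)) T \<and> (\<forall>(x, y) \<in> T. valency C x = valency C y)"

definition respects_polarisation :: "('v \<Rightarrow> nat \<Rightarrow> nat) \<Rightarrow> ('v \<times> 'v) set \<Rightarrow> bool" where
  "respects_polarisation \<rho> T \<longleftrightarrow> (\<forall>(x, y) \<in> T. \<rho> x = \<rho> y)"


section \<open>Multi-tape Turing machines and polynomial time\<close>

text \<open>
  The symbols of a machine \<open>M\<close> are \<open>0, \<dots>, num_symbols M - 1\<close>, where \<open>0\<close> is the blank. Its
  non-halting states are \<open>0, \<dots>, num_states M - 1\<close>; it starts in state \<open>0\<close> and halts on entering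
  the state \<open>num_states M\<close>. The transition function receives the current state and the list of
  symbols under the heads; it yields the next state and, for each tape, the symbol to be written
  and the head movement. Tapes are infinite in both directions. Tape \<open>0\<close> holds the input and
  tape \<open>1\<close> the output.
\<close>

type_synonym symbol = nat
type_synonym word = "symbol list"

datatype move = Move_Left | Stay | Move_Right

record machine =
  num_tapes :: nat
  num_symbols :: nat
  num_states :: nat
  transition :: "nat \<Rightarrow> symbol list \<Rightarrow> nat \<times> (symbol \<times> move) list"

definition turing_machine :: "machine \<Rightarrow> bool" where
  "turing_machine M \<longleftrightarrow>
     2 \<le> num_tapes M \<and>
     (\<forall>q ss. q < num_states M \<longrightarrow> length ss = num_tapes M \<longrightarrow> set ss \<subseteq> {..<num_symbols M} \<longrightarrow>
        (case transition M q ss of (q', acts) \<Rightarrow>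
           q' \<le> num_states M \<and> length acts = num_tapes M \<and>
           fst ` set acts \<subseteq> {..<num_symbols M}))"

type_synonym tape = "(int \<Rightarrow> symbol) \<times> int"

definition word_content :: "word \<Rightarrow> int \<Rightarrow> symbol" where
  "word_content w i = (if 0 \<le> i \<and> i < int (length w) then w ! nat i else 0)"

definition read_tape :: "tape \<Rightarrow> symbol" where
  "read_tape t = fst t (snd t)"

fun move_head :: "move \<Rightarrow> int \<Rightarrow> int" where
  "move_head Move_Left i = i - 1"
| "move_head Stay i = i"
| "move_head Move_Right i = i + 1"

definition act_on_tape :: "symbol \<times> move \<Rightarrow> tape \<Rightarrow> tape" where
  "act_on_tape a t = ((fst t)(snd t := fst a), move_head (snd a) (snd t))"

type_synonym config = "nat \<times> tape list"

definition initial_config :: "machine \<Rightarrow> word \<Rightarrow> config" where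
  "initial_config M w =
     (0, (word_content w, 0) # replicate (num_tapes M - 1) (word_content [], 0))"

definition step :: "machine \<Rightarrow> config \<Rightarrow> config" where
  "step M c =
     (case c of (q, ts) \<Rightarrow>
        if q < num_states M
        then (case transition M q (map read_tape ts) of
                (q', acts) \<Rightarrow> (q', map2 act_on_tape acts ts))
        else c)"

text \<open>Halting configurations are fixed by \<^const>\<open>step\<close>, so \<open>t\<close> is an upper bound on the
  running time.\<close>

definition outputs_within :: "machine \<Rightarrow> word \<Rightarrow> word \<Rightarrow> nat \<Rightarrow> bool" where
  "outputs_within M w v t \<longleftrightarrow>
     (case (step M ^^ t) (initial_config M w) of
        (q, ts) \<Rightarrow> q = num_states M \<and> fst (ts ! 1) = word_content v)"

definition polynomial_time_computable ::
    "'a set \<Rightarrow> ('a \<Rightarrow> word) \<Rightarrow> ('b \<Rightarrow> word) \<Rightarrow> ('a \<Rightarrow> 'b) \<Rightarrow> bool" where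
  "polynomial_time_computable D enc enc' f \<longleftrightarrow>
     (\<exists>M (p :: nat poly). turing_machine M \<and>
        (\<forall>x \<in> D. set (enc x) \<subseteq> {0<..<num_symbols M} \<and>
           outputs_within M (enc x) (enc' (f x)) (poly p (length (enc x)))))"


section \<open>Decision problems with solutions and parsimonious transformations\<close>

record ('i, 's) problem =
  instances :: "'i set"
  solutions :: "'i \<Rightarrow> 's set"
  encoding :: "'i \<Rightarrow> word"

definition yes_instance :: "('i, 's) problem \<Rightarrow> 'i \<Rightarrow> bool" where
  "yes_instance P x \<longleftrightarrow> (\<exists>s. s \<in> solutions P x)"

definition parsimonious_transformation ::
    "('i, 's) problem \<Rightarrow> ('j, 't) problem \<Rightarrow> ('i \<Rightarrow> 'j) \<Rightarrow> bool" where
  "parsimonious_transformation P Q f \<longleftrightarrow>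
     (\<forall>x \<in> instances P.
        f x \<in> instances Q \<and>
        (yes_instance P x \<longleftrightarrow> yes_instance Q (f x)) \<and>
        card (solutions P x) = card (solutions Q (f x)))"

definition polynomial_time_transformation ::
    "('i, 's) problem \<Rightarrow> ('j, 't) problem \<Rightarrow> ('i \<Rightarrow> 'j) \<Rightarrow> bool" where
  "polynomial_time_transformation P Q f \<longleftrightarrow>
     polynomial_time_computable (instances P) (encoding P) (encoding Q) f"


section \<open>Encodings\<close>

text \<open>
  Numbers are written in binary, least significant digit first, with the symbols \<open>1\<close> and \<open>2\<close>
  for the digits zero and one (zero is the empty numeral). The symbols \<open>3\<close>, \<open>4\<close>, \<open>5\<close> terminate
  numbers, lists and sections respectively.
\<close>

fun binary :: "nat \<Rightarrow> word" where
  "binary n = (if n = 0 then [] else (1 + n mod 2) # binary (n div 2))"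

declare binary.simps [simp del]

definition encode_number :: "nat \<Rightarrow> word" where
  "encode_number n = binary n @ [3]"


section \<open>The problem 3-SAT\<close>

datatype literal = Pos nat | Neg nat

fun literal_var :: "literal \<Rightarrow> nat" where
  "literal_var (Pos x) = x"
| "literal_var (Neg x) = x"

fun literal_true :: "(nat \<Rightarrow> bool) \<Rightarrow> literal \<Rightarrow> bool" where
  "literal_true \<alpha> (Pos x) \<longleftrightarrow> \<alpha> x"
| "literal_true \<alpha> (Neg x) \<longleftrightarrow> \<not> \<alpha> x"

type_synonym cnf = "literal list list"

definition cnf_vars :: "cnf \<Rightarrow> nat set" where
  "cnf_vars \<phi> = (\<Union>c \<in> set \<phi>. literal_var ` set c)"

definition satisfying_assignments :: "cnf \<Rightarrow> (nat \<Rightarrow> bool) set" where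
  "satisfying_assignments \<phi> =
     {\<alpha> \<in> cnf_vars \<phi> \<rightarrow>\<^sub>E UNIV. \<forall>c \<in> set \<phi>. \<exists>l \<in> set c. literal_true \<alpha> l}"

fun encode_literal :: "literal \<Rightarrow> word" where
  "encode_literal (Pos x) = 2 # encode_number x"
| "encode_literal (Neg x) = 1 # encode_number x"

definition encode_cnf :: "cnf \<Rightarrow> word" where
  "encode_cnf \<phi> = concat (map (\<lambda>c. concat (map encode_literal c) @ [4]) \<phi>)"

definition three_SAT :: "(cnf, nat \<Rightarrow> bool) problem" where
  "three_SAT = \<lparr>
     instances = {\<phi>. \<forall>c \<in> set \<phi>. length c \<le> 3},
     solutions = satisfying_assignments,
     encoding = encode_cnf\<rparr>"


section \<open>The problem Width6-Valency2-Maximal-Routing\<close>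

text \<open>
  A polarised switching circuit is presented by the list of the classes of its polarisation, the
  classes being lists of vertices, and by the list of its edges in the form
  \<open>(tail, out-label, head, in-label)\<close>. The edges themselves are the positions in the latter list.
\<close>

record routing_instance =
  class_list :: "nat list list"
  edge_list :: "(nat \<times> nat \<times> nat \<times> nat) list"
  threshold :: nat

definition circuit_of :: "routing_instance \<Rightarrow> (nat, nat) circuit" where
  "circuit_of I = \<lparr>
     graph = \<lparr>
       verts = (\<Union>c \<in> set (class_list I). set c),
       arcs = {..<length (edge_list I)},
       tail = (\<lambda>e. case edge_list I ! e of (u, i, v, j) \<Rightarrow> u),
       head = (\<lambda>e. case edge_list I ! e of (u, i, v, j) \<Rightarrow> v)\<rparr>,
     in_label = (\<lambda>e. case edge_list I ! e of (u, i, v, j) \<Rightarrow> j),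
     out_label = (\<lambda>e. case edge_list I ! e of (u, i, v, j) \<Rightarrow> i)\<rparr>"

definition polarisation_of :: "routing_instance \<Rightarrow> (nat \<times> nat) set" where
  "polarisation_of I = {(x, y). \<exists>c \<in> set (class_list I). x \<in> set c \<and> y \<in> set c}"

definition routing_solutions :: "routing_instance \<Rightarrow> (nat \<Rightarrow> nat \<Rightarrow> nat) set" where
  "routing_solutions I =
     {\<rho> \<in> routings (circuit_of I).
        respects_polarisation \<rho> (polarisation_of I) \<and>
        threshold I \<le> card (cycle_decomposition (circuit_of I) \<rho>)}"

fun encode_edge :: "nat \<times> nat \<times> nat \<times> nat \<Rightarrow> word" where
  "encode_edge (u, i, v, j) =
     encode_number u @ encode_number i @ encode_number v @ encode_number j"

definition encode_routing_instance :: "routing_instance \<Rightarrow> word" where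
  "encode_routing_instance I =
     concat (map (\<lambda>c. concat (map encode_number c) @ [4]) (class_list I)) @ [5] @
     concat (map encode_edge (edge_list I)) @ [5] @
     encode_number (threshold I)"

definition Width6_Valency2_Maximal_Routing ::
    "(routing_instance, nat \<Rightarrow> nat \<Rightarrow> nat) problem" where
  "Width6_Valency2_Maximal_Routing = \<lparr>
     instances = {I.
       switching_circuit (circuit_of I) \<and>
       polarisation (circuit_of I) (polarisation_of I) \<and>
       (\<forall>v \<in> verts (graph (circuit_of I)). valency (circuit_of I) v \<le> 2) \<and>
       (\<forall>X \<in> verts (graph (circuit_of I)) // polarisation_of I. card X \<le> 6) \<and>
       0 < threshold I},
     solutions = routing_solutions,
     encoding = encode_routing_instance\<rparr>"

end

theory Submission
  imports Defs
begin

text \<open>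
  Read a formula as the list of its literals, each clause being followed by an end marker. A row of
  classes \<open>(i, 0), \<dots>, (i, n)\<close> carries the value of the variable of the \<open>i\<close>-th token. Neighbours in a row
  are forced to agree by circuits on two vertices that have two cycles if the vertices are routed alike
  and one otherwise; the same circuits join the classes \<open>(i, j)\<close> and \<open>(j, i)\<close> if the tokens \<open>i\<close> and \<open>j\<close>
  have the same variable. So no class becomes large, however often a variable occurs. For each token,
  a circuit on six vertices attains its maximum of three cycles exactly if the truth value of the clause read so far is updated
  correctly. All gadgets are disjoint, so the number of cycles is the sum over the gadgets; the
  threshold is the sum of the maxima, and all auxiliary values are determined by the assignment.

  Since vertices may be arbitrary numbers, the node \<open>(r, i, j)\<close> is given a number whose binary notation
  spells \<open>r\<close>, \<open>i\<close> and \<open>j\<close> in unary. The instance can then be written down by two nested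
  loops over the tokens that only compare binary numerals and copy unary counters.
\<close>


section \<open>Counting orbits\<close>

text \<open>Polarisation alone cannot make all occurrences of a variable agree, since the width is
  bounded while a variable may occur any number of times; agreement is therefore bought with cycles.
  Parsimony adds the demand that a routing meeting the threshold contain no bit that the assignment
  leaves open. Hence the row of an end marker is forced to carry False, and a circuit of eight loops
  forces the clause value to be False before the first and after the last token; it sits on the four
  clause vertices that no token circuit meets.

  If two tokens have different variables, the linking circuit is placed on two vertices of one
  class, where it has two cycles for every admissible routing. Thus each pair of tokens contributes
  the same maximum, the threshold depends only on the number of tokens, and the machine treats all
  pairs alike without searching for the next occurrence of a variable.

  The maxima of the circuits are established by evaluation: the cycles of a permutation are counted
  by the elements that are least in their own orbit, which is decided by iterating a finite
  table.\<close>

lemma orbit_subset_closed: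
  assumes "f ` A \<subseteq> A" "x \<in> A"
  shows "orbit f x \<subseteq> A"
proof
  fix y assume "y \<in> orbit f x"
  then show "y \<in> A" by induction (use assms in auto)
qed

text \<open>A semiconjugacy carries orbits onto orbits. The intertwining is asked for on an
  invariant set only, since a wiring determines its successor map only on its own slots.\<close>

lemma orbit_image_conj:
  assumes cl: "f ` A \<subseteq> A" and conj: "\<And>x. x \<in> A \<Longrightarrow> g (h x) = h (f x)" and x: "x \<in> A"
  shows "orbit g (h x) = h ` orbit f x"
proof
  show "orbit g (h x) \<subseteq> h ` orbit f x"
  proof
    fix y assume "y \<in> orbit g (h x)"
    then show "y \<in> h ` orbit f x"
    proof induction
      case base
      show ?case unfolding conj[OF x] by (intro imageI orbit.base)
    next
      case (step y)
      then obtain z where z: "z \<in> orbit f x" "y = h z" by auto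
      then have "z \<in> A" using orbit_subset_closed[OF cl x] by auto
      then have "g y = h (f z)" using z(2) conj by simp
      then show ?case using orbit.step[OF z(1)] by simp
    qed
  qed
  show "h ` orbit f x \<subseteq> orbit g (h x)"
  proof clarify
    fix y assume "y \<in> orbit f x"
    then show "h y \<in> orbit g (h x)"
    proof induction
      case base
      show ?case unfolding conj[OF x, symmetric] by (rule orbit.base)
    next
      case (step y)
      then have "y \<in> A" using orbit_subset_closed[OF cl x] by auto
      then show ?case using orbit.step[OF step.IH] by (simp add: conj)
    qed
  qed
qed

lemma card_orbits_conj:
  assumes "f ` A \<subseteq> A" "\<And>x. x \<in> A \<Longrightarrow> g (h x) = h (f x)" "inj_on h A"
  shows "card (orbit g ` h ` A) = card (orbit f ` A)"
proof -
  have "orbit g ` h ` A = image h ` (orbit f ` A)"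
    unfolding image_image
    by (rule image_cong[OF refl], rule orbit_image_conj[of f A g h, OF assms(1,2)])
  moreover have "inj_on (image h) (orbit f ` A)"
    by (rule inj_on_image) (use orbit_subset_closed[OF assms(1)] in \<open>auto intro: inj_on_subset[OF assms(3)]\<close>)
  ultimately show ?thesis by (simp add: card_image)
qed

lemma orbits_cong:
  assumes "f ` A \<subseteq> A" "\<And>x. x \<in> A \<Longrightarrow> g x = f x"
  shows "orbit g ` A = orbit f ` A"
  by (rule image_cong[OF refl], rule orbit_image_conj[of f A g "\<lambda>x. x", unfolded image_ident])
    (use assms in auto)

text \<open>An orbit that starts in an invariant set stays there, and orbits are nonempty, so no
  orbit is counted on both sides.\<close>

lemma card_orbits_Un:
  assumes "f ` A \<subseteq> A" "f ` B \<subseteq> B" "A \<inter> B = {}" "finite A" "finite B"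
  shows "card (orbit f ` (A \<union> B)) = card (orbit f ` A) + card (orbit f ` B)"
proof -
  have "orbit f ` A \<inter> orbit f ` B = {}"
  proof (rule ccontr)
    assume "orbit f ` A \<inter> orbit f ` B \<noteq> {}"
    then obtain x y where "x \<in> A" "y \<in> B" "orbit f x = orbit f y" by auto
    then show False
      using orbit_subset_closed[OF assms(1), of x] orbit_subset_closed[OF assms(2), of y]
        orbit_nonempty[of f x] assms(3) by auto
  qed
  then show ?thesis using assms by (simp add: image_Un card_Un_disjoint)
qed

text \<open>A bounded search in place of a quantifier over the orbit: on numerals and an explicit
  table it unfolds by rewriting, and so the cycles of the gadgets can be counted.\<close>

fun least_along :: "(nat \<Rightarrow> nat) \<Rightarrow> nat \<Rightarrow> nat \<Rightarrow> nat \<Rightarrow> bool" where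
  "least_along f i 0 x \<longleftrightarrow> True"
| "least_along f i (Suc k) x \<longleftrightarrow> i \<le> x \<and> least_along f i k (f x)"

lemma least_along_iff: "least_along f i k x \<longleftrightarrow> (\<forall>m<k. i \<le> (f ^^ m) x)"
proof (induction k arbitrary: x)
  case (Suc k)
  have "(\<forall>m<Suc k. i \<le> (f ^^ m) x) \<longleftrightarrow> i \<le> x \<and> (\<forall>m<k. i \<le> (f ^^ Suc m) x)"
    by (auto simp: less_Suc_eq_0_disj)
  then show ?case by (simp only: least_along.simps Suc.IH funpow_Suc_right o_apply)
qed simp

text \<open>Pigeonhole: two of the \<open>n + 1\<close> iterates of \<open>x\<close> with exponents
  up to \<open>n\<close> coincide, and injectivity cancels the common initial part.\<close>

lemma bij_funpow_return:
  assumes "bij_betw f {..<n} {..<n}" "x < (n :: nat)"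
  shows "\<exists>m. 0 < m \<and> m \<le> n \<and> (f ^^ m) x = x"
proof -
  have cl: "(f ^^ k) y < n" if "y < n" for k y
    using that assms(1) by (induction k) (auto simp: bij_betw_def)
  have "\<not> inj_on (\<lambda>k. (f ^^ k) x) {..n}"
  proof
    assume "inj_on (\<lambda>k. (f ^^ k) x) {..n}"
    then have "card {..n} \<le> card {..<n}"
      by (rule card_inj_on_le) (use cl assms in auto)
    then show False by simp
  qed
  then obtain a b where ab: "a < b" "b \<le> n" "(f ^^ a) x = (f ^^ b) x"
    unfolding inj_on_def by (metis atMost_iff linorder_neqE_nat)
  have inj: "inj_on (f ^^ k) {..<n}" for k
    by (induction k)
      (use assms(1) cl in \<open>auto simp: inj_on_def bij_betw_def intro: inj_onD\<close>)
  have "(f ^^ b) x = (f ^^ a) ((f ^^ (b - a)) x)"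
    using ab by (metis funpow_add comp_apply le_add_diff_inverse less_imp_le)
  then have "(f ^^ (b - a)) x = x"
    using ab inj[of a] cl[OF assms(2)] assms(2) by (auto simp: inj_on_def)
  then show ?thesis using ab by (intro exI[of _ "b - a"]) auto
qed

text \<open>Every cycle has exactly one least element. Following \<open>f\<close> for
  \<open>n\<close> steps shows the whole cycle, because the return time is at most
  \<open>n\<close>.\<close>

lemma card_orbits_least:
  assumes bij: "bij_betw f {..<n} {..<n}"
  shows "card (orbit f ` {..<n}) = length (filter (\<lambda>i. least_along f i n i) [0..<n])"
proof -
  let ?S = "{i. i < n \<and> least_along f i n i}"
  have cl: "f ` {..<n} \<subseteq> {..<n}" using bij by (auto simp: bij_betw_def)
  have orb: "orbit f x = {(f ^^ m) x |m. m < n}" and self: "x \<in> orbit f x" if x: "x < n" for x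
  proof -
    obtain m where m: "0 < m" "m \<le> n" "(f ^^ m) x = x"
      using bij_funpow_return[OF bij x] by auto
    then show self: "x \<in> orbit f x" 
      unfolding orbit_altdef by (metis (mono_tags, lifting) mem_Collect_eq)
    have "orbit f x = {(f ^^ k) x |k. k < m}" by (rule orbit_altdef_bounded[OF m(3,1)])
    also have "\<dots> \<subseteq> {(f ^^ m) x |m. m < n}" using m by auto
    also have "\<dots> \<subseteq> orbit f x" by (auto intro: funpow_in_orbit self)
    finally show "orbit f x = {(f ^^ m) x |m. m < n}"
      using \<open>{(f ^^ m) x |m. m < n} \<subseteq> orbit f x\<close> by blast
  qed
  have least: "least_along f x n x \<longleftrightarrow> (\<forall>y \<in> orbit f x. x \<le> y)" if "x < n" for x
    by (auto simp: least_along_iff orb[OF that])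
  have eq: "orbit f y = orbit f x" if "x < n" "y \<in> orbit f x" for x y
  proof -
    have "y < n" using that orbit_subset_closed[OF cl, of x] by auto
    show ?thesis
      using that self[OF \<open>x < n\<close>] self[OF \<open>y < n\<close>] orbit_swap orbit_trans by (metis subsetI subset_antisym)
  qed
  have "bij_betw (orbit f) ?S (orbit f ` {..<n})"
  proof (rule bij_betw_imageI)
    show "inj_on (orbit f) ?S"
    proof (rule inj_onI)
      fix x y assume "x \<in> ?S" "y \<in> ?S" "orbit f x = orbit f y"
      then show "x = y" using least[of x] least[of y] self[of x] self[of y] by (metis antisym mem_Collect_eq)
    qed
    show "orbit f ` ?S = orbit f ` {..<n}"
    proof
      show "orbit f ` {..<n} \<subseteq> orbit f ` ?S"
      proof clarify
        fix x assume x: "x < n"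
        let ?y = "LEAST y. y \<in> orbit f x"
        have y: "?y \<in> orbit f x" using self[OF x] by (rule LeastI)
        then have yn: "?y < n" using orbit_subset_closed[OF cl, of x] x by auto
        have "least_along f ?y n ?y"
          using least[OF yn] eq[OF x y] by (auto intro: Least_le)
        then show "orbit f x \<in> orbit f ` ?S" using eq[OF x y] yn by (auto intro!: rev_image_eqI[of ?y])
      qed
    qed auto
  qed
  then have "card (orbit f ` {..<n}) = card ?S" by (metis bij_betw_same_card)
  also have "?S = set (filter (\<lambda>i. least_along f i n i) [0..<n])" by auto
  also have "card \<dots> = length (filter (\<lambda>i. least_along f i n i) [0..<n])"
    by (rule distinct_card) simp
  finally show ?thesis .
qed


section \<open>Wirings\<close>

text \<open>
  A wiring of a list of vertices of valency 2 is a permutation of the slots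
  \<open>0, \<dots>, 2k - 1\<close>: slot \<open>s\<close> stands for the label \<open>s mod 2 + 1\<close> at the vertex of position
  \<open>s div 2\<close>, and an edge joins the out-slot \<open>e\<close> to the in-slot \<open>\<sigma> ! e\<close>. A routing is
  represented by the booleans that tell at which vertices the two labels are swapped.
\<close>

definition edges_of :: "nat list \<Rightarrow> nat list \<Rightarrow> (nat \<times> nat \<times> nat \<times> nat) list" where
  "edges_of vs \<sigma> = map (\<lambda>e. (vs ! (e div 2), e mod 2 + 1, vs ! (\<sigma> ! e div 2), \<sigma> ! e mod 2 + 1))
     [0..<length \<sigma>]"

text \<open>Exchanges the two slots of one vertex; on labels this is the transposition of 1 and
  2.\<close>

definition flip :: "nat \<Rightarrow> nat" where
  "flip s = (if even s then Suc s else s - 1)"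

definition wire_next :: "nat list \<Rightarrow> bool list \<Rightarrow> nat \<Rightarrow> nat" where
  "wire_next \<sigma> bs e = (if bs ! (\<sigma> ! e div 2) then flip (\<sigma> ! e) else \<sigma> ! e)"

definition wire_cycles :: "nat list \<Rightarrow> bool list \<Rightarrow> nat" where
  "wire_cycles \<sigma> bs = card (orbit (wire_next \<sigma> bs) ` {..<length \<sigma>})"

text \<open>Of \<open>vs\<close> only the length enters. Its type is left open because the list is
  taken to be the vertices, the booleans of a routing, or the pieces that spell the
  vertices.\<close>

definition wiring :: "nat list \<Rightarrow> 'a list \<Rightarrow> bool" where
  "wiring \<sigma> vs \<longleftrightarrow> distinct \<sigma> \<and> set \<sigma> = {..<length \<sigma>} \<and> length \<sigma> = 2 * length vs"

lemma flip_flip [simp]: "flip (flip s) = s"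
  by (auto simp: flip_def elim: oddE)

lemma flip_div [simp]: "flip s div 2 = s div 2"
  by (auto simp: flip_def elim!: evenE oddE)

lemma flip_less: "s < 2 * k \<Longrightarrow> flip s < 2 * k"
  by (auto simp: flip_def elim!: evenE oddE)

lemma flip_add: "even a \<Longrightarrow> flip (a + s) = a + flip s"
  by (auto simp: flip_def elim!: evenE oddE)

lemma wiring_nth_less: "wiring \<sigma> vs \<Longrightarrow> e < length \<sigma> \<Longrightarrow> \<sigma> ! e < length \<sigma>"
  unfolding wiring_def by (metis lessThan_iff nth_mem)

lemma wire_next_less: "wiring \<sigma> vs \<Longrightarrow> e < length \<sigma> \<Longrightarrow> wire_next \<sigma> bs e < length \<sigma>"
  using wiring_nth_less[of \<sigma> vs e] by (auto simp: wire_next_def wiring_def flip_less)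

text \<open>A swap keeps the vertex of a slot, so the vertex at which an edge arrives can be read
  off its successor; this determines the boolean, and the swap can be undone.\<close>

lemma wire_next_bij:
  assumes "wiring \<sigma> vs"
  shows "bij_betw (wire_next \<sigma> bs) {..<length \<sigma>} {..<length \<sigma>}"
proof -
  have "inj_on (wire_next \<sigma> bs) {..<length \<sigma>}"
  proof (rule inj_onI)
    fix x y assume xy: "x \<in> {..<length \<sigma>}" "y \<in> {..<length \<sigma>}" "wire_next \<sigma> bs x = wire_next \<sigma> bs y"
    have "wire_next \<sigma> bs x div 2 = \<sigma> ! x div 2" "wire_next \<sigma> bs y div 2 = \<sigma> ! y div 2"
      by (auto simp: wire_next_def)
    then have "\<sigma> ! x = \<sigma> ! y" using xy(3) by (metis flip_flip wire_next_def)
    then show "x = y" using assms xy by (auto simp: wiring_def nth_eq_iff_index_eq)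
  qed
  moreover have "wire_next \<sigma> bs ` {..<length \<sigma>} \<subseteq> {..<length \<sigma>}"
    using wire_next_less[OF assms] by auto
  ultimately show ?thesis by (simp add: bij_betw_def endo_inj_surj)
qed

lemma wire_cycles_least:
  assumes "wiring \<sigma> vs"
  shows "wire_cycles \<sigma> bs =
    length (filter (\<lambda>i. least_along (wire_next \<sigma> bs) i (length \<sigma>) i) [0..<length \<sigma>])"
  unfolding wire_cycles_def by (rule card_orbits_least[OF wire_next_bij[OF assms]])

lemma wiring_append:
  assumes "wiring \<sigma> us" "wiring \<tau> vs"
  shows "wiring (\<sigma> @ map ((+) (length \<sigma>)) \<tau>) (us @ vs)"
proof -
  have "(+) (length \<sigma>) ` {..<length \<tau>} = {length \<sigma>..<length \<sigma> + length \<tau>}"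
    by (simp add: lessThan_atLeast0 add.commute)
  then show ?thesis using assms by (simp add: wiring_def distinct_map ivl_disj_un(8) ivl_disj_int ivl_disj_un_one)
qed

text \<open>Both blocks of slots are invariant, and on the second block the shift by
  \<open>length \<sigma>\<close> is a conjugacy. It commutes with \<open>flip\<close> because this
  length is even.\<close>

lemma wire_cycles_append:
  assumes "wiring \<sigma> bs" "wiring \<tau> cs"
  shows "wire_cycles (\<sigma> @ map ((+) (length \<sigma>)) \<tau>) (bs @ cs) = wire_cycles \<sigma> bs + wire_cycles \<tau> cs"
proof -
  let ?\<sigma> = "\<sigma> @ map ((+) (length \<sigma>)) \<tau>"
  let ?f = "wire_next ?\<sigma> (bs @ cs)"
  have l: "length \<sigma> = 2 * length bs" using assms by (simp add: wiring_def)
  have A: "?f e = wire_next \<sigma> bs e" if "e < length \<sigma>" for e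
    using wiring_nth_less[OF assms(1) that] that l
    by (auto simp: wire_next_def nth_append)
  have B: "?f (length \<sigma> + e) = length \<sigma> + wire_next \<tau> cs e" if "e < length \<tau>" for e
  proof -
    have "(length \<sigma> + \<tau> ! e) div 2 = length bs + \<tau> ! e div 2" using l by simp
    then show ?thesis using that l by (auto simp: wire_next_def nth_append flip_add)
  qed
  have i: "(+) (length \<sigma>) ` {..<length \<tau>} = {length \<sigma>..<length \<sigma> + length \<tau>}"
    by (simp add: lessThan_atLeast0 add.commute)
  have clA: "wire_next \<sigma> bs ` {..<length \<sigma>} \<subseteq> {..<length \<sigma>}"
    using wire_next_less[OF assms(1)] by auto
  have clB: "wire_next \<tau> cs ` {..<length \<tau>} \<subseteq> {..<length \<tau>}"
    using wire_next_less[OF assms(2)] by auto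
  have "wire_cycles ?\<sigma> (bs @ cs) = card (orbit ?f ` ({..<length \<sigma>} \<union> (+) (length \<sigma>) ` {..<length \<tau>}))"
    unfolding wire_cycles_def i by (rule arg_cong[where f = "\<lambda>A. card (orbit ?f ` A)"]) auto
  also have "\<dots> = card (orbit ?f ` {..<length \<sigma>}) + card (orbit ?f ` (+) (length \<sigma>) ` {..<length \<tau>})"
    by (rule card_orbits_Un) (use A B clA clB in \<open>auto simp: image_image\<close>)
  also have "card (orbit ?f ` {..<length \<sigma>}) = wire_cycles \<sigma> bs"
    unfolding wire_cycles_def using orbits_cong[of "wire_next \<sigma> bs" "{..<length \<sigma>}" ?f] A clA by simp
  also have "card (orbit ?f ` (+) (length \<sigma>) ` {..<length \<tau>}) = wire_cycles \<tau> cs"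
    unfolding wire_cycles_def by (rule card_orbits_conj) (use B clB in auto)
  finally show ?thesis .
qed

lemma edges_of_append:
  assumes "wiring \<sigma> us" "wiring \<tau> vs"
  shows "edges_of (us @ vs) (\<sigma> @ map ((+) (length \<sigma>)) \<tau>) = edges_of us \<sigma> @ edges_of vs \<tau>"
proof (rule nth_equalityI)
  fix e assume "e < length (edges_of (us @ vs) (\<sigma> @ map ((+) (length \<sigma>)) \<tau>))"
  then have e: "e < length \<sigma> + length \<tau>" by (simp add: edges_of_def)
  have l: "length \<sigma> = 2 * length us" using assms by (simp add: wiring_def)
  show "edges_of (us @ vs) (\<sigma> @ map ((+) (length \<sigma>)) \<tau>) ! e = (edges_of us \<sigma> @ edges_of vs \<tau>) ! e"
  proof (cases "e < length \<sigma>")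
    case True
    then show ?thesis using wiring_nth_less[OF assms(1) True] l e
      by (auto simp: edges_of_def nth_append)
  next
    case False
    define d where "d = e - length \<sigma>"
    have d: "e = length \<sigma> + d" "d < length \<tau>" using False e by (auto simp: d_def)
    have "(length \<sigma> + d) div 2 = length us + d div 2" "(length \<sigma> + \<tau> ! d) div 2 = length us + \<tau> ! d div 2"
      "(length \<sigma> + d) mod 2 = d mod 2" "(length \<sigma> + \<tau> ! d) mod 2 = \<tau> ! d mod 2"
      using l by auto
    then show ?thesis
      unfolding edges_of_def d(1) nth_append_length_plus length_map length_append
      using d(2) by (simp only: nth_append_length_plus nth_map nth_upt length_upt length_map length_append
        nth_append add_less_cancel_left not_add_less1 if_False add_0 diff_zero add_diff_cancel_left')
  qed
qed (simp add: edges_of_def)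

text \<open>The disjoint union of circuits, each wiring being shifted past the slots of the earlier
  ones. Edges and cycles are additive over it.\<close>

fun join_wirings :: "nat list list \<Rightarrow> nat list" where
  "join_wirings [] = []"
| "join_wirings (\<sigma> # \<sigma>s) = \<sigma> @ map ((+) (length \<sigma>)) (join_wirings \<sigma>s)"

lemma wiring_join:
  assumes "\<forall>(\<sigma>, vs) \<in> set gs. wiring \<sigma> vs"
  shows "wiring (join_wirings (map fst gs)) (concat (map snd gs))"
  using assms
proof (induction gs)
  case Nil
  then show ?case by (simp add: wiring_def)
next
  case (Cons g gs)
  then show ?case by (cases g) (simp add: wiring_append)
qed

lemma edges_of_join:
  assumes "\<forall>(\<sigma>, vs) \<in> set gs. wiring \<sigma> vs"
  shows "edges_of (concat (map snd gs)) (join_wirings (map fst gs)) =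
    concat (map (\<lambda>(\<sigma>, vs). edges_of vs \<sigma>) gs)"
  using assms
proof (induction gs)
  case Nil
  then show ?case by (simp add: edges_of_def)
next
  case (Cons g gs)
  then show ?case by (cases g) (simp add: edges_of_append wiring_join)
qed

lemma wiring_map [simp]: "wiring \<sigma> (map b vs) \<longleftrightarrow> wiring \<sigma> vs"
  by (simp add: wiring_def)

lemma wire_cycles_join:
  assumes "\<forall>(\<sigma>, vs) \<in> set gs. wiring \<sigma> vs"
  shows "wire_cycles (join_wirings (map fst gs)) (map b (concat (map snd gs))) =
    (\<Sum>(\<sigma>, vs) \<leftarrow> gs. wire_cycles \<sigma> (map b vs))"
  using assms
proof (induction gs)
  case Nil
  then show ?case by (simp add: wire_cycles_def)
next
  case (Cons g gs)
  then show ?case using wiring_join[of gs] by (cases g) (simp add: wire_cycles_append)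
qed


section \<open>Circuits of valency 2 given by a wiring\<close>

lemma permutes_1_2:
  assumes "p permutes {1..2::nat}"
  shows "p = id \<or> p = transpose 1 2"
proof -
  have "{1..2::nat} = {1, 2}" by auto
  then have p: "p permutes {1, 2}" using assms by simp
  have "p 1 \<in> {1, 2}" "p 2 \<in> {1, 2}" using permutes_in_image[OF p] by (metis insertI1 insertI2)+
  moreover have "p 1 \<noteq> p 2" using inj_eq[OF permutes_inj[OF p], of 1 2] by simp
  moreover have "p x = x" if "x \<noteq> 1" "x \<noteq> 2" for x using p that by (auto simp: permutes_def)
  ultimately show ?thesis unfolding fun_eq_iff transpose_def id_def by (metis insertE singletonD)
qed

lemma transpose_1_2_neq_id: "transpose 1 (2 :: nat) \<noteq> id"
  by (metis id_apply one_eq_numeral_iff semiring_norm(83) transpose_apply_first)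

lemma transpose_1_2_permutes: "transpose 1 2 permutes {1..2 :: nat}"
  by (rule permutes_swap_id) auto

text \<open>An edge is identified with its out-slot: edge \<open>e\<close> of the circuit is slot
  \<open>e\<close> of the wiring, and the map \<open>next_arc\<close> of a routing becomes
  \<open>wire_next\<close> on the same set of numbers.\<close>

locale wired_instance =
  fixes I :: routing_instance and V \<sigma> :: "nat list"
  assumes W: "wiring \<sigma> V" and V: "distinct V"
    and E: "edge_list I = edges_of V \<sigma>"
    and classes: "(\<Union>c \<in> set (class_list I). set c) = set V"
begin

abbreviation C where "C \<equiv> circuit_of I"

lemma verts_C [simp]: "verts (graph C) = set V"
  using classes by (simp add: circuit_of_def)

lemma arcs_C [simp]: "arcs (graph C) = {..<length \<sigma>}"
  by (simp add: circuit_of_def E edges_of_def)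

lemma edge_C:
  assumes "e < length \<sigma>"
  shows "tail (graph C) e = V ! (e div 2)" "head (graph C) e = V ! (\<sigma> ! e div 2)"
    "out_label C e = e mod 2 + 1" "in_label C e = \<sigma> ! e mod 2 + 1"
  using assms by (simp_all add: circuit_of_def E edges_of_def)

lemma length_\<sigma>: "length \<sigma> = 2 * length V"
  using W by (simp add: wiring_def)

lemma \<sigma>_less: "e < length \<sigma> \<Longrightarrow> \<sigma> ! e < 2 * length V"
  using wiring_nth_less[OF W] by (simp add: length_\<sigma>)

lemma \<sigma>_inj: "e < length \<sigma> \<Longrightarrow> e' < length \<sigma> \<Longrightarrow> \<sigma> ! e = \<sigma> ! e' \<longleftrightarrow> e = e'"
  using W by (simp add: wiring_def nth_eq_iff_index_eq)

lemma \<sigma>_surj: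
  assumes "s < 2 * length V"
  obtains e where "e < length \<sigma>" "\<sigma> ! e = s"
proof -
  have "s \<in> set \<sigma>" using assms W by (simp add: wiring_def)
  then show ?thesis using that by (auto simp: in_set_conv_nth)
qed

lemma V_eq: "x < 2 * length V \<Longrightarrow> k < length V \<Longrightarrow> V ! (x div 2) = V ! k \<longleftrightarrow> x div 2 = k"
  using V by (subst nth_eq_iff_index_eq) auto

lemma out_arcs_C:
  assumes "k < length V"
  shows "out_arcs (graph C) (V ! k) = {2 * k, 2 * k + 1}"
  using assms V_eq by (auto simp: out_arcs_def edge_C length_\<sigma>)

lemma in_arcs_C:
  assumes "k < length V"
  shows "in_arcs (graph C) (V ! k) = {e. e < length \<sigma> \<and> \<sigma> ! e div 2 = k}"
  using assms V_eq \<sigma>_less by (auto simp: in_arcs_def edge_C)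

lemma out_label_bij:
  assumes "k < length V"
  shows "bij_betw (out_label C) (out_arcs (graph C) (V ! k)) {1..2}"
proof -
  have "2 * k < length \<sigma>" "2 * k + 1 < length \<sigma>" using assms by (auto simp: length_\<sigma>)
  then show ?thesis
    by (auto simp: out_arcs_C[OF assms] bij_betw_def edge_C)
qed

lemma in_label_bij:
  assumes "k < length V"
  shows "bij_betw (in_label C) (in_arcs (graph C) (V ! k)) {1..2}"
proof (rule bij_betw_imageI)
  show "inj_on (in_label C) (in_arcs (graph C) (V ! k))"
  proof (rule inj_onI)
    fix x y assume "x \<in> in_arcs (graph C) (V ! k)" "y \<in> in_arcs (graph C) (V ! k)"
      and "in_label C x = in_label C y"
    then have xy: "x < length \<sigma>" "y < length \<sigma>" "\<sigma> ! x div 2 = \<sigma> ! y div 2" "\<sigma> ! x mod 2 = \<sigma> ! y mod 2"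
      by (auto simp: in_arcs_C[OF assms] edge_C)
    then have "\<sigma> ! x = \<sigma> ! y" by (metis div_mult_mod_eq)
    then show "x = y" using xy \<sigma>_inj by blast
  qed
  show "in_label C ` in_arcs (graph C) (V ! k) = {1..2}"
  proof
    show "in_label C ` in_arcs (graph C) (V ! k) \<subseteq> {1..2}"
      by (auto simp: in_arcs_C[OF assms] edge_C)
    show "{1..2} \<subseteq> in_label C ` in_arcs (graph C) (V ! k)"
    proof
      fix l :: nat assume l: "l \<in> {1..2}"
      \<comment> \<open>Labels start at 1, so label \<open>l\<close> at position \<open>k\<close> is
        the slot \<open>2 * k + (l - 1)\<close>.\<close>
      then have "2 * k + (l - 1) < 2 * length V" using assms by auto
      then obtain e where e: "e < length \<sigma>" "\<sigma> ! e = 2 * k + (l - 1)" by (rule \<sigma>_surj)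
      from l consider "l = 1" | "l = 2" by fastforce
      then have "\<sigma> ! e div 2 = k \<and> \<sigma> ! e mod 2 + 1 = l" using e(2) by cases simp_all
      then have "e \<in> in_arcs (graph C) (V ! k)" "in_label C e = l"
        using e(1) by (simp_all add: in_arcs_C[OF assms] edge_C)
      then show "l \<in> in_label C ` in_arcs (graph C) (V ! k)" by blast
    qed
  qed
qed

lemma valency_C: "v \<in> set V \<Longrightarrow> valency C v = 2"
  using bij_betw_same_card[OF in_label_bij] by (auto simp: in_set_conv_nth in_degree_def)

lemma out_degree_C: "v \<in> set V \<Longrightarrow> out_degree (graph C) v = 2"
  using bij_betw_same_card[OF out_label_bij] by (auto simp: in_set_conv_nth out_degree_def)

lemma switching_circuit_C: "switching_circuit C"
proof -
  have "fin_digraph (graph C)"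
    by unfold_locales
      (use \<sigma>_less in \<open>fastforce simp: edge_C length_\<sigma> less_mult_imp_div_less mult.commute\<close>)+
  then show ?thesis
    using in_label_bij out_label_bij
    by (auto simp: switching_circuit_def valency_C out_degree_C in_set_conv_nth)
qed

lemma routings_C: "routings C = (\<Pi>\<^sub>E v \<in> set V. {id, transpose 1 2})"
proof -
  have "{p. p permutes {1..valency C v}} = {id, transpose 1 2}" if "v \<in> set V" for v
    using permutes_1_2 transpose_1_2_permutes permutes_id valency_C[OF that] by auto
  then show ?thesis unfolding routings_def verts_C by (rule PiE_cong)
qed

text \<open>With valency 2 a routing is one bit per vertex: \<open>\<rho> v \<noteq> id\<close> says
  that the two labels are swapped at \<open>v\<close>.\<close>

lemma next_arc_C:
  assumes "\<rho> \<in> routings C" "e < length \<sigma>"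
  shows "next_arc C \<rho> e = wire_next \<sigma> (map (\<lambda>v. \<rho> v \<noteq> id) V) e"
proof -
  define k where "k = \<sigma> ! e div 2"
  have k: "k < length V" using \<sigma>_less[OF assms(2)] by (auto simp: k_def)
  let ?n = "wire_next \<sigma> (map (\<lambda>v. \<rho> v \<noteq> id) V) e"
  have \<rho>: "\<rho> (V ! k) = id \<or> \<rho> (V ! k) = transpose 1 2"
    using assms(1) k by (auto simp: routings_C)
  have s: "\<sigma> ! e = 2 * k \<or> \<sigma> ! e = 2 * k + 1" by (auto simp: k_def)
  have n: "?n \<in> out_arcs (graph C) (V ! k) \<and> out_label C ?n = \<rho> (V ! k) (in_label C e)"
  proof -
    have "2 * k < length \<sigma>" "2 * k + 1 < length \<sigma>" using k by (auto simp: length_\<sigma>)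
    then show ?thesis
      using s \<rho> k transpose_1_2_neq_id
      by (auto simp: out_arcs_C edge_C assms(2) wire_next_def flip_def transpose_def)
  qed
  have "next_arc C \<rho> e = (THE e'. e' \<in> out_arcs (graph C) (V ! k) \<and>
      out_label C e' = \<rho> (V ! k) (in_label C e))"
    by (simp add: next_arc_def edge_C assms(2) k_def Let_def)
  also have "\<dots> = ?n"
    using n bij_betw_imp_inj_on[OF out_label_bij[OF k]] by (intro the_equality) (metis inj_onD)+
  finally show ?thesis .
qed

lemma card_cycle_decomposition:
  assumes "\<rho> \<in> routings C"
  shows "card (cycle_decomposition C \<rho>) = wire_cycles \<sigma> (map (\<lambda>v. \<rho> v \<noteq> id) V)"
proof -
  have "orbit (next_arc C \<rho>) ` {..<length \<sigma>} = orbit (wire_next \<sigma> (map (\<lambda>v. \<rho> v \<noteq> id) V)) ` {..<length \<sigma>}"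
    by (rule orbits_cong) (use next_arc_C[OF assms] wire_next_less[OF W] in auto)
  then show ?thesis by (simp add: cycle_decomposition_def wire_cycles_def)
qed

end


section \<open>The gadgets\<close>

text \<open>A table of \<open>wire_next\<close>, so that evaluation looks successors up instead of
  computing them anew.\<close>

definition next_list :: "nat list \<Rightarrow> bool list \<Rightarrow> nat list" where
  "next_list \<sigma> bs = map (\<lambda>s. if bs ! (s div 2) then flip s else s) \<sigma>"

fun count_least :: "nat list \<Rightarrow> nat \<Rightarrow> nat" where
  "count_least l 0 = 0"
| "count_least l (Suc i) = of_bool (least_along ((!) l) i (length l) i) + count_least l i"

lemma least_along_numeral:
  "least_along f i (numeral v) x \<longleftrightarrow> i \<le> x \<and> least_along f i (pred_numeral v) (f x)"
  by (simp add: numeral_eq_Suc)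

lemma count_least_numeral:
  "count_least l (numeral v) =
    of_bool (least_along ((!) l) (pred_numeral v) (length l) (pred_numeral v)) + count_least l (pred_numeral v)"
  by (simp add: numeral_eq_Suc)

lemma least_along_cong:
  assumes "\<And>y. y < n \<Longrightarrow> f y = g y \<and> f y < n" "x < n"
  shows "least_along f i k x \<longleftrightarrow> least_along g i k x"
  using assms(2)
proof (induction k arbitrary: x)
  case (Suc k)
  then have "f x = g x" "g x < n" using assms(1)[of x] by auto
  then show ?case using Suc.IH[of "g x"] by simp
qed simp

lemma wire_cycles_count_least:
  assumes "wiring \<sigma> vs"
  shows "wire_cycles \<sigma> bs = count_least (next_list \<sigma> bs) (length \<sigma>)"
proof -
  let ?l = "next_list \<sigma> bs"
  have "least_along (wire_next \<sigma> bs) i (length \<sigma>) i \<longleftrightarrow> least_along ((!) ?l) i (length ?l) i"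
    if "i < length \<sigma>" for i
    using least_along_cong[of "length \<sigma>" "wire_next \<sigma> bs" "(!) ?l" i i "length \<sigma>"]
      wire_next_less[OF assms] that by (simp add: next_list_def wire_next_def)
  then have "wire_cycles \<sigma> bs = length (filter (\<lambda>i. least_along ((!) ?l) i (length ?l) i) [0..<length \<sigma>])"
    unfolding wire_cycles_least[OF assms] by (intro arg_cong[where f = length] filter_cong) auto
  also have "length (filter (\<lambda>i. least_along ((!) ?l) i (length ?l) i) [0..<k]) = count_least ?l k" for k
    by (induction k) auto
  finally show ?thesis .
qed

lemmas wire_cycles_compute =
  least_along_numeral count_least_numeral next_list_def flip_def

text \<open>Two vertices joined by two parallel edges in each direction. Going there and back
  applies both routings to the label: this is the identity, with two cycles, if they agree, and the
  transposition, with one cycle, otherwise.\<close>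

definition eq_wire :: "nat list" where
  "eq_wire = [2, 3, 0, 1]"

text \<open>Each of four vertices carries two loops, which are separate cycles if the vertex is not
  swapped and merge into one if it is. So the maximum 8 forces all four vertices to carry
  False.\<close>

definition loop_wire :: "nat list" where
  "loop_wire = [0, 1, 2, 3, 4, 5, 6, 7]"

datatype token = Lit literal | End

text \<open>Found by computer search; \<open>token_ok\<close> describes the routings with the maximal number of cycles, where
  the six vertices carry the values \<open>s, s, t, t, p, n\<close>.\<close>

fun token_wire :: "token \<Rightarrow> nat list" where
  "token_wire (Lit (Pos x)) = [3, 11, 4, 9, 10, 6, 0, 1, 7, 5, 2, 8]"
| "token_wire (Lit (Neg x)) = [3, 10, 4, 8, 11, 6, 0, 1, 7, 5, 2, 9]"
| "token_wire End = [7, 10, 0, 5, 6, 8, 3, 11, 2, 1, 4, 9]"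

fun token_ok :: "token \<Rightarrow> bool \<Rightarrow> bool \<Rightarrow> bool \<Rightarrow> bool \<Rightarrow> bool" where
  "token_ok (Lit (Pos x)) s t p n \<longleftrightarrow> p = n \<and> t = (s \<or> p)"
| "token_ok (Lit (Neg x)) s t p n \<longleftrightarrow> p = n \<and> t = (s \<or> \<not> p)"
| "token_ok End s t p n \<longleftrightarrow> s \<and> \<not> t \<and> \<not> p \<and> \<not> n"

lemma wiringI:
  assumes "distinct \<sigma>" "\<forall>s \<in> set \<sigma>. s < length \<sigma>" "length \<sigma> = 2 * length vs"
  shows "wiring \<sigma> vs"
proof -
  have "set \<sigma> = {..<length \<sigma>}"
    using assms by (intro card_subset_eq) (auto simp: distinct_card)
  then show ?thesis using assms by (simp add: wiring_def)
qed

lemma wiring_eq_wire: "wiring eq_wire [u, v]"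
  by (rule wiringI) (simp_all add: eq_wire_def)

lemma wiring_loop_wire: "wiring loop_wire [u, v, w, x]"
  by (rule wiringI) (simp_all add: loop_wire_def)

lemma wiring_token_wire: "wiring (token_wire t) [u, v, w, x, y, z]"
  by (rule wiringI; cases t rule: token_wire.cases; simp)

lemma wire_cycles_eq_wire: "wire_cycles eq_wire [x, y] = (if x = y then 2 else 1)"
  unfolding wire_cycles_count_least[OF wiring_eq_wire]
  unfolding eq_wire_def
  by (cases x; cases y; simp add: wire_cycles_compute)

lemma wire_cycles_loop_wire:
  "wire_cycles loop_wire [x, y, z, w] = 8 - (of_bool x + of_bool y + of_bool z + of_bool w)"
  unfolding wire_cycles_count_least[OF wiring_loop_wire]
  unfolding loop_wire_def
  by (cases x; cases y; cases z; cases w; simp add: wire_cycles_compute)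

text \<open>Evaluation of all sixteen settings for each of the three wirings. The wiring for a
  negated variable is the one for the plain variable with the entries 8 and 9, and 10 and 11,
  interchanged, which negates the roles of \<open>p\<close> and \<open>n\<close>. For
  \<open>End\<close> a single setting attains 3: the clause value is True before and False after,
  and the row is pinned to False.\<close>

lemma wire_cycles_token_wire:
  "wire_cycles (token_wire t) [s, s, t', t', p, n] \<le> 3 \<and>
    (wire_cycles (token_wire t) [s, s, t', t', p, n] = 3 \<longleftrightarrow> token_ok t s t' p n)"
  unfolding wire_cycles_count_least[OF wiring_token_wire]
  by (cases t rule: token_wire.cases; cases s; cases t'; cases p; cases n; simp add: wire_cycles_compute)


section \<open>Vertex numbers\<close>

text \<open>The bijection from pairs onto the positive integers by 2-adic valuation and odd part.
  With the least significant digit first, its binary notation is \<open>k\<close> zeros, a one, and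
  then the notation of \<open>x\<close>.\<close>

definition pair_code :: "nat \<Rightarrow> nat \<Rightarrow> nat" where
  "pair_code k x = 2 ^ k * (2 * x + 1)"

lemma pair_code_0: "pair_code 0 x = 2 * x + 1"
  and pair_code_Suc: "pair_code (Suc k) x = 2 * pair_code k x"
  by (simp_all add: pair_code_def)

text \<open>Parity decides whether the exponent is 0; otherwise both sides can be halved.\<close>

lemma pair_code_eq_iff [simp]: "pair_code k x = pair_code k' x' \<longleftrightarrow> k = k' \<and> x = x'"
proof (induction k arbitrary: k')
  case 0
  have "2 * x + 1 \<noteq> 2 * y" for y by presburger
  then show ?case by (cases k') (auto simp: pair_code_0 pair_code_Suc)
next
  case (Suc k)
  have "2 * y \<noteq> 2 * x' + 1" for y by presburger
  then show ?case using Suc by (cases k') (auto simp: pair_code_0 pair_code_Suc)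
qed

definition node :: "nat \<Rightarrow> nat \<Rightarrow> nat \<Rightarrow> nat" where
  "node r i j = pair_code r (pair_code i (pair_code j 0))"

lemma node_eq_iff [simp]: "node r i j = node r' i' j' \<longleftrightarrow> r = r' \<and> i = i' \<and> j = j'"
  by (simp add: node_def)

text \<open>Pattern matching on node numbers. The triple is unique by \<open>node_eq_iff\<close>;
  the value at other numbers is left unspecified.\<close>

definition node_case :: "(nat \<Rightarrow> nat \<Rightarrow> nat \<Rightarrow> 'a) \<Rightarrow> nat \<Rightarrow> 'a" where
  "node_case f v = (THE x. \<exists>r i j. v = node r i j \<and> x = f r i j)"

lemma node_case_node [simp]: "node_case f (node r i j) = f r i j"
  unfolding node_case_def by (rule the_equality) auto


section \<open>The reduction\<close>

text \<open>
  The \<open>i\<close>-th token has a row of classes \<open>(i, 0), \<dots>, (i, n)\<close>, all of which carry the value of the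
  literal's variable. The class \<open>(i, j)\<close> consists of the nodes \<open>0\<close> and \<open>1\<close>, which link it to
  its neighbours in the row (or, at the ends of the row, to the gadget of the token), and of the nodes
  \<open>2\<close> and \<open>3\<close>, which link it to the class \<open>(j, i)\<close> if the two tokens have the same variable. The nodes
  \<open>4, \<dots>, 7\<close> with indices \<open>i\<close> and \<open>0\<close> form a class carrying the truth value of the part of
  the current clause that precedes the \<open>i\<close>-th token.
\<close>

definition tokens :: "cnf \<Rightarrow> token list" where
  "tokens \<phi> = concat (map (\<lambda>c. map Lit c @ [End]) \<phi>)"

text \<open>All end markers share the key \<open>None\<close>, so their rows are linked to each
  other as well; this is consistent, since each of these rows has to carry False.\<close>

fun key :: "token \<Rightarrow> nat option" where
  "key (Lit l) = Some (literal_var l)"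
| "key End = None"

definition row_class :: "nat \<Rightarrow> nat \<Rightarrow> nat list" where
  "row_class i j = [node 0 i j, node 1 i j, node 2 i j, node 3 i j]"

text \<open>Column \<open>n\<close> closes the row. It has no transposed class to be linked to,
  hence no nodes 2 and 3: node 0 ends the chain and node 1 goes to the gadget of the token.\<close>

definition last_class :: "nat \<Rightarrow> nat \<Rightarrow> nat list" where
  "last_class n i = [node 0 i n, node 1 i n]"

definition clause_class :: "nat \<Rightarrow> nat list" where
  "clause_class i = [node 4 i 0, node 5 i 0, node 6 i 0, node 7 i 0]"

definition class_lists :: "nat \<Rightarrow> nat list list" where
  "class_lists n = clause_class 0 #
     concat (map (\<lambda>i. map (row_class i) [0..<n] @ [last_class n i, clause_class (Suc i)]) [0..<n])"

text \<open>\<open>node 3 a b\<close> is met by cell \<open>(b, a)\<close> if the tokens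
  \<open>a\<close> and \<open>b\<close> have equal keys, and by cell \<open>(a, b)\<close> if not.
  In the latter case both ends of the link lie in one class, where they agree automatically.\<close>

definition cell_gadgets :: "token list \<Rightarrow> nat \<Rightarrow> nat \<Rightarrow> (nat list \<times> nat list) list" where
  "cell_gadgets ts i j =
     [(eq_wire, [node 1 i j, node 0 i (Suc j)]),
      (eq_wire, [node 2 i j, if key (ts ! i) = key (ts ! j) then node 3 j i else node 3 i j])]"

text \<open>Leads from the clause value at index \<open>i\<close> to the one at
  \<open>Suc i\<close>. The value of the token is taken from both ends of its row, that is, from the
  two nodes that the chain leaves over.\<close>

definition token_gadget :: "token list \<Rightarrow> nat \<Rightarrow> nat list \<times> nat list" where
  "token_gadget ts i = (token_wire (ts ! i),
     [node 4 i 0, node 5 i 0, node 6 (Suc i) 0, node 7 (Suc i) 0, node 0 i 0, node 1 i (length ts)])"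

text \<open>The token gadgets meet the nodes 4 and 5 for indices below \<open>n\<close> and the
  nodes 6 and 7 for positive indices; these four nodes remain.\<close>

definition final_gadget :: "nat \<Rightarrow> nat list \<times> nat list" where
  "final_gadget n = (loop_wire, [node 6 0 0, node 7 0 0, node 4 n 0, node 5 n 0])"

definition row_gadgets :: "token list \<Rightarrow> nat \<Rightarrow> (nat list \<times> nat list) list" where
  "row_gadgets ts i = concat (map (cell_gadgets ts i) [0..<length ts]) @ [token_gadget ts i]"

definition gadgets :: "token list \<Rightarrow> (nat list \<times> nat list) list" where
  "gadgets ts = concat (map (row_gadgets ts) [0..<length ts]) @ [final_gadget (length ts)]"

text \<open>Eight cycles from the loops, three for each token, and twice two for each of the
  \<open>n * n\<close> cells.\<close>

definition max_cycles :: "nat \<Rightarrow> nat" where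
  "max_cycles n = 8 + 3 * n + 4 * n * n"

definition reduction :: "token list \<Rightarrow> routing_instance" where
  "reduction ts = \<lparr>class_list = class_lists (length ts),
     edge_list = concat (map (\<lambda>(\<sigma>, vs). edges_of vs \<sigma>) (gadgets ts)),
     threshold = max_cycles (length ts)\<rparr>"

section \<open>Each vertex lies in exactly one class and in exactly one gadget\<close>

definition valid_node :: "nat \<Rightarrow> nat \<Rightarrow> nat \<Rightarrow> nat \<Rightarrow> bool" where
  "valid_node n r i j \<longleftrightarrow>
     r < 4 \<and> i < n \<and> j < n \<or> r < 2 \<and> i < n \<and> j = n \<or> 4 \<le> r \<and> r < 8 \<and> i \<le> n \<and> j = 0"

definition nodes :: "nat \<Rightarrow> nat set" where
  "nodes n = {node r i j |r i j. valid_node n r i j}"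

lemma nodes_iff [simp]: "node r i j \<in> nodes n \<longleftrightarrow> valid_node n r i j"
  by (auto simp: nodes_def)

lemma less_4: "r < (4 :: nat) \<longleftrightarrow> r = 0 \<or> r = 1 \<or> r = 2 \<or> r = 3"
  by auto

lemma range_4_8: "4 \<le> r \<and> r < (8 :: nat) \<longleftrightarrow> r = 4 \<or> r = 5 \<or> r = 6 \<or> r = 7"
  by auto

lemma set_class_lists:
  "set (class_lists n) =
    {row_class i j |i j. i < n \<and> j < n} \<union> {last_class n i |i. i < n} \<union> {clause_class i |i. i \<le> n}"
proof -
  have "{clause_class i |i. i \<le> n} = insert (clause_class 0) {clause_class (Suc i) |i. i < n}"
    by (auto simp: image_iff less_Suc_eq_0_disj simp flip: less_Suc_eq_le)
  then show ?thesis by (auto simp: class_lists_def)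
qed

definition row_of :: "nat \<Rightarrow> bool \<times> nat \<times> nat" where
  "row_of = node_case (\<lambda>r i j. (r < 4, i, j))"

lemma same_class_iff:
  "(\<exists>c \<in> set (class_lists n). x \<in> set c \<and> y \<in> set c) \<longleftrightarrow>
    x \<in> nodes n \<and> y \<in> nodes n \<and> row_of x = row_of y" (is "?L \<longleftrightarrow> ?R")
proof
  assume ?L
  then show ?R
    by (auto simp: set_class_lists row_class_def last_class_def clause_class_def valid_node_def row_of_def)
next
  assume ?R
  then obtain r i j r' where x: "x = node r i j" "valid_node n r i j" and y: "y = node r' i j"
    "valid_node n r' i j" "r < 4 \<longleftrightarrow> r' < 4"
    by (auto simp: nodes_def row_of_def)
  consider "4 \<le> r" | "r < 4" "j < n" | "r < 4" "j = n" using x by (fastforce simp: valid_node_def)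
  then show ?L
  proof cases
    case 1
    then have "4 \<le> r \<and> r < 8" "4 \<le> r' \<and> r' < 8" "i \<le> n" "j = 0"
      using x y by (auto simp: valid_node_def)
    then have "clause_class i \<in> set (class_lists n) \<and> x \<in> set (clause_class i) \<and> y \<in> set (clause_class i)"
      using x(1) y(1) unfolding range_4_8 by (auto simp: set_class_lists clause_class_def)
    then show ?thesis by blast
  next
    case 2
    then have "r < 4" "r' < 4" "i < n" using x y by (auto simp: valid_node_def)
    then have "row_class i j \<in> set (class_lists n) \<and> x \<in> set (row_class i j) \<and> y \<in> set (row_class i j)"
      using x(1) y(1) 2 unfolding less_4 by (auto simp: set_class_lists row_class_def)
    then show ?thesis by blast
  next
    case 3
    then have "r = 0 \<or> r = 1" "r' = 0 \<or> r' = 1" "i < n" using x y by (auto simp: valid_node_def)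
    then have "last_class n i \<in> set (class_lists n) \<and> x \<in> set (last_class n i) \<and> y \<in> set (last_class n i)"
      using x(1) y(1) 3 by (auto simp: set_class_lists last_class_def)
    then show ?thesis by blast
  qed
qed

lemma Union_classes: "(\<Union>c \<in> set (class_lists n). set c) = nodes n"
  using same_class_iff[of n x x for x] by blast

lemma wiring_gadgets: "\<forall>(\<sigma>, vs) \<in> set (gadgets ts). wiring \<sigma> vs"
  by (auto simp: gadgets_def row_gadgets_def cell_gadgets_def token_gadget_def final_gadget_def
      wiring_eq_wire wiring_loop_wire wiring_token_wire)

definition cell_nodes :: "token list \<Rightarrow> nat \<Rightarrow> nat \<Rightarrow> nat list" where
  "cell_nodes ts i j = [node 1 i j, node 0 i (Suc j), node 2 i j,
     if key (ts ! i) = key (ts ! j) then node 3 j i else node 3 i j]"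

definition token_nodes :: "token list \<Rightarrow> nat \<Rightarrow> nat list" where
  "token_nodes ts i = [node 4 i 0, node 5 i 0, node 6 (Suc i) 0, node 7 (Suc i) 0, node 0 i 0, node 1 i (length ts)]"

lemma snd_gadgets:
  "concat (map snd (gadgets ts)) =
    concat (map (\<lambda>i. concat (map (cell_nodes ts i) [0..<length ts]) @ token_nodes ts i) [0..<length ts]) @
    [node 6 0 0, node 7 0 0, node 4 (length ts) 0, node 5 (length ts) 0]"
proof -
  have c: "concat (map snd (cell_gadgets ts i j)) = cell_nodes ts i j" for i j
    by (simp add: cell_gadgets_def cell_nodes_def)
  have m: "concat (map snd (concat (map f xs))) = concat (map (\<lambda>x. concat (map snd (f x))) xs)"
    for f :: "nat \<Rightarrow> (nat list \<times> nat list) list" and xs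
    by (induction xs) auto
  have "concat (map snd (row_gadgets ts i)) = concat (map (cell_nodes ts i) [0..<length ts]) @ token_nodes ts i" for i
    by (simp add: row_gadgets_def m c token_gadget_def token_nodes_def)
  then show ?thesis by (simp add: gadgets_def m final_gadget_def)
qed

lemma distinct_concat_map:
  assumes "distinct xs" "\<And>x. x \<in> set xs \<Longrightarrow> distinct (f x)"
    and "\<And>x y. x \<in> set xs \<Longrightarrow> y \<in> set xs \<Longrightarrow> x \<noteq> y \<Longrightarrow> set (f x) \<inter> set (f y) = {}"
  shows "distinct (concat (map f xs))"
  using assms
proof (induction xs)
  case (Cons x xs)
  have "set (f x) \<inter> set (f y) = {}" if "y \<in> set xs" for y
    using Cons.prems(1) that by (intro Cons.prems(3)) auto
  then have "set (f x) \<inter> set (concat (map f xs)) = {}" by auto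
  moreover have "distinct (concat (map f xs))" using Cons.prems by (intro Cons.IH) auto
  ultimately show ?case using Cons.prems(2)[of x] by simp
qed simp

text \<open>The delicate case is node 3: the cells \<open>(i, j)\<close> and \<open>(j, i)\<close>
  compare the same two keys and hence take the same branch, so they cannot meet the same node 3
  unless they coincide.\<close>

lemma distinct_gadgets: "distinct (concat (map snd (gadgets ts)))"
proof -
  let ?n = "length ts"
  let ?row = "\<lambda>i. concat (map (cell_nodes ts i) [0..<?n]) @ token_nodes ts i"
  have "distinct (concat (map (cell_nodes ts i) [0..<?n]))" if "i < ?n" for i
    by (rule distinct_concat_map) (auto simp: cell_nodes_def)
  then have "distinct (?row i)" if "i < ?n" for i
    using that by (auto simp: cell_nodes_def token_nodes_def)
  moreover have "set (?row i) \<inter> set (?row j) = {}" if "i < ?n" "j < ?n" "i \<noteq> j" for i j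
    using that by (auto simp: cell_nodes_def token_nodes_def split: if_splits)
  ultimately have "distinct (concat (map ?row [0..<?n]))"
    by (intro distinct_concat_map) auto
  then show ?thesis
    unfolding snd_gadgets by (auto simp: cell_nodes_def token_nodes_def split: if_splits)
qed

lemma set_gadgets: "set (concat (map snd (gadgets ts))) = nodes (length ts)" (is "?A = _")
proof
  let ?n = "length ts"
  show "?A \<subseteq> nodes ?n"
    unfolding snd_gadgets by (auto simp: cell_nodes_def token_nodes_def valid_node_def split: if_splits)
  show "nodes ?n \<subseteq> ?A"
  proof
    fix v assume "v \<in> nodes ?n"
    then obtain r i j where v: "v = node r i j" "valid_node ?n r i j" by (auto simp: nodes_def)
    have cell: "w \<in> ?A" if "i < ?n" "j < ?n" "w \<in> set (cell_nodes ts i j)" for w i j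
      unfolding snd_gadgets using that by auto
    have tok: "w \<in> ?A" if "i < ?n" "w \<in> set (token_nodes ts i)" for w i
      unfolding snd_gadgets using that by auto
    have fin: "w \<in> ?A" if "w \<in> {node 6 0 0, node 7 0 0, node 4 ?n 0, node 5 ?n 0}" for w
      unfolding snd_gadgets using that by auto
    from v(2) have "r < 4 \<or> 4 \<le> r \<and> r < 8" by (auto simp: valid_node_def)
    then consider "r = 0" | "r = 1" | "r = 2" | "r = 3" | "r = 4 \<or> r = 5" | "r = 6 \<or> r = 7"
      unfolding range_4_8 less_4 by auto
    then show "v \<in> ?A"
    proof cases
      case 1
      \<comment> \<open>Node 0 of column 0 is met by the token gadget, node 0 of a later column by
        the chain link of the preceding cell.\<close>
      then show ?thesis using v tok[of i v] cell[of i "j - 1" v]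
        by (cases j) (auto simp: valid_node_def token_nodes_def cell_nodes_def)
    next
      case 2
      then show ?thesis using v tok[of i v] cell[of i j v]
        by (auto simp: valid_node_def token_nodes_def cell_nodes_def)
    next
      case 3
      then show ?thesis using v cell[of i j v] by (auto simp: valid_node_def cell_nodes_def)
    next
      case 4
      then have ij: "i < ?n" "j < ?n" using v by (auto simp: valid_node_def)
      show ?thesis
      proof (cases "key (ts ! j) = key (ts ! i)")
        case True
        show ?thesis by (rule cell[OF ij(2,1)]) (simp add: cell_nodes_def True v(1) 4)
      next
        case False
        show ?thesis by (rule cell[OF ij]) (simp add: cell_nodes_def False[symmetric] v(1) 4)
      qed
    next
      case 5
      then show ?thesis using v tok[of i v] fin[of v]
        by (cases "i = ?n") (auto simp: valid_node_def token_nodes_def)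
    next
      case 6
      then show ?thesis using v tok[of "i - 1" v] fin[of v]
        by (cases i) (auto simp: valid_node_def token_nodes_def)
    qed
  qed
qed

section \<open>Reaching the threshold means maximality in every gadget\<close>

lemma sum_list_ge_iff:
  assumes "\<And>x. x \<in> set xs \<Longrightarrow> f x \<le> (g x :: nat)"
  shows "sum_list (map g xs) \<le> sum_list (map f xs) \<longleftrightarrow> (\<forall>x \<in> set xs. f x = g x)"
  using assms
proof (induction xs)
  case (Cons x xs)
  have "sum_list (map f xs) \<le> sum_list (map g xs)" by (rule sum_list_mono) (use Cons.prems in auto)
  moreover have "f x \<le> g x" using Cons.prems by auto
  moreover have "sum_list (map g xs) \<le> sum_list (map f xs) \<longleftrightarrow> (\<forall>x \<in> set xs. f x = g x)"
    using Cons.prems by (intro Cons.IH) auto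
  ultimately have "sum_list (map g (x # xs)) \<le> sum_list (map f (x # xs)) \<longleftrightarrow>
      f x = g x \<and> (\<forall>x \<in> set xs. f x = g x)"
    unfolding list.map sum_list.Cons by linarith
  then show ?case by simp
qed simp


text \<open>The kind of a gadget is recognised from its wiring, which is why the wirings are shown
  to be different.\<close>

definition gadget_max :: "nat list \<times> nat list \<Rightarrow> nat" where
  "gadget_max g = (if fst g = eq_wire then 2 else if fst g = loop_wire then 8 else 3)"

lemma token_wire_neq: "token_wire t \<noteq> eq_wire" "token_wire t \<noteq> loop_wire"
  by (cases t rule: token_wire.cases; simp add: eq_wire_def loop_wire_def)+

lemma loop_wire_neq: "loop_wire \<noteq> eq_wire"
  by (simp add: eq_wire_def loop_wire_def)

lemma sum_gadget_max: "sum_list (map gadget_max (gadgets ts)) = max_cycles (length ts)"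
proof -
  have c: "sum_list (map f (concat xss)) = sum_list (map (\<lambda>xs. sum_list (map f xs)) xss)"
    for f :: "nat list \<times> nat list \<Rightarrow> nat" and xss
    by (induction xss) auto
  have "sum_list (map gadget_max (cell_gadgets ts i j)) = 4" for i j
    by (simp add: cell_gadgets_def gadget_max_def)
  then have "sum_list (map gadget_max (row_gadgets ts i)) = 4 * length ts + 3" for i
    by (simp add: row_gadgets_def c o_def sum_list_triv token_gadget_def gadget_max_def token_wire_neq)
  then show ?thesis
    by (simp add: gadgets_def c o_def sum_list_triv final_gadget_def gadget_max_def loop_wire_neq
        max_cycles_def algebra_simps)
qed

interpretation wired_instance "reduction ts" "concat (map snd (gadgets ts))"
  "join_wirings (map fst (gadgets ts))" for ts
  by unfold_locales
    (use wiring_join[OF wiring_gadgets] distinct_gadgets edges_of_join[OF wiring_gadgets] set_gadgets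
      Union_classes in \<open>simp_all add: reduction_def del: set_concat\<close>)

lemma polarisation_of_reduction:
  "polarisation_of (reduction ts) =
    {(x, y). x \<in> nodes (length ts) \<and> y \<in> nodes (length ts) \<and> row_of x = row_of y}"
  by (simp add: polarisation_of_def reduction_def same_class_iff)

text \<open>Nodes 5 and 7 share their classes with nodes 4 and 6 of the same index, so the doubled
  inputs of a token gadget and of the final gadget are represented by one node each.\<close>

definition gadgets_ok :: "token list \<Rightarrow> (nat \<Rightarrow> bool) \<Rightarrow> bool" where
  "gadgets_ok ts b \<longleftrightarrow>
     (let n = length ts in
      (\<forall>i < n. \<forall>j < n. b (node 1 i j) = b (node 0 i (Suc j)) \<and>
        b (node 2 i j) = b (if key (ts ! i) = key (ts ! j) then node 3 j i else node 3 i j)) \<and>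
      (\<forall>i < n. token_ok (ts ! i) (b (node 4 i 0)) (b (node 6 (Suc i) 0)) (b (node 0 i 0)) (b (node 1 i n))) \<and>
      \<not> b (node 6 0 0) \<and> \<not> b (node 4 n 0))"

lemma ball_gadgets:
  "(\<forall>g \<in> set (gadgets ts). Q g) \<longleftrightarrow>
    (\<forall>i < length ts. (\<forall>j < length ts. \<forall>g \<in> set (cell_gadgets ts i j). Q g) \<and> Q (token_gadget ts i)) \<and>
    Q (final_gadget (length ts))"
  unfolding gadgets_def row_gadgets_def by auto

text \<open>No gadget exceeds its maximum, so a total reaching the sum of the maxima reaches each of
  them. The polarisation enters through \<open>s\<close>, which provides the doubled inputs for
  which the token wirings were evaluated.\<close>

lemma max_cycles_iff:
  assumes \<rho>: "\<rho> \<in> routings (circuit_of (reduction ts))"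
    and resp: "respects_polarisation \<rho> (polarisation_of (reduction ts))"
  shows "max_cycles (length ts) \<le> card (cycle_decomposition (circuit_of (reduction ts)) \<rho>) \<longleftrightarrow>
    gadgets_ok ts (\<lambda>v. \<rho> v \<noteq> id)"
proof -
  define b where "b = (\<lambda>v. \<rho> v \<noteq> id)"
  define c where "c = (\<lambda>(\<sigma>, vs). wire_cycles \<sigma> (map b vs))"
  let ?n = "length ts"
  have r: "b x = b y" if "x \<in> nodes ?n" "y \<in> nodes ?n" "row_of x = row_of y" for x y
  proof -
    have "\<rho> x = \<rho> y"
      using resp that unfolding respects_polarisation_def polarisation_of_reduction by blast
    then show ?thesis by (simp add: b_def)
  qed
  have s: "b (node 5 i 0) = b (node 4 i 0)" "b (node 7 i 0) = b (node 6 i 0)" if "i \<le> ?n" for i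
    by (rule r; use that in \<open>simp add: valid_node_def row_of_def\<close>)+
  have tok: "c (token_gadget ts i) = wire_cycles (token_wire (ts ! i))
      [b (node 4 i 0), b (node 4 i 0), b (node 6 (Suc i) 0), b (node 6 (Suc i) 0), b (node 0 i 0), b (node 1 i ?n)]"
    if "i < ?n" for i
    using that s[of i] s[of "Suc i"] by (simp add: c_def token_gadget_def)
  have gm: "gadget_max (token_gadget ts i) = 3" for i
    by (simp add: gadget_max_def token_gadget_def token_wire_neq)
  have fin: "c (final_gadget ?n) = 8 - (2 * of_bool (b (node 6 0 0)) + 2 * of_bool (b (node 4 ?n 0)))"
    "gadget_max (final_gadget ?n) = 8"
    using s[of 0] s[of ?n]
    by (simp_all add: c_def final_gadget_def wire_cycles_loop_wire gadget_max_def loop_wire_neq)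
  have cell: "c (eq_wire, [x, y]) = (if b x = b y then 2 else 1)" "gadget_max (eq_wire, [x, y]) = 2" for x y
    by (simp_all add: c_def wire_cycles_eq_wire gadget_max_def)
  have "card (cycle_decomposition (circuit_of (reduction ts)) \<rho>) = sum_list (map c (gadgets ts))"
    unfolding card_cycle_decomposition[OF \<rho>] wire_cycles_join[OF wiring_gadgets] c_def b_def ..
  moreover have "\<forall>g \<in> set (gadgets ts). c g \<le> gadget_max g"
    unfolding ball_gadgets by (auto simp: cell_gadgets_def cell fin tok gm wire_cycles_token_wire)
  ultimately have "max_cycles ?n \<le> card (cycle_decomposition (circuit_of (reduction ts)) \<rho>) \<longleftrightarrow>
      (\<forall>g \<in> set (gadgets ts). c g = gadget_max g)"
    unfolding sum_gadget_max[symmetric] by (simp add: sum_list_ge_iff)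
  also have "\<dots> \<longleftrightarrow> (\<forall>i < ?n. (\<forall>j < ?n. \<forall>g \<in> set (cell_gadgets ts i j). c g = gadget_max g) \<and>
      c (token_gadget ts i) = gadget_max (token_gadget ts i)) \<and>
      c (final_gadget ?n) = gadget_max (final_gadget ?n)"
    unfolding ball_gadgets ..
  also have "\<dots> \<longleftrightarrow> gadgets_ok ts b"
    by (auto simp: gadgets_ok_def cell_gadgets_def cell fin tok gm wire_cycles_token_wire Let_def)
  finally show ?thesis by (simp add: b_def)
qed


section \<open>Parsimony\<close>

fun clause_step :: "(nat \<Rightarrow> bool) \<Rightarrow> token \<Rightarrow> bool \<Rightarrow> bool" where
  "clause_step \<alpha> (Lit l) s \<longleftrightarrow> s \<or> literal_true \<alpha> l"
| "clause_step \<alpha> End s \<longleftrightarrow> False"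

definition clause_state :: "(nat \<Rightarrow> bool) \<Rightarrow> token list \<Rightarrow> nat \<Rightarrow> bool" where
  "clause_state \<alpha> ts i = fold (clause_step \<alpha>) (take i ts) False"

definition token_value :: "(nat \<Rightarrow> bool) \<Rightarrow> token \<Rightarrow> bool" where
  "token_value \<alpha> t = (case key t of None \<Rightarrow> False | Some x \<Rightarrow> \<alpha> x)"

text \<open>An automaton whose state is the truth value of the current clause. It mediates between
  the quantifiers over clauses and literals and the condition imposed at each end marker.\<close>

fun accepts :: "(nat \<Rightarrow> bool) \<Rightarrow> bool \<Rightarrow> token list \<Rightarrow> bool" where
  "accepts \<alpha> s [] \<longleftrightarrow> True"
| "accepts \<alpha> s (Lit l # ts) \<longleftrightarrow> accepts \<alpha> (s \<or> literal_true \<alpha> l) ts"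
| "accepts \<alpha> s (End # ts) \<longleftrightarrow> s \<and> accepts \<alpha> False ts"

lemma accepts_iff:
  "accepts \<alpha> s ts \<longleftrightarrow> (\<forall>i < length ts. ts ! i = End \<longrightarrow> fold (clause_step \<alpha>) (take i ts) s)"
proof (induction \<alpha> s ts rule: accepts.induct)
  case (2 \<alpha> s l ts)
  show ?case unfolding accepts.simps 2 by (auto simp: less_Suc_eq_0_disj)
next
  case (3 \<alpha> s ts)
  show ?case unfolding accepts.simps 3 by (auto simp: less_Suc_eq_0_disj)
qed simp

lemma accepts_clause:
  "accepts \<alpha> s (map Lit c @ End # ts) \<longleftrightarrow> (s \<or> (\<exists>l \<in> set c. literal_true \<alpha> l)) \<and> accepts \<alpha> False ts"
  by (induction c arbitrary: s) auto

lemma accepts_tokens: "accepts \<alpha> False (tokens \<phi>) \<longleftrightarrow> (\<forall>c \<in> set \<phi>. \<exists>l \<in> set c. literal_true \<alpha> l)"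
  by (induction \<phi>) (simp_all add: tokens_def accepts_clause)

text \<open>The tokens of a formula are an empty list or end with \<open>End\<close>, which resets
  the state; the loops at index \<open>n\<close> demand just this.\<close>

lemma clause_state_length: "\<not> clause_state \<alpha> (tokens \<phi>) (length (tokens \<phi>))"
proof -
  have "fold (clause_step \<alpha>) (tokens \<phi>) False = False"
    by (induction \<phi>) (simp_all add: tokens_def)
  then show ?thesis by (simp add: clause_state_def)
qed

lemma clause_state_0: "\<not> clause_state \<alpha> ts 0"
  by (simp add: clause_state_def)

lemma clause_state_Suc:
  "i < length ts \<Longrightarrow> clause_state \<alpha> ts (Suc i) = clause_step \<alpha> (ts ! i) (clause_state \<alpha> ts i)"
  by (simp add: clause_state_def take_Suc_conv_app_nth)

lemma cnf_vars_tokens: "cnf_vars \<phi> = {x. \<exists>i < length (tokens \<phi>). key (tokens \<phi> ! i) = Some x}"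
proof -
  have "key ` set (tokens \<phi>) = (\<Union>c \<in> set \<phi>. insert None (Some ` literal_var ` set c))"
    by (simp add: tokens_def image_UN image_image Un_commute)
  then have "cnf_vars \<phi> = {x. Some x \<in> key ` set (tokens \<phi>)}"
    by (auto simp: cnf_vars_def)
  also have "\<dots> = {x. \<exists>i < length (tokens \<phi>). key (tokens \<phi> ! i) = Some x}"
    by (auto simp: in_set_conv_nth image_iff) (metis nth_mem)+
  finally show ?thesis .
qed

lemma satisfying_assignments_iff:
  "\<alpha> \<in> satisfying_assignments \<phi> \<longleftrightarrow> \<alpha> \<in> extensional (cnf_vars \<phi>) \<and>
    (\<forall>i < length (tokens \<phi>). tokens \<phi> ! i = End \<longrightarrow> clause_state \<alpha> (tokens \<phi>) i)"
  using accepts_tokens[of \<alpha> \<phi>] unfolding accepts_iff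
  by (simp add: satisfying_assignments_def PiE_def clause_state_def)

section \<open>Satisfying assignments correspond to optimal routings\<close>

definition node_value :: "(nat \<Rightarrow> bool) \<Rightarrow> token list \<Rightarrow> nat \<Rightarrow> bool" where
  "node_value \<alpha> ts = node_case (\<lambda>r i j. if r < 4 then token_value \<alpha> (ts ! i) else clause_state \<alpha> ts i)"

definition assignment_routing :: "token list \<Rightarrow> (nat \<Rightarrow> bool) \<Rightarrow> nat \<Rightarrow> nat \<Rightarrow> nat" where
  "assignment_routing ts \<alpha> =
     (\<lambda>v \<in> nodes (length ts). if node_value \<alpha> ts v then transpose 1 2 else id)"

lemma routings_reduction: "routings (circuit_of (reduction ts)) = (\<Pi>\<^sub>E v \<in> nodes (length ts). {id, transpose 1 2})"
  using routings_C[of ts] unfolding set_gadgets .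

lemma routing_solutions_reduction:
  "\<rho> \<in> routing_solutions (reduction ts) \<longleftrightarrow>
    \<rho> \<in> (\<Pi>\<^sub>E v \<in> nodes (length ts). {id, transpose 1 2}) \<and>
    (\<forall>x \<in> nodes (length ts). \<forall>y \<in> nodes (length ts). row_of x = row_of y \<longrightarrow> \<rho> x = \<rho> y) \<and>
    gadgets_ok ts (\<lambda>v. \<rho> v \<noteq> id)"
proof -
  have "respects_polarisation \<rho> (polarisation_of (reduction ts)) \<longleftrightarrow>
    (\<forall>x \<in> nodes (length ts). \<forall>y \<in> nodes (length ts). row_of x = row_of y \<longrightarrow> \<rho> x = \<rho> y)"
    unfolding respects_polarisation_def polarisation_of_reduction by blast
  moreover have "threshold (reduction ts) = max_cycles (length ts)" by (simp add: reduction_def)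
  ultimately show ?thesis
    unfolding routing_solutions_def mem_Collect_eq using max_cycles_iff[of \<rho> ts]
    by (auto simp: routings_reduction)
qed

text \<open>A routing is \<open>undefined\<close> outside the nodes, where nothing relates it to
  \<open>node_value\<close>; so it matters that only nodes are inspected.\<close>

lemma gadgets_ok_cong:
  assumes "\<And>v. v \<in> nodes (length ts) \<Longrightarrow> b v = b' v"
  shows "gadgets_ok ts b = gadgets_ok ts b'"
proof -
  have v: "b (node r i j) = b' (node r i j)" if "valid_node (length ts) r i j" for r i j
    by (rule assms) (simp add: that)
  have "b (node r i j) = b' (node r i j)" if "r < 4" "i < length ts" "j < length ts" for r i j
    by (rule v) (use that in \<open>simp add: valid_node_def\<close>)
  moreover have "b (node 0 i (Suc j)) = b' (node 0 i (Suc j))" if "i < length ts" "j < length ts" for i j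
    by (rule v) (use that in \<open>auto simp: valid_node_def\<close>)
  moreover have "b (node 0 i 0) = b' (node 0 i 0)" "b (node 1 i (length ts)) = b' (node 1 i (length ts))"
    if "i < length ts" for i
    by (rule v; use that in \<open>auto simp: valid_node_def\<close>)+
  moreover have "b (node 6 (Suc i) 0) = b' (node 6 (Suc i) 0)" if "i < length ts" for i
    by (rule v) (use that in \<open>auto simp: valid_node_def\<close>)
  moreover have "b (node r i 0) = b' (node r i 0)" if "r = 4 \<or> r = 6" "i \<le> length ts" for r i
    by (rule v) (use that in \<open>auto simp: valid_node_def\<close>)
  ultimately show ?thesis by (simp add: gadgets_ok_def Let_def del: One_nat_def)
qed

lemma token_ok_value:
  assumes "t = End \<longrightarrow> s"
  shows "token_ok t s (clause_step \<alpha> t s) (token_value \<alpha> t) (token_value \<alpha> t)"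
  using assms by (cases t rule: token_wire.cases) (auto simp: token_value_def)

text \<open>The new clause value is forced by the old one and the assignment; this keeps the clause
  classes from adding solutions.\<close>

lemma token_ok_step:
  assumes "token_ok t s s' p n" "p = token_value \<alpha> t"
  shows "s' = clause_step \<alpha> t s"
  using assms by (cases t rule: token_wire.cases) (auto simp: token_value_def)

lemma assignment_routing_solution:
  assumes "\<alpha> \<in> satisfying_assignments \<phi>"
  shows "assignment_routing (tokens \<phi>) \<alpha> \<in> routing_solutions (reduction (tokens \<phi>))"
proof -
  let ?ts = "tokens \<phi>" and ?\<rho> = "assignment_routing (tokens \<phi>) \<alpha>"
  have "gadgets_ok ?ts (\<lambda>v. ?\<rho> v \<noteq> id) = gadgets_ok ?ts (node_value \<alpha> ?ts)"
    by (rule gadgets_ok_cong) (use transpose_1_2_neq_id in \<open>simp add: assignment_routing_def\<close>)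
  moreover have "gadgets_ok ?ts (node_value \<alpha> ?ts)"
    using assms clause_state_0 clause_state_length token_ok_value
    by (auto simp: gadgets_ok_def Let_def node_value_def satisfying_assignments_iff clause_state_Suc
        token_value_def)
  moreover have "?\<rho> x = ?\<rho> y"
    if "x \<in> nodes (length ?ts)" "y \<in> nodes (length ?ts)" "row_of x = row_of y" for x y
  proof -
    have "node_value \<alpha> ?ts x = node_value \<alpha> ?ts y"
      using that by (auto simp: nodes_def row_of_def node_value_def)
    then show ?thesis by (simp only: assignment_routing_def restrict_apply' that(1,2))
  qed
  moreover have "?\<rho> \<in> (\<Pi>\<^sub>E v \<in> nodes (length ?ts). {id, transpose 1 2})"
    by (auto simp: assignment_routing_def)
  ultimately show ?thesis
    unfolding routing_solutions_reduction by blast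
qed

text \<open>The value of a variable is visible at \<open>node 0 i 0\<close> for any token
  \<open>i\<close> in which it occurs.\<close>

lemma assignment_routing_inj: "inj_on (assignment_routing (tokens \<phi>)) (satisfying_assignments \<phi>)"
proof (rule inj_onI)
  fix \<alpha> \<beta>
  assume \<alpha>: "\<alpha> \<in> satisfying_assignments \<phi>" and \<beta>: "\<beta> \<in> satisfying_assignments \<phi>"
    and eq: "assignment_routing (tokens \<phi>) \<alpha> = assignment_routing (tokens \<phi>) \<beta>"
  let ?ts = "tokens \<phi>"
  have "\<alpha> x = \<beta> x" if "x \<in> cnf_vars \<phi>" for x
  proof -
    from that obtain i where i: "i < length ?ts" "key (?ts ! i) = Some x"
      unfolding cnf_vars_tokens by auto
    then have "node 0 i 0 \<in> nodes (length ?ts)" by (auto simp: valid_node_def)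
    then have "node_value \<alpha> ?ts (node 0 i 0) = node_value \<beta> ?ts (node 0 i 0)"
      using fun_cong[OF eq, of "node 0 i 0"] transpose_1_2_neq_id
      by (auto simp: assignment_routing_def split: if_splits)
    then show ?thesis using i by (simp add: node_value_def token_value_def)
  qed
  then show "\<alpha> = \<beta>"
    using \<alpha> \<beta> unfolding satisfying_assignments_iff by (intro extensionalityI[of _ "cnf_vars \<phi>"]) auto
qed

text \<open>The value is constant along each row, and two rows with the same key meet in transposed
  classes, so an assignment can be read off. The clause values follow by induction from the False at
  index 0.\<close>

lemma routing_solution_is_assignment_routing:
  assumes "\<rho> \<in> routing_solutions (reduction (tokens \<phi>))"
  shows "\<exists>\<alpha> \<in> satisfying_assignments \<phi>. assignment_routing (tokens \<phi>) \<alpha> = \<rho>"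
proof -
  let ?ts = "tokens \<phi>"
  let ?n = "length ?ts"
  define b where "b = (\<lambda>v. \<rho> v \<noteq> id)"
  have ext: "\<rho> \<in> (\<Pi>\<^sub>E v \<in> nodes ?n. {id, transpose 1 2})"
    and resp: "\<And>x y. x \<in> nodes ?n \<Longrightarrow> y \<in> nodes ?n \<Longrightarrow> row_of x = row_of y \<Longrightarrow> b x = b y"
    and ok: "gadgets_ok ?ts b"
    using assms unfolding routing_solutions_reduction b_def by metis+
  have ok1: "b (node 1 i j) = b (node 0 i (Suc j))"
    and ok2: "b (node 2 i j) = b (if key (?ts ! i) = key (?ts ! j) then node 3 j i else node 3 i j)"
    if "i < ?n" "j < ?n" for i j
    using ok that unfolding gadgets_ok_def Let_def by blast+
  have ok3: "token_ok (?ts ! i) (b (node 4 i 0)) (b (node 6 (Suc i) 0)) (b (node 0 i 0)) (b (node 1 i ?n))"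
    if "i < ?n" for i
    using ok that unfolding gadgets_ok_def Let_def by blast
  have ok4: "\<not> b (node 6 0 0)" using ok unfolding gadgets_ok_def Let_def by blast
  have row: "b (node r i j) = b (node 0 i j)" if "r < 4" "i < ?n" "j < ?n" for r i j
    by (rule resp) (use that in \<open>auto simp: valid_node_def row_of_def\<close>)
  have clause: "b (node r i 0) = b (node 6 i 0)" if "4 \<le> r" "r < 8" "i \<le> ?n" for r i
    by (rule resp) (use that in \<open>auto simp: valid_node_def row_of_def\<close>)
  have chain: "b (node 0 i j) = b (node 0 i 0)" if "i < ?n" "j \<le> ?n" for i j
    using that(2)
  proof (induction j)
    case (Suc j)
    then show ?case using ok1[OF that(1), of j] row[of 1 i j] that(1) by simp
  qed simp
  have last: "b (node 1 i ?n) = b (node 0 i ?n)" if "i < ?n" for i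
    by (rule resp) (use that in \<open>auto simp: valid_node_def row_of_def\<close>)
  have same: "b (node 0 i 0) = b (node 0 j 0)" if "i < ?n" "j < ?n" "key (?ts ! i) = key (?ts ! j)" for i j
  proof -
    have "b (node 0 i 0) = b (node 2 i j)" using chain[of i j] row[of 2 i j] that by simp
    also have "\<dots> = b (node 3 j i)" using ok2[of i j] that by simp
    also have "\<dots> = b (node 0 j 0)" using chain[of j i] row[of 3 j i] that by simp
    finally show ?thesis .
  qed
  \<comment> \<open>By \<open>same\<close> all occurrences of a variable have one value, so the
    existential quantifier just selects an occurrence.\<close>
  define \<alpha> where "\<alpha> = (\<lambda>x \<in> cnf_vars \<phi>. \<exists>i < ?n. key (?ts ! i) = Some x \<and> b (node 0 i 0))"
  have val: "b (node 0 i 0) = token_value \<alpha> (?ts ! i)" if "i < ?n" for i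
  proof (cases "key (?ts ! i)")
    case None
    then have "?ts ! i = End" by (cases "?ts ! i") auto
    \<comment> \<open>At an end marker \<open>token_ok\<close> forces the row to be False, which is
      what \<open>token_value\<close> prescribes.\<close>
    then show ?thesis using ok3[OF that] by (simp add: token_value_def)
  next
    case (Some x)
    then have "x \<in> cnf_vars \<phi>" using that unfolding cnf_vars_tokens by auto
    then have "\<alpha> x \<longleftrightarrow> (\<exists>j < ?n. key (?ts ! j) = Some x \<and> b (node 0 j 0))" by (simp add: \<alpha>_def)
    also have "\<dots> \<longleftrightarrow> b (node 0 i 0)" using same Some that by metis
    finally show ?thesis using Some by (simp add: token_value_def)
  qed
  have state: "b (node 6 i 0) = clause_state \<alpha> ?ts i" if "i \<le> ?n" for i
    using that
  proof (induction i)
    case 0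
    then show ?case using ok4 clause_state_0 by simp
  next
    case (Suc i)
    then have i: "i < ?n" by simp
    have "b (node 6 (Suc i) 0) = clause_step \<alpha> (?ts ! i) (b (node 4 i 0))"
      using token_ok_step[OF ok3[OF i] val[OF i]] .
    then show ?case using Suc.IH clause[of 4 i] i by (simp add: clause_state_Suc)
  qed
  have "\<alpha> \<in> satisfying_assignments \<phi>"
    unfolding satisfying_assignments_iff
  proof (intro conjI allI impI)
    show "\<alpha> \<in> extensional (cnf_vars \<phi>)" by (simp add: \<alpha>_def)
    fix i assume i: "i < ?n" "?ts ! i = End"
    then have "b (node 4 i 0)" using ok3[OF i(1)] by simp
    then show "clause_state \<alpha> ?ts i" using clause[of 4 i] state[of i] i(1) by simp
  qed
  moreover have "assignment_routing ?ts \<alpha> = \<rho>"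
  proof (rule extensionalityI)
    show "assignment_routing ?ts \<alpha> \<in> extensional (nodes ?n)" by (simp add: assignment_routing_def)
    show "\<rho> \<in> extensional (nodes ?n)" using ext by (simp add: PiE_def)
    fix v assume v: "v \<in> nodes ?n"
    then obtain r i j where r: "v = node r i j" "valid_node ?n r i j" by (auto simp: nodes_def)
    have "b v = node_value \<alpha> ?ts v"
    proof (cases "r < 4")
      case True
      then have ij: "i < ?n" "j \<le> ?n" using r(2) by (auto simp: valid_node_def)
      have "b v = b (node 0 i j)"
        unfolding r(1) by (rule resp) (use True ij r(2) in \<open>auto simp: valid_node_def row_of_def\<close>)
      then show ?thesis using chain[OF ij] val[OF ij(1)] True by (simp add: r(1) node_value_def)
    next
      case False
      then have "4 \<le> r" "r < 8" "i \<le> ?n" "j = 0" using r(2) by (auto simp: valid_node_def)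
      then show ?thesis using clause[of r i] state[of i] by (simp add: r(1) node_value_def)
    qed
    moreover have "\<rho> v = id \<or> \<rho> v = transpose 1 2" using ext v by auto
    ultimately show "assignment_routing ?ts \<alpha> v = \<rho> v"
      using v by (auto simp: assignment_routing_def b_def)
  qed
  ultimately show ?thesis by blast
qed

lemma card_solutions:
  "card (satisfying_assignments \<phi>) = card (routing_solutions (reduction (tokens \<phi>)))"
proof -
  have "bij_betw (assignment_routing (tokens \<phi>)) (satisfying_assignments \<phi>)
      (routing_solutions (reduction (tokens \<phi>)))"
    using assignment_routing_inj assignment_routing_solution routing_solution_is_assignment_routing
    by (intro bij_betw_imageI) (blast+)
  then show ?thesis by (rule bij_betw_same_card)
qed

text \<open>A class lies among the nodes with fixed \<open>i\<close> and \<open>j\<close> and with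
  \<open>r\<close> on one side of 4, so it has at most four vertices.\<close>

lemma reduction_instance: "reduction ts \<in> instances Width6_Valency2_Maximal_Routing"
proof -
  let ?T = "polarisation_of (reduction ts)" and ?n = "length ts"
  have V: "verts (graph (circuit_of (reduction ts))) = nodes ?n"
    using verts_C[of ts] unfolding set_gadgets .
  have val: "valency (circuit_of (reduction ts)) v = 2" if "v \<in> nodes ?n" for v
    using valency_C[of v ts] that unfolding set_gadgets .
  have "equiv (nodes ?n) ?T"
    unfolding polarisation_of_reduction equiv_def refl_on_def sym_def trans_def by auto
  then have "polarisation (circuit_of (reduction ts)) ?T"
    unfolding polarisation_def V by (auto simp: polarisation_of_reduction val)
  moreover have "card X \<le> 6" if X: "X \<in> nodes ?n // ?T" for X
  proof -
    obtain x where x: "x \<in> nodes ?n" "X = ?T `` {x}" using X by (auto simp: quotient_def)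
    then obtain r i j where r: "x = node r i j" by (auto simp: nodes_def)
    have "X \<subseteq> (\<lambda>r. node r i j) ` (if r < 4 then {0, 1, 2, 3} else {4, 5, 6, 7})"
      using x(2) r by (auto simp: polarisation_of_reduction nodes_def row_of_def valid_node_def)
    then have "card X \<le> card ((\<lambda>r. node r i j) ` (if r < 4 then {0, 1, 2, 3} else {4, 5, 6, 7}))"
      by (intro card_mono) auto
    also have "\<dots> \<le> card (if r < 4 then {0, 1, 2, 3} else {4, 5, 6, 7 :: nat})"
      by (rule card_image_le) auto
    also have "\<dots> \<le> 6" by simp
    finally show ?thesis .
  qed
  ultimately show ?thesis
    unfolding Width6_Valency2_Maximal_Routing_def
    using switching_circuit_C[of ts] val V by (auto simp: reduction_def max_cycles_def)
qed

lemma parsimonious_reduction: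
  "parsimonious_transformation three_SAT Width6_Valency2_Maximal_Routing (\<lambda>\<phi>. reduction (tokens \<phi>))"
proof -
  have "(\<exists>\<alpha>. \<alpha> \<in> satisfying_assignments \<phi>) \<longleftrightarrow> (\<exists>\<rho>. \<rho> \<in> routing_solutions (reduction (tokens \<phi>)))" for \<phi>
    using assignment_routing_solution routing_solution_is_assignment_routing by metis
  then show ?thesis
    using reduction_instance card_solutions
    by (simp add: parsimonious_transformation_def yes_instance_def three_SAT_def
        Width6_Valency2_Maximal_Routing_def)
qed


section \<open>Structured programs for Turing machines\<close>

text \<open>
  \<open>Op d a g\<close> acts on tape \<open>d\<close> depending on the symbol under the head of tape \<open>a\<close>; the tests
  of \<open>Cond a b c\<close> and \<open>Loop a b c\<close> read the tapes \<open>a\<close> and \<open>b\<close>.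
\<close>

datatype prog =
    Op nat nat "symbol \<Rightarrow> symbol \<times> move"
  | Seq prog prog (infixr \<open>;;\<close> 60)
  | Cond nat nat "symbol \<Rightarrow> symbol \<Rightarrow> bool" prog prog
  | Loop nat nat "symbol \<Rightarrow> symbol \<Rightarrow> bool" prog

type_synonym store = "nat \<Rightarrow> tape"

text \<open>The additional steps are those of the compiled code: one for the test, and one for the
  jump at the end of the first branch of \<open>Cond\<close> or of the body of
  \<open>Loop\<close>.\<close>

inductive exec :: "prog \<Rightarrow> store \<Rightarrow> nat \<Rightarrow> store \<Rightarrow> bool" where
  Op: "exec (Op d a g) st 1 (st(d := act_on_tape (g (read_tape (st a))) (st d)))"
| Seq: "exec p st t st' \<Longrightarrow> exec q st' t' st'' \<Longrightarrow> exec (p ;; q) st (t + t') st''"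
| Cond_True: "c (read_tape (st a)) (read_tape (st b)) \<Longrightarrow> exec p st t st' \<Longrightarrow>
    exec (Cond a b c p q) st (1 + t + 1) st'"
| Cond_False: "\<not> c (read_tape (st a)) (read_tape (st b)) \<Longrightarrow> exec q st t st' \<Longrightarrow>
    exec (Cond a b c p q) st (1 + t) st'"
| Loop_False: "\<not> c (read_tape (st a)) (read_tape (st b)) \<Longrightarrow> exec (Loop a b c p) st 1 st"
| Loop_True: "c (read_tape (st a)) (read_tape (st b)) \<Longrightarrow> exec p st t st' \<Longrightarrow>
    exec (Loop a b c p) st' t' st'' \<Longrightarrow> exec (Loop a b c p) st (1 + t + 1 + t') st''"


subsection \<open>Compilation\<close>

type_synonym instr = "symbol list \<Rightarrow> nat \<times> (symbol \<times> move) list"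

definition stay :: "symbol list \<Rightarrow> (symbol \<times> move) list" where
  "stay ss = map (\<lambda>s. (s, Stay)) ss"

fun code_size :: "prog \<Rightarrow> nat" where
  "code_size (Op d a g) = 1"
| "code_size (p ;; q) = code_size p + code_size q"
| "code_size (Cond a b c p q) = code_size p + code_size q + 2"
| "code_size (Loop a b c p) = code_size p + 2"

text \<open>Addresses are absolute: \<open>n\<close> is that of the first instruction, and control
  leaves at \<open>n + code_size p\<close>, the address that follows. Tests and jumps write back the
  symbols they read.\<close>

fun code :: "prog \<Rightarrow> nat \<Rightarrow> instr list" where
  "code (Op d a g) n = [\<lambda>ss. (n + 1, (stay ss)[d := g (ss ! a)])]"
| "code (p ;; q) n = code p n @ code q (n + code_size p)"
| "code (Cond a b c p q) n =
     (\<lambda>ss. (if c (ss ! a) (ss ! b) then n + 1 else n + code_size p + 2, stay ss)) # code p (n + 1) @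
     (\<lambda>ss. (n + code_size p + code_size q + 2, stay ss)) # code q (n + code_size p + 2)"
| "code (Loop a b c p) n =
     (\<lambda>ss. (if c (ss ! a) (ss ! b) then n + 1 else n + code_size p + 2, stay ss)) # code p (n + 1) @
     [\<lambda>ss. (n, stay ss)]"

lemma length_code [simp]: "length (code p n) = code_size p"
  by (induction p arbitrary: n) auto

text \<open>The halting state is the address just behind the code, so the machine halts by running
  off its end.\<close>

definition compile :: "nat \<Rightarrow> nat \<Rightarrow> prog \<Rightarrow> machine" where
  "compile k g p = \<lparr>num_tapes = k, num_symbols = g, num_states = code_size p,
     transition = (!) (code p 0)\<rparr>"

fun well_formed :: "nat \<Rightarrow> nat \<Rightarrow> prog \<Rightarrow> bool" where
  "well_formed k g (Op d a f) \<longleftrightarrow> d < k \<and> a < k \<and> (\<forall>s < g. fst (f s) < g)"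
| "well_formed k g (p ;; q) \<longleftrightarrow> well_formed k g p \<and> well_formed k g q"
| "well_formed k g (Cond a b c p q) \<longleftrightarrow> a < k \<and> b < k \<and> well_formed k g p \<and> well_formed k g q"
| "well_formed k g (Loop a b c p) \<longleftrightarrow> a < k \<and> b < k \<and> well_formed k g p"

definition instr_ok :: "nat \<Rightarrow> nat \<Rightarrow> nat \<Rightarrow> instr \<Rightarrow> bool" where
  "instr_ok k g n f \<longleftrightarrow> (\<forall>ss. length ss = k \<longrightarrow> set ss \<subseteq> {..<g} \<longrightarrow>
     fst (f ss) \<le> n \<and> length (snd (f ss)) = k \<and> fst ` set (snd (f ss)) \<subseteq> {..<g})"

lemma instr_ok_mono: "instr_ok k g n f \<Longrightarrow> n \<le> n' \<Longrightarrow> instr_ok k g n' f"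
  unfolding instr_ok_def using le_trans by blast

lemma instr_ok_stay: "(\<And>ss. q ss \<le> n) \<Longrightarrow> instr_ok k g n (\<lambda>ss. (q ss, stay ss))"
  by (auto simp: instr_ok_def stay_def)

lemma instr_ok_code:
  "well_formed k g p \<Longrightarrow> f \<in> set (code p n) \<Longrightarrow> instr_ok k g (n + code_size p) f"
proof (induction p arbitrary: n)
  case (Op d a h)
  have "fst ` set ((stay ss)[d := h (ss ! a)]) \<subseteq> {..<g}"
    if ss: "length ss = k" "set ss \<subseteq> {..<g}" for ss
  proof -
    have "ss ! a < g" using ss Op by (auto simp: subset_iff)
    then have "fst (h (ss ! a)) < g" using Op by auto
    moreover have "fst ` set (stay ss) \<subseteq> {..<g}" using ss by (auto simp: stay_def)
    ultimately have "fst ` insert (h (ss ! a)) (set (stay ss)) \<subseteq> {..<g}" by simp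
    then show ?thesis
      using image_mono[OF set_update_subset_insert[of "stay ss" d "h (ss ! a)"], of fst] by blast
  qed
  then show ?case using Op by (auto simp: instr_ok_def stay_def)
next
  case (Seq p q)
  then show ?case
    using Seq.IH(1)[of n] Seq.IH(2)[of "n + code_size p"] instr_ok_mono[of k g "n + code_size p"]
    by (auto simp: add.assoc)
next
  case (Cond a b c p q)
  then show ?case
    using Cond.IH(1)[of "n + 1"] Cond.IH(2)[of "n + code_size p + 2"]
      instr_ok_mono[of k g "n + 1 + code_size p" f "n + code_size (Cond a b c p q)"]
    by (auto intro!: instr_ok_stay simp: algebra_simps)
next
  case (Loop a b c p)
  then show ?case
    using Loop.IH[of "n + 1"]
      instr_ok_mono[of k g "n + 1 + code_size p" f "n + code_size (Loop a b c p)"]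
    by (auto intro!: instr_ok_stay simp: algebra_simps)
qed

lemma turing_machine_compile:
  assumes "well_formed k g p" "2 \<le> k"
  shows "turing_machine (compile k g p)"
proof -
  have "instr_ok k g (code_size p) (code p 0 ! q)" if "q < code_size p" for q
    using instr_ok_code[OF assms(1), of _ 0] that by simp
  then show ?thesis
    using assms(2) unfolding turing_machine_def compile_def instr_ok_def
    by (auto split: prod.splits) (metis fst_conv snd_conv, metis snd_conv, fastforce)
qed

definition tapes :: "nat \<Rightarrow> store \<Rightarrow> tape list" where
  "tapes k st = map st [0..<k]"

lemma act_stay: "act_on_tape (read_tape t, Stay) t = t"
  by (simp add: act_on_tape_def read_tape_def)

lemma map2_stay: "map2 act_on_tape (stay (map read_tape ts)) ts = ts"
  by (induction ts) (simp_all add: stay_def act_stay)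

lemma tapes_read: "a < k \<Longrightarrow> map read_tape (tapes k st) ! a = read_tape (st a)"
  by (simp add: tapes_def)

lemma tapes_update:
  assumes "d < k"
  shows "map2 act_on_tape ((stay (map read_tape (tapes k st)))[d := x]) (tapes k st) =
    tapes k (st(d := act_on_tape x (st d)))"
proof (rule nth_equalityI)
  fix i assume "i < length (map2 act_on_tape ((stay (map read_tape (tapes k st)))[d := x]) (tapes k st))"
  then have "i < k" by (simp add: tapes_def stay_def)
  then show "map2 act_on_tape ((stay (map read_tape (tapes k st)))[d := x]) (tapes k st) ! i =
      tapes k (st(d := act_on_tape x (st d))) ! i"
    by (cases "i = d") (simp_all add: tapes_def stay_def act_stay)
qed (simp add: tapes_def stay_def)

lemma funpow_trans: "(f ^^ s) x = y \<Longrightarrow> (f ^^ t) y = z \<Longrightarrow> (f ^^ (s + t)) x = z"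
  by (subst add.commute) (simp add: funpow_add)

text \<open>Stated for code placed between \<open>pre\<close> and \<open>post\<close>, so that the
  induction hypotheses apply to subprograms, whose surroundings are the rest of the program.\<close>

lemma exec_compile:
  assumes "exec p st t st'" "well_formed k g p"
    and "num_states M = length pre + code_size p + length post"
    and "transition M = (!) (pre @ code p (length pre) @ post)"
  shows "(step M ^^ t) (length pre, tapes k st) = (length pre + code_size p, tapes k st')"
  using assms
proof (induction arbitrary: pre post)
  case (Op d a h st)
  then show ?case
    by (simp add: step_def tapes_read tapes_update fun_upd_def)
next
  case (Seq p st t st' q t' st'')
  have "(step M ^^ t) (length pre, tapes k st) = (length pre + code_size p, tapes k st')"
    using Seq.prems by (intro Seq.IH(1)[of pre "code q (length pre + code_size p) @ post"]) auto
  moreover have "(step M ^^ t') (length (pre @ code p (length pre)), tapes k st') =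
      (length (pre @ code p (length pre)) + code_size q, tapes k st'')"
    using Seq.prems by (intro Seq.IH(2)[of "pre @ code p (length pre)" post]) auto
  ultimately show ?case by (auto intro: funpow_trans simp: add.assoc)
next
  case (Cond_True c st a b p t st' q)
  let ?n = "length pre"
  let ?i = "\<lambda>ss. (if c (ss ! a) (ss ! b) then ?n + 1 else ?n + code_size p + 2, stay ss)"
  let ?j = "\<lambda>ss. (?n + code_size p + code_size q + 2, stay ss)"
  have M: "transition M = (!) (pre @ ?i # code p (?n + 1) @ ?j # code q (?n + code_size p + 2) @ post)"
    using Cond_True.prems by simp
  have "(step M ^^ 1) (?n, tapes k st) = (?n + 1, tapes k st)"
    using Cond_True by (simp add: step_def tapes_read map2_stay)
  moreover have "(step M ^^ t) (length (pre @ [?i]), tapes k st) = (length (pre @ [?i]) + code_size p, tapes k st')"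
    using Cond_True.prems
    by (intro Cond_True.IH[of "pre @ [?i]" "?j # code q (?n + code_size p + 2) @ post"]) auto
  moreover have "(step M ^^ 1) (?n + 1 + code_size p, tapes k st') = (?n + code_size (Cond a b c p q), tapes k st')"
    using Cond_True.prems
    by (simp add: step_def map2_stay M nth_append del: code.simps)
  ultimately show ?case
    by (intro funpow_trans[of "1 + t" _ _ _ 1] funpow_trans[of 1 _ _ _ t]) auto
next
  case (Cond_False c st a b q t st' p)
  let ?n = "length pre"
  let ?i = "\<lambda>ss. (if c (ss ! a) (ss ! b) then ?n + 1 else ?n + code_size p + 2, stay ss)"
  let ?j = "\<lambda>ss. (?n + code_size p + code_size q + 2, stay ss)"
  let ?pre = "pre @ ?i # code p (?n + 1) @ [?j]"
  have "(step M ^^ 1) (?n, tapes k st) = (?n + code_size p + 2, tapes k st)"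
    using Cond_False by (simp add: step_def tapes_read map2_stay)
  moreover have "(step M ^^ t) (length ?pre, tapes k st) = (length ?pre + code_size q, tapes k st')"
    using Cond_False.prems by (intro Cond_False.IH[of ?pre post]) auto
  ultimately show ?case
    by (intro funpow_trans[of 1 _ _ _ t]) auto
next
  case (Loop_False c st a b p)
  then show ?case by (simp add: step_def tapes_read map2_stay)
next
  case (Loop_True c st a b p t st' t' st'')
  let ?n = "length pre"
  let ?i = "\<lambda>ss. (if c (ss ! a) (ss ! b) then ?n + 1 else ?n + code_size p + 2, stay ss)"
  let ?j = "\<lambda>ss. (?n, stay ss)"
  have M: "transition M = (!) (pre @ ?i # code p (?n + 1) @ ?j # post)"
    using Loop_True.prems by simp
  have "(step M ^^ 1) (?n, tapes k st) = (?n + 1, tapes k st)"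
    using Loop_True by (simp add: step_def tapes_read map2_stay)
  moreover have "(step M ^^ t) (length (pre @ [?i]), tapes k st) = (length (pre @ [?i]) + code_size p, tapes k st')"
    using Loop_True.prems by (intro Loop_True.IH(1)[of "pre @ [?i]" "?j # post"]) auto
  moreover have "(step M ^^ 1) (?n + 1 + code_size p, tapes k st') = (?n, tapes k st')"
    using Loop_True.prems by (simp add: step_def map2_stay M nth_append del: code.simps)
  moreover have "(step M ^^ t') (?n, tapes k st') = (?n + code_size (Loop a b c p), tapes k st'')"
    using Loop_True.prems by (intro Loop_True.IH(2)[of pre post]) auto
  ultimately show ?case
    by (intro funpow_trans[of "1 + t + 1" _ _ _ t'] funpow_trans[of "1 + t" _ _ _ 1] funpow_trans[of 1 _ _ _ t]) auto
qed

lemma funpow_fixpoint: "f x = x \<Longrightarrow> (f ^^ n) x = x"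
  by (induction n) auto

definition blank :: tape where
  "blank = (word_content [], 0)"

definition input_store :: "word \<Rightarrow> store" where
  "input_store w = (\<lambda>_. blank)(0 := (word_content w, 0))"

lemma outputs_within_compile:
  assumes "exec p (input_store w) t st" "well_formed k g p" "2 \<le> k" "t \<le> t'"
    and "fst (st 1) = word_content v"
  shows "outputs_within (compile k g p) w v t'"
proof -
  let ?M = "compile k g p"
  have "initial_config ?M w = (0, tapes k (input_store w))"
    unfolding initial_config_def tapes_def
    by (rule arg_cong[where f = "Pair 0"], rule nth_equalityI)
      (use assms(3) in \<open>auto simp: compile_def input_store_def blank_def nth_Cons'\<close>)
  then have "(step ?M ^^ t) (initial_config ?M w) = (code_size p, tapes k st)"
    using exec_compile[OF assms(1,2), of ?M "[]" "[]"] by (simp add: compile_def)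
  moreover have "(step ?M ^^ (t' - t)) (code_size p, tapes k st) = (code_size p, tapes k st)"
    by (rule funpow_fixpoint) (simp add: step_def compile_def)
  ultimately have "(step ?M ^^ t') (initial_config ?M w) = (code_size p, tapes k st)"
    using funpow_trans[of t "step ?M" "initial_config ?M w" _ "t' - t"] assms(4) by simp
  then show ?thesis
    using assms(3,5) by (simp add: outputs_within_def compile_def tapes_def)
qed


subsection \<open>Running times\<close>

text \<open>Exact times depend on the data; upper bounds compose without case distinctions.\<close>

definition runs :: "prog \<Rightarrow> store \<Rightarrow> nat \<Rightarrow> store \<Rightarrow> bool" where
  "runs p st b st' \<longleftrightarrow> (\<exists>t \<le> b. exec p st t st')"

lemma runs_Op: "st' = st(d := act_on_tape (g (read_tape (st a))) (st d)) \<Longrightarrow> runs (Op d a g) st 1 st'"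
  unfolding runs_def using exec.Op by auto

lemma runs_mono: "runs p st b st' \<Longrightarrow> b \<le> b' \<Longrightarrow> runs p st b' st'"
  unfolding runs_def by (meson le_trans)

lemma runs_Seq:
  assumes "runs p st b st'" "runs q st' b' st''"
  shows "runs (p ;; q) st (b + b') st''"
  using assms unfolding runs_def by (meson add_mono exec.Seq)

lemma runs_Cond_True:
  assumes "c (read_tape (st a)) (read_tape (st a'))" "runs p st b st'"
  shows "runs (Cond a a' c p q) st (b + 2) st'"
proof -
  obtain t where "t \<le> b" "exec p st t st'" using assms by (auto simp: runs_def)
  then show ?thesis
    using exec.Cond_True[of c st a a' p t st' q, OF assms(1)] unfolding runs_def by (intro exI[of _ "1 + t + 1"]) auto
qed

lemma runs_Cond_False:
  assumes "\<not> c (read_tape (st a)) (read_tape (st a'))" "runs q st b st'"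
  shows "runs (Cond a a' c p q) st (b + 2) st'"
proof -
  obtain t where "t \<le> b" "exec q st t st'" using assms by (auto simp: runs_def)
  then show ?thesis
    using exec.Cond_False[of c st a a' q t st' p, OF assms(1)] unfolding runs_def by (intro exI[of _ "1 + t"]) auto
qed

lemma runs_Loop_False:
  "\<not> c (read_tape (st a)) (read_tape (st a')) \<Longrightarrow> runs (Loop a a' c p) st 1 st"
  unfolding runs_def using exec.Loop_False by auto

lemma runs_Loop_True:
  assumes "c (read_tape (st a)) (read_tape (st a'))" "runs p st b st'" "runs (Loop a a' c p) st' b' st''"
  shows "runs (Loop a a' c p) st (b + 2 + b') st''"
proof -
  obtain t t' where "t \<le> b" "exec p st t st'" "t' \<le> b'" "exec (Loop a a' c p) st' t' st''"
    using assms by (auto simp: runs_def)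
  then show ?thesis
    using exec.Loop_True[of c st a a' p t st' t' st'', OF assms(1)] unfolding runs_def by (intro exI[of _ "1 + t + 1 + t'"]) auto
qed

text \<open>The loop invariant is given as a function: \<open>st i\<close> is the store after
  \<open>i\<close> rounds. The induction goes backwards from the last round because
  \<open>runs_Loop_True\<close> puts a round in front.\<close>

lemma runs_Loop:
  assumes "\<And>i. i < n \<Longrightarrow> c (read_tape (st i a)) (read_tape (st i a'))"
    and "\<And>i. i < n \<Longrightarrow> runs p (st i) b (st (Suc i))"
    and "\<not> c (read_tape (st n a)) (read_tape (st n a'))"
  shows "runs (Loop a a' c p) (st 0) (n * (b + 2) + 1) (st n)"
proof -
  have "runs (Loop a a' c p) (st (n - i)) (i * (b + 2) + 1) (st n)" if "i \<le> n" for i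
    using that
  proof (induction i)
    case 0
    then show ?case using runs_Loop_False[of c "st n"] assms(3) by simp
  next
    case (Suc i)
    then have "n - Suc i < n" "Suc (n - Suc i) = n - i" by auto
    then have "runs (Loop a a' c p) (st (n - Suc i)) (b + 2 + (i * (b + 2) + 1)) (st n)"
      using assms(1,2)[of "n - Suc i"] Suc by (intro runs_Loop_True[where st' = "st (n - i)"]) auto
    then show ?case by (rule runs_mono) simp
  qed
  from this[of n] show ?thesis by simp
qed

text \<open>A step writes only under the head and moves it by at most one cell, so the content of an
  initially blank tape is bounded by the running time. This bounds the edge tape without computing
  the length of any encoding.\<close>

definition confined :: "nat \<Rightarrow> tape \<Rightarrow> bool" where
  "confined m t \<longleftrightarrow> abs (snd t) \<le> int m \<and> (\<forall>z. int m < abs z \<longrightarrow> fst t z = 0)"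

lemma confined_act: "confined m t \<Longrightarrow> confined (m + 1) (act_on_tape x t)"
  by (cases "snd x") (auto simp: confined_def act_on_tape_def)

lemma confined_mono: "confined m t \<Longrightarrow> m \<le> m' \<Longrightarrow> confined m' t"
  unfolding confined_def by (metis (no_types, lifting) le_less_trans of_nat_le_iff order_trans)

lemma exec_confined:
  assumes "exec p st t st'" "confined m (st k)"
  shows "confined (m + t) (st' k)"
  using assms
proof (induction arbitrary: m)
  case (Op d a g st)
  then show ?case using confined_act[of m "st d" "g (read_tape (st a))"] confined_mono[of m "st k" "m + 1"] by auto
next
  case (Seq p st t st' q t' st'')
  then show ?case using Seq.IH(2)[of "m + t"] by (simp add: add.assoc)
next
  case (Cond_True c st a b p t st' q)
  then show ?case using confined_mono[of "m + t" "st' k" "m + (1 + t + 1)"] by simp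
next
  case (Cond_False c st a b q t st' p)
  then show ?case using confined_mono[of "m + t" "st' k" "m + (1 + t)"] by simp
next
  case (Loop_False c st a b p)
  then show ?case using confined_mono[of m "st k" "m + 1"] by simp
next
  case (Loop_True c st a b p t st' t' st'')
  then show ?case
    using Loop_True.IH(2)[of "m + t"] confined_mono[of "m + t + t'" "st'' k" "m + (1 + t + 1 + t')"] by simp
qed


section \<open>Elementary programs\<close>

text \<open>\<open>Tp l r\<close> holds the word \<open>l @ r\<close> with the head on the first symbol of \<open>r\<close>, and
  \<open>before l r\<close> is the tape one position to the left.\<close>

definition Tp :: "word \<Rightarrow> word \<Rightarrow> tape" where
  "Tp l r = (word_content (l @ r), int (length l))"

definition before :: "word \<Rightarrow> word \<Rightarrow> tape" where
  "before l r = (word_content (l @ r), int (length l) - 1)"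

definition head_symbol :: "word \<Rightarrow> symbol" where
  "head_symbol r = (case r of [] \<Rightarrow> 0 | x # _ \<Rightarrow> x)"

lemma head_symbol_simps [simp]: "head_symbol [] = 0" "head_symbol (x # r) = x"
  by (simp_all add: head_symbol_def)

lemma blank_Tp: "blank = Tp [] []"
  by (simp add: blank_def Tp_def)

lemma read_Tp [simp]: "read_tape (Tp l r) = head_symbol r"
  by (cases r) (auto simp: read_tape_def Tp_def word_content_def nth_append)

lemma before_snoc: "before (l @ [x]) r = Tp l (x # r)"
  by (simp add: before_def Tp_def)

lemma read_before_Nil: "read_tape (before [] r) = 0"
  by (simp add: read_tape_def before_def word_content_def)

lemma act_right_Cons: "act_on_tape (y, Move_Right) (Tp l (x # r)) = Tp (l @ [y]) r"
  by (auto simp: act_on_tape_def Tp_def word_content_def fun_eq_iff nth_append nth_Cons')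

lemma act_right_Nil: "act_on_tape (y, Move_Right) (Tp l []) = Tp (l @ [y]) []"
  by (auto simp: act_on_tape_def Tp_def word_content_def fun_eq_iff nth_append nth_Cons')

lemma act_right: "act_on_tape (y, Move_Right) (Tp l r) = Tp (l @ [y]) (tl r)"
  by (cases r) (simp_all add: act_right_Cons act_right_Nil)

lemma act_right_before: "act_on_tape (read_tape (before l r), Move_Right) (before l r) = Tp l r"
  by (auto simp: act_on_tape_def read_tape_def before_def Tp_def)

lemma act_left: "act_on_tape (head_symbol r, Move_Left) (Tp l r) = before l r"
  using read_Tp[of l r] by (auto simp: act_on_tape_def read_tape_def before_def Tp_def)

lemma act_erase: "act_on_tape (0, Move_Left) (Tp l [x]) = before l []"
  by (auto simp: act_on_tape_def before_def Tp_def word_content_def fun_eq_iff nth_append)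

definition move_right :: "nat \<Rightarrow> prog" where
  "move_right k = Op k k (\<lambda>s. (s, Move_Right))"

definition move_left :: "nat \<Rightarrow> prog" where
  "move_left k = Op k k (\<lambda>s. (s, Move_Left))"

definition put :: "nat \<Rightarrow> symbol \<Rightarrow> prog" where
  "put k x = Op k k (\<lambda>_. (x, Move_Right))"

definition nop :: prog where
  "nop = Op 0 0 (\<lambda>s. (s, Stay))"

definition skip :: "nat \<Rightarrow> symbol set \<Rightarrow> prog" where
  "skip k S = Loop k k (\<lambda>s _. s \<in> S) (move_right k)"

text \<open>The first step puts the head on the last symbol to be passed; the search overshoots by
  one cell, which the last step corrects. At the start of the tape the blank to the left stops the
  search.\<close>

definition rewind :: "nat \<Rightarrow> symbol set \<Rightarrow> prog" where
  "rewind k S = move_left k ;; Loop k k (\<lambda>s _. s \<in> S) (move_left k) ;; move_right k"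

definition copy :: "nat \<Rightarrow> nat \<Rightarrow> prog" where
  "copy a d = Loop a a (\<lambda>s _. s \<noteq> 0) (Op d a (\<lambda>s. (s, Move_Right)) ;; move_right a)"

text \<open>The source is copied whole wherever its head stands, and its head is left at the end; so
  a unary counter comes out unchanged and can be copied again.\<close>

definition append_tape :: "nat \<Rightarrow> nat \<Rightarrow> prog" where
  "append_tape a d = rewind a {0<..} ;; copy a d"

definition erase :: "nat \<Rightarrow> prog" where
  "erase k = move_left k ;; Loop k k (\<lambda>s _. s \<noteq> 0) (Op k k (\<lambda>_. (0, Move_Left))) ;; move_right k"

text \<open>Symbol 2 is the digit one and symbol 1 the digit zero: the carry clears the leading
  ones, and the next cell, a zero or a blank, becomes a one.\<close>

definition increment :: "nat \<Rightarrow> prog" where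
  "increment k = Loop k k (\<lambda>s _. s = 2) (put k 1) ;; put k 2 ;; rewind k {0<..}"

fun repeat :: "nat \<Rightarrow> prog \<Rightarrow> prog" where
  "repeat 0 p = nop"
| "repeat (Suc m) p = p ;; repeat m p"

text \<open>Lists of pieces are words with holes: \<open>Unary k\<close> stands for the current
  content of tape \<open>k\<close>.\<close>

datatype piece = Sym symbol | Unary nat

fun emit :: "nat \<Rightarrow> piece list \<Rightarrow> prog" where
  "emit d [] = nop"
| "emit d (Sym x # ps) = put d x ;; emit d ps"
| "emit d (Unary k # ps) = append_tape k d ;; emit d ps"

fun spell :: "(nat \<Rightarrow> nat) \<Rightarrow> piece \<Rightarrow> word" where
  "spell u (Sym x) = [x]"
| "spell u (Unary k) = replicate (u k) 1"

definition spells :: "(nat \<Rightarrow> nat) \<Rightarrow> piece list \<Rightarrow> word" where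
  "spells u ps = concat (map (spell u) ps)"

lemma spells_simps [simp]:
  "spells u [] = []" "spells u (p # ps) = spell u p @ spells u ps"
  "spells u (ps @ qs) = spells u ps @ spells u qs"
  by (simp_all add: spells_def)

section \<open>Effects and running times of the elementary programs\<close>

lemma runs_nop: "runs nop st 1 st"
  unfolding nop_def by (rule runs_Op) (simp add: act_stay)

lemma runs_move_right: "st k = Tp l (x # r) \<Longrightarrow> runs (move_right k) st 1 (st(k := Tp (l @ [x]) r))"
  unfolding move_right_def by (rule runs_Op) (simp add: act_right_Cons)

lemma runs_move_right_before: "st k = before l r \<Longrightarrow> runs (move_right k) st 1 (st(k := Tp l r))"
  unfolding move_right_def by (rule runs_Op) (simp add: act_right_before)

lemma runs_move_left: "st k = Tp l r \<Longrightarrow> runs (move_left k) st 1 (st(k := before l r))"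
  unfolding move_left_def by (rule runs_Op) (simp add: act_left)

lemma runs_put: "st k = Tp l r \<Longrightarrow> runs (put k x) st 1 (st(k := Tp (l @ [x]) (tl r)))"
  unfolding put_def by (rule runs_Op) (simp add: act_right)

lemma runs_skip:
  assumes "st k = Tp l (w @ r)" "set w \<subseteq> S" "head_symbol r \<notin> S"
  shows "runs (skip k S) st (3 * length w + 1) (st(k := Tp (l @ w) r))"
  using assms
proof (induction w arbitrary: st l)
  case Nil
  then have "st(k := Tp l r) = st" by auto
  then show ?case
    using Nil runs_Loop_False[of "\<lambda>s _. s \<in> S" st k k "move_right k"] by (simp add: skip_def)
next
  case (Cons x w)
  let ?st = "st(k := Tp (l @ [x]) (w @ r))"
  have "runs (skip k S) ?st (3 * length w + 1) (?st(k := Tp ((l @ [x]) @ w) r))"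
    by (rule Cons.IH) (use Cons.prems in auto)
  then have "runs (skip k S) st (1 + 2 + (3 * length w + 1)) (?st(k := Tp ((l @ [x]) @ w) r))"
    unfolding skip_def using Cons.prems
    by (intro runs_Loop_True[OF _ runs_move_right[of st k l x "w @ r"]]) auto
  from runs_mono[OF this, of "3 * length (x # w) + 1"] show ?case by (simp add: fun_upd_def cong: if_cong)
qed

text \<open>The head starts on the last symbol of \<open>l @ w\<close>, if there is one. The
  conditions on \<open>last l\<close> and on the blank make the search stop exactly where
  \<open>l\<close> ends.\<close>

lemma runs_back_loop:
  assumes "st k = before (l @ w) r" "set w \<subseteq> S" "l \<noteq> [] \<longrightarrow> last l \<notin> S" "0 \<notin> S"
  shows "runs (Loop k k (\<lambda>s _. s \<in> S) (move_left k)) st (3 * length w + 1) (st(k := before l (w @ r)))"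
  using assms(1,2)
proof (induction w arbitrary: st r rule: rev_induct)
  case Nil
  have "read_tape (before l r) \<notin> S"
    using assms(3,4) by (cases l rule: rev_cases) (auto simp: read_before_Nil before_snoc)
  moreover have "st(k := before l r) = st" using Nil by auto
  ultimately show ?case
    using Nil runs_Loop_False[of "\<lambda>s _. s \<in> S" st k k "move_left k"] by simp
next
  case (snoc x w)
  have st: "st k = Tp (l @ w) (x # r)" using snoc.prems by (simp flip: append_assoc add: before_snoc)
  let ?st = "st(k := before (l @ w) (x # r))"
  have "runs (Loop k k (\<lambda>s _. s \<in> S) (move_left k)) ?st (3 * length w + 1) (?st(k := before l (w @ x # r)))"
    by (rule snoc.IH) (use snoc.prems in auto)
  then have "runs (Loop k k (\<lambda>s _. s \<in> S) (move_left k)) st (1 + 2 + (3 * length w + 1))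
      (?st(k := before l (w @ x # r)))"
    using st snoc.prems by (intro runs_Loop_True[OF _ runs_move_left[of st k "l @ w" "x # r"]]) auto
  from runs_mono[OF this, of "3 * length (w @ [x]) + 1"] show ?case by (simp add: fun_upd_def cong: if_cong)
qed

lemma runs_rewind:
  assumes "st k = Tp (l @ w) r" "set w \<subseteq> S" "l \<noteq> [] \<longrightarrow> last l \<notin> S" "0 \<notin> S"
  shows "runs (rewind k S) st (3 * length w + 3) (st(k := Tp l (w @ r)))"
proof -
  have 1: "runs (Loop k k (\<lambda>s _. s \<in> S) (move_left k)) (st(k := before (l @ w) r)) (3 * length w + 1)
      (st(k := before l (w @ r)))"
    using runs_back_loop[of "st(k := before (l @ w) r)" k l w r S] assms by simp
  have 2: "runs (move_right k) (st(k := before l (w @ r))) 1 (st(k := Tp l (w @ r)))"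
    using runs_move_right_before[of "st(k := before l (w @ r))" k l "w @ r"] by simp
  show ?thesis
    unfolding rewind_def
    by (rule runs_mono[OF runs_Seq[OF runs_move_left[of st k, OF assms(1)] runs_Seq[OF 1 2]]]) simp
qed

lemma runs_copy:
  assumes "st a = Tp l r" "st d = Tp m []" "a \<noteq> d" "0 \<notin> set r"
  shows "runs (copy a d) st (4 * length r + 1) (st(a := Tp (l @ r) [], d := Tp (m @ r) []))"
  using assms
proof (induction r arbitrary: st l m)
  case Nil
  then have "st(a := Tp l [], d := Tp m []) = st" by auto
  moreover have "runs (copy a d) st 1 st"
    using Nil unfolding copy_def by (intro runs_Loop_False) simp
  ultimately show ?case by (simp add: fun_upd_def cong: if_cong)
next
  case (Cons x r)
  let ?st1 = "st(d := Tp (m @ [x]) [])"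
  let ?st = "?st1(a := Tp (l @ [x]) r)"
  have 1: "runs (Op d a (\<lambda>s. (s, Move_Right))) st 1 ?st1"
    by (rule runs_Op) (simp add: Cons.prems act_right_Nil)
  have 2: "runs (move_right a) ?st1 1 ?st"
    by (rule runs_move_right) (use Cons.prems in auto)
  have "runs (copy a d) ?st (4 * length r + 1) (?st(a := Tp ((l @ [x]) @ r) [], d := Tp ((m @ [x]) @ r) []))"
    by (rule Cons.IH) (use Cons.prems in auto)
  then have "runs (copy a d) st (1 + 1 + 2 + (4 * length r + 1))
      (?st(a := Tp ((l @ [x]) @ r) [], d := Tp ((m @ [x]) @ r) []))"
    unfolding copy_def using Cons.prems
    by (intro runs_Loop_True[OF _ runs_Seq[OF 1 2]]) auto
  moreover have "?st(a := Tp ((l @ [x]) @ r) [], d := Tp ((m @ [x]) @ r) []) =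
      st(a := Tp (l @ x # r) [], d := Tp (m @ x # r) [])"
    by (auto simp: fun_eq_iff)
  ultimately have "runs (copy a d) st (1 + 1 + 2 + (4 * length r + 1)) (st(a := Tp (l @ x # r) [], d := Tp (m @ x # r) []))"
    by (simp only:)
  then show ?case by (rule runs_mono) simp
qed

lemma runs_append_tape:
  assumes "st a = Tp l r" "st d = Tp m []" "a \<noteq> d" "0 \<notin> set l" "0 \<notin> set r"
  shows "runs (append_tape a d) st (7 * length l + 4 * length r + 4) (st(a := Tp (l @ r) [], d := Tp (m @ l @ r) []))"
proof -
  have 1: "runs (rewind a {0<..}) st (3 * length l + 3) (st(a := Tp [] (l @ r)))"
    by (rule runs_rewind) (use assms in \<open>auto intro!: gr0I\<close>)
  have "runs (copy a d) (st(a := Tp [] (l @ r))) (4 * length (l @ r) + 1)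
      ((st(a := Tp [] (l @ r)))(a := Tp ([] @ l @ r) [], d := Tp (m @ l @ r) []))"
    by (rule runs_copy) (use assms in auto)
  then have 2: "runs (copy a d) (st(a := Tp [] (l @ r))) (4 * length (l @ r) + 1)
      (st(a := Tp (l @ r) [], d := Tp (m @ l @ r) []))"
    by simp
  show ?thesis unfolding append_tape_def by (rule runs_mono[OF runs_Seq[OF 1 2]]) simp
qed

lemma runs_emit:
  assumes "\<And>k. Unary k \<in> set ps \<Longrightarrow> k \<noteq> d \<and> st k = Tp (replicate (u k) 1) [] \<and> u k \<le> N"
    and "st d = Tp m []"
  shows "runs (emit d ps) st (length ps * (7 * N + 4) + 1) (st(d := Tp (m @ spells u ps) []))"
  using assms
proof (induction d ps arbitrary: st m rule: emit.induct)
  case (1 d)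
  then have "st(d := Tp m []) = st" by auto
  then show ?case using runs_nop by simp
next
  case (2 d x ps)
  have 1: "runs (put d x) st 1 (st(d := Tp (m @ [x]) []))"
    using runs_put[of st d m "[]" x] 2 by simp
  have "runs (emit d ps) (st(d := Tp (m @ [x]) [])) (length ps * (7 * N + 4) + 1)
      ((st(d := Tp (m @ [x]) []))(d := Tp ((m @ [x]) @ spells u ps) []))"
    by (rule "2.IH") (use 2 in auto)
  from runs_mono[OF runs_Seq[OF 1 this], of "length (Sym x # ps) * (7 * N + 4) + 1"]
  show ?case by (simp add: fun_upd_def cong: if_cong)
next
  case (3 d k ps)
  then have k: "k \<noteq> d" "st k = Tp (replicate (u k) 1) []" "u k \<le> N" by auto
  let ?w = "replicate (u k) (1 :: nat)"
  have "runs (append_tape k d) st (7 * length ?w + 4 * length ([] :: word) + 4)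
      (st(k := Tp (?w @ []) [], d := Tp (m @ ?w @ []) []))"
    by (rule runs_append_tape) (use k 3 in auto)
  moreover have "st(k := Tp (?w @ []) [], d := Tp (m @ ?w @ []) []) = st(d := Tp (m @ ?w) [])"
    using k by (auto simp: fun_eq_iff)
  ultimately have 1: "runs (append_tape k d) st (7 * N + 4) (st(d := Tp (m @ ?w) []))"
    using k(3) by (auto elim: runs_mono)
  have "runs (emit d ps) (st(d := Tp (m @ ?w) [])) (length ps * (7 * N + 4) + 1)
      ((st(d := Tp (m @ ?w) []))(d := Tp ((m @ ?w) @ spells u ps) []))"
    by (rule "3.IH") (use 3 in auto)
  from runs_mono[OF runs_Seq[OF 1 this], of "length (Unary k # ps) * (7 * N + 4) + 1"]
  show ?case by (simp add: fun_upd_def cong: if_cong)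
qed

lemma runs_erase:
  assumes "st k = Tp l []" "0 \<notin> set l"
  shows "runs (erase k) st (3 * length l + 3) (st(k := Tp [] []))"
proof -
  have loop: "runs (Loop k k (\<lambda>s _. s \<noteq> 0) (Op k k (\<lambda>_. (0, Move_Left)))) st (3 * length l + 1) (st(k := before [] []))"
    if "st k = before l []" "0 \<notin> set l" for st l
    using that
  proof (induction l arbitrary: st rule: rev_induct)
    case Nil
    then have "st(k := before [] []) = st" by auto
    then show ?case using Nil runs_Loop_False[of "\<lambda>s _. s \<noteq> 0" st k k] by (simp add: read_before_Nil)
  next
    case (snoc x l)
    then have st: "st k = Tp l [x]" by (simp add: before_snoc)
    have "runs (Op k k (\<lambda>_. (0, Move_Left))) st 1 (st(k := before l []))"
      by (rule runs_Op) (simp add: st act_erase)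
    moreover have "runs (Loop k k (\<lambda>s _. s \<noteq> 0) (Op k k (\<lambda>_. (0, Move_Left)))) (st(k := before l []))
        (3 * length l + 1) ((st(k := before l []))(k := before [] []))"
      by (rule snoc.IH) (use snoc.prems in auto)
    ultimately have "runs (Loop k k (\<lambda>s _. s \<noteq> 0) (Op k k (\<lambda>_. (0, Move_Left)))) st
        (1 + 2 + (3 * length l + 1)) ((st(k := before l []))(k := before [] []))"
      using st snoc.prems by (intro runs_Loop_True) auto
    from runs_mono[OF this, of "3 * length (l @ [x]) + 1"] show ?case by (simp add: fun_upd_def cong: if_cong)
  qed
  have 1: "runs (Loop k k (\<lambda>s _. s \<noteq> 0) (Op k k (\<lambda>_. (0, Move_Left)))) (st(k := before l []))
      (3 * length l + 1) (st(k := before [] []))"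
    using loop[of "st(k := before l [])" l] assms by simp
  have 2: "runs (move_right k) (st(k := before [] [])) 1 (st(k := Tp [] []))"
    using runs_move_right_before[of "st(k := before [] [])" k] by simp
  show ?thesis
    unfolding erase_def
    by (rule runs_mono[OF runs_Seq[OF runs_move_left[of st k, OF assms(1)] runs_Seq[OF 1 2]]]) simp
qed

section \<open>Counting in binary\<close>

lemma binary_0: "binary 0 = []"
  by (simp add: binary.simps)

lemma binary_double: "binary (2 * n) = (if n = 0 then [] else 1 # binary n)"
  by (subst binary.simps) (simp add: binary_0)

lemma binary_double_Suc: "binary (2 * n + 1) = 2 # binary n"
  by (subst binary.simps) simp

lemma set_binary: "set (binary n) \<subseteq> {1, 2}"
proof (induction n rule: binary.induct)
  case (1 n)
  then show ?case by (cases "n = 0") (auto simp: binary_0 binary.simps[of n])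
qed

text \<open>A crude bound is enough, since the threshold itself is polynomial in the number of
  tokens.\<close>

lemma length_binary: "length (binary n) \<le> n"
proof (induction n rule: binary.induct)
  case (1 n)
  show ?case
  proof (cases "n = 0")
    case False
    then have "length (binary (n div 2)) \<le> n div 2" using 1 by simp
    moreover have "n div 2 < n" using False by simp
    ultimately show ?thesis using False by (simp add: binary.simps[of n])
  qed (simp add: binary_0)
qed

text \<open>\<open>tl r\<close> covers both ways in which a carry ends: a zero digit is overwritten,
  or the numeral grows by a digit.\<close>

lemma binary_Suc_decompose:
  "\<exists>a r. binary n = replicate a 2 @ r \<and> head_symbol r \<noteq> 2 \<and> binary (Suc n) = replicate a 1 @ 2 # tl r"
proof (induction n rule: less_induct)
  case (less n)
  consider "n = 0" | m where "n = 2 * m" "m \<noteq> 0" | m where "n = 2 * m + 1" by (metis mult_0_right oddE evenE)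
  then show ?case
  proof cases
    case 1
    then show ?thesis using binary_double_Suc[of 0] by (intro exI[of _ 0] exI[of _ "[]"]) (simp add: binary_0)
  next
    case 2
    then show ?thesis using binary_double[of m] binary_double_Suc[of m]
      by (intro exI[of _ 0] exI[of _ "binary n"]) simp
  next
    case 3
    then obtain a r where ar: "binary m = replicate a 2 @ r" "head_symbol r \<noteq> 2"
      "binary (Suc m) = replicate a 1 @ 2 # tl r"
      using less[of m] by auto
    have "Suc n = 2 * Suc m" using 3 by simp
    then show ?thesis using ar 3 binary_double[of "Suc m"] binary_double_Suc[of m]
      by (intro exI[of _ "Suc a"] exI[of _ r]) simp
  qed
qed

lemma runs_carry_loop:
  assumes "st k = Tp l (replicate a 2 @ r)" "head_symbol r \<noteq> 2"
  shows "runs (Loop k k (\<lambda>s _. s = 2) (put k 1)) st (3 * a + 1) (st(k := Tp (l @ replicate a 1) r))"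
  using assms
proof (induction a arbitrary: st l)
  case 0
  then have "st(k := Tp l r) = st" by auto
  then show ?case using 0 runs_Loop_False[of "\<lambda>s _. s = 2" st k k] by simp
next
  case (Suc a)
  let ?st = "st(k := Tp (l @ [1]) (replicate a 2 @ r))"
  have "runs (put k 1) st 1 ?st"
    using runs_put[of st k l "replicate (Suc a) 2 @ r" 1] Suc.prems by simp
  moreover have "runs (Loop k k (\<lambda>s _. s = 2) (put k 1)) ?st (3 * a + 1) (?st(k := Tp ((l @ [1]) @ replicate a 1) r))"
    by (rule Suc.IH) (use Suc.prems in auto)
  ultimately have "runs (Loop k k (\<lambda>s _. s = 2) (put k 1)) st (1 + 2 + (3 * a + 1))
      (?st(k := Tp ((l @ [1]) @ replicate a 1) r))"
    using Suc.prems by (intro runs_Loop_True) auto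
  from runs_mono[OF this, of "3 * Suc a + 1"] show ?case by (simp add: fun_upd_def cong: if_cong)
qed

lemma runs_increment:
  assumes "st k = Tp [] (binary n)"
  shows "runs (increment k) st (6 * n + 10) (st(k := Tp [] (binary (Suc n))))"
proof -
  obtain a r where ar: "binary n = replicate a 2 @ r" "head_symbol r \<noteq> 2"
    "binary (Suc n) = replicate a 1 @ 2 # tl r"
    using binary_Suc_decompose by blast
  have a: "a \<le> n" using length_binary[of n] ar(1) by simp
  have 1: "runs (Loop k k (\<lambda>s _. s = 2) (put k 1)) st (3 * a + 1) (st(k := Tp (replicate a 1) r))"
    using runs_carry_loop[of st k "[]"] assms ar by simp
  have 2: "runs (put k 2) (st(k := Tp (replicate a 1) r)) 1 (st(k := Tp (replicate a 1 @ [2]) (tl r)))"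
    using runs_put[of "st(k := Tp (replicate a 1) r)" k "replicate a 1" r 2] by simp
  have 3: "runs (rewind k {0<..}) (st(k := Tp (replicate a 1 @ [2]) (tl r))) (3 * length (replicate a 1 @ [2 :: nat]) + 3)
      (st(k := Tp [] (binary (Suc n))))"
    using runs_rewind[of "st(k := Tp (replicate a 1 @ [2]) (tl r))" k "[]" "replicate a 1 @ [2]" "tl r" "{0<..}"] ar
    by (auto simp: set_replicate_conv_if)
  show ?thesis
    unfolding increment_def
    by (rule runs_mono[OF runs_Seq[OF 1 runs_Seq[OF 2 3]]]) (use a in simp)
qed

lemma runs_repeat_increment:
  assumes "st k = Tp [] (binary n)" "n + m \<le> N"
  shows "runs (repeat m (increment k)) st (m * (6 * N + 10) + 1) (st(k := Tp [] (binary (n + m))))"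
  using assms
proof (induction m arbitrary: n st)
  case 0
  then have "st(k := Tp [] (binary n)) = st" by auto
  then show ?case using runs_nop by simp
next
  case (Suc m)
  let ?st = "st(k := Tp [] (binary (Suc n)))"
  have "runs (repeat m (increment k)) ?st (m * (6 * N + 10) + 1) (?st(k := Tp [] (binary (Suc n + m))))"
    by (rule Suc.IH) (use Suc.prems in auto)
  from runs_mono[OF runs_Seq[OF runs_increment[of st k n, OF Suc.prems(1)] this], of "Suc m * (6 * N + 10) + 1"]
  show ?case using Suc.prems by (simp add: fun_upd_def cong: if_cong)
qed

lemma well_formed_elementary [simp]:
  "well_formed n g (move_right k) \<longleftrightarrow> k < n"
  "well_formed n g (move_left k) \<longleftrightarrow> k < n"
  "0 < g \<Longrightarrow> well_formed n g (put k x) \<longleftrightarrow> k < n \<and> x < g"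
  "well_formed n g nop \<longleftrightarrow> 0 < n"
  "well_formed n g (skip k S) \<longleftrightarrow> k < n"
  "well_formed n g (rewind k S) \<longleftrightarrow> k < n"
  "well_formed n g (copy k d) \<longleftrightarrow> k < n \<and> d < n"
  "well_formed n g (append_tape k d) \<longleftrightarrow> k < n \<and> d < n"
  "0 < g \<Longrightarrow> well_formed n g (erase k) \<longleftrightarrow> k < n"
  "2 < g \<Longrightarrow> well_formed n g (increment k) \<longleftrightarrow> k < n"
  by (auto simp: move_right_def move_left_def put_def nop_def skip_def rewind_def copy_def
      append_tape_def erase_def increment_def)

lemma well_formed_repeat: "0 < n \<Longrightarrow> well_formed n g p \<Longrightarrow> well_formed n g (repeat m p)"
  by (induction m) auto

fun piece_ok :: "nat \<Rightarrow> nat \<Rightarrow> piece \<Rightarrow> bool" where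
  "piece_ok n g (Sym x) \<longleftrightarrow> x < g"
| "piece_ok n g (Unary k) \<longleftrightarrow> k < n"

lemma well_formed_emit:
  assumes "0 < g" "d < n"
  shows "list_all (piece_ok n g) ps \<Longrightarrow> well_formed n g (emit d ps)"
  using assms by (induction d ps rule: emit.induct) auto


section \<open>Encodings\<close>

lemma binary_pair_code: "binary (pair_code k x) = replicate k 1 @ 2 # binary x"
proof (induction k)
  case 0
  then show ?case using binary_double_Suc[of x] by (simp add: pair_code_0)
next
  case (Suc k)
  have "pair_code k x \<noteq> 0" by (simp add: pair_code_def)
  then show ?case using Suc by (simp add: pair_code_Suc binary_double)
qed

fun encode_token :: "token \<Rightarrow> word" where
  "encode_token (Lit l) = encode_literal l"
| "encode_token End = [4]"

fun token_sign :: "token \<Rightarrow> word" where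
  "token_sign (Lit (Pos x)) = [2]"
| "token_sign (Lit (Neg x)) = [1]"
| "token_sign End = []"

fun token_bits :: "token \<Rightarrow> word" where
  "token_bits (Lit l) = binary (literal_var l)"
| "token_bits End = []"

fun token_end :: "token \<Rightarrow> symbol" where
  "token_end (Lit l) = 3"
| "token_end End = 4"

lemma encode_token_split: "encode_token t = token_sign t @ token_bits t @ [token_end t]"
  by (cases t rule: token_sign.cases) (simp_all add: encode_number_def)

lemma set_token_sign: "set (token_sign t) \<subseteq> {1, 2}"
  by (cases t rule: token_sign.cases) auto

lemma set_token_bits: "set (token_bits t) \<subseteq> {1, 2}"
  using set_binary by (cases t rule: token_sign.cases) auto

lemma token_end_cases: "token_end t \<in> {3, 4}"
  by (cases t) auto

lemma set_encode_token: "set (encode_token t) \<subseteq> {1, 2, 3, 4}"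
  using set_token_sign[of t] set_token_bits[of t] token_end_cases[of t]
  by (auto simp: encode_token_split)

lemma binary_inj: "binary m = binary n \<longleftrightarrow> m = n"
proof
  show "binary m = binary n \<Longrightarrow> m = n"
  proof (induction m arbitrary: n rule: less_induct)
    case (less m)
    show ?case
    proof (cases "m = 0")
      case True
      then show ?thesis using less.prems by (cases "n = 0") (simp_all add: binary_0 binary.simps[of n])
    next
      case False
      then have n: "n \<noteq> 0" using less.prems by (cases "n = 0") (auto simp: binary_0 binary.simps[of m])
      have "m mod 2 = n mod 2" "binary (m div 2) = binary (n div 2)"
        using less.prems False n by (simp_all add: binary.simps[of n] binary.simps[of m])
      moreover from this have "m div 2 = n div 2" using False by (intro less.IH) auto
      ultimately show ?thesis by (metis div_mult_mod_eq)
    qed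
  qed
qed simp

text \<open>The terminators have to be compared too, because an end marker and a literal of the
  variable 0 both have the empty numeral.\<close>

lemma same_key_iff: "key t = key t' \<longleftrightarrow> token_bits t = token_bits t' \<and> token_end t = token_end t'"
  by (cases t; cases t') (auto simp: binary_inj)

definition encode_tokens :: "token list \<Rightarrow> word" where
  "encode_tokens ts = concat (map encode_token ts)"

lemma encode_cnf_tokens: "encode_cnf \<phi> = encode_tokens (tokens \<phi>)"
  by (induction \<phi>) (simp_all add: encode_cnf_def encode_tokens_def tokens_def comp_def)

definition encode_classes :: "nat list list \<Rightarrow> word" where
  "encode_classes cs = concat (map (\<lambda>c. concat (map encode_number c) @ [4]) cs)"

definition encode_gadgets :: "(nat list \<times> nat list) list \<Rightarrow> word" where
  "encode_gadgets gs = concat (map encode_edge (concat (map (\<lambda>(\<sigma>, vs). edges_of vs \<sigma>) gs)))"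

lemma encode_classes_simps:
  "encode_classes [] = []" "encode_classes (cs @ cs') = encode_classes cs @ encode_classes cs'"
  by (simp_all add: encode_classes_def)

lemma encode_gadgets_simps:
  "encode_gadgets [] = []" "encode_gadgets (gs @ gs') = encode_gadgets gs @ encode_gadgets gs'"
  by (simp_all add: encode_gadgets_def)

lemma encode_reduction:
  "encode_routing_instance (reduction ts) =
    encode_classes (class_lists (length ts)) @ [5] @ encode_gadgets (gadgets ts) @ [5] @
    encode_number (max_cycles (length ts))"
  by (simp add: encode_routing_instance_def reduction_def encode_classes_def encode_gadgets_def)


section \<open>The machine\<close>

text \<open>
  Tape 0 points to the \<open>i\<close>-th token of the input and tape 2, a copy of the input, to the \<open>j\<close>-th token.
  The classes and the edges are written to the tapes 1 and 3. The tapes 4 and 5 hold \<open>i\<close> and \<open>j\<close> in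
  unary, tape 6 holds the threshold in binary.
\<close>

definition node_pieces :: "nat \<Rightarrow> piece list \<Rightarrow> piece list \<Rightarrow> piece list" where
  "node_pieces r A B = replicate r (Sym 1) @ [Sym 2] @ A @ [Sym 2] @ B @ [Sym 2, Sym 3]"

definition class_pieces :: "piece list list \<Rightarrow> piece list" where
  "class_pieces us = concat us @ [Sym 4]"

text \<open>A template of \<open>encode_gadgets\<close>: wiring and labels are constants of the
  program, the vertices are left open as pieces.\<close>

definition gadget_pieces :: "nat list \<Rightarrow> piece list list \<Rightarrow> piece list" where
  "gadget_pieces \<sigma> us = concat (map (\<lambda>e.
     us ! (e div 2) @ map Sym (encode_number (e mod 2 + 1)) @
     us ! (\<sigma> ! e div 2) @ map Sym (encode_number (\<sigma> ! e mod 2 + 1))) [0..<length \<sigma>])"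

lemma spells_concat: "spells u (concat pss) = concat (map (spells u) pss)"
  by (induction pss) auto

lemma spells_Sym: "spells u (map Sym w) = w"
  by (induction w) auto

lemma spells_replicate_Sym: "spells u (replicate n (Sym x)) = replicate n x"
  by (induction n) auto

lemma spells_node_pieces:
  assumes "spells u A = replicate i 1" "spells u B = replicate j 1"
  shows "spells u (node_pieces r A B) = encode_number (node r i j)"
  using assms
  by (simp add: node_pieces_def spells_replicate_Sym node_def encode_number_def binary_pair_code binary_0)

lemma spells_class_pieces:
  assumes "map (spells u) us = map encode_number vs"
  shows "spells u (class_pieces us) = encode_classes [vs]"
  using assms by (simp add: class_pieces_def encode_classes_def spells_concat)

lemma spells_gadget_pieces:
  assumes "map (spells u) us = map encode_number vs" "wiring \<sigma> vs"
  shows "spells u (gadget_pieces \<sigma> us) = encode_gadgets [(\<sigma>, vs)]"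
proof -
  have l: "length us = length vs" using assms(1) by (metis length_map)
  have n: "spells u (us ! k) = encode_number (vs ! k)" if "k < length vs" for k
    using assms(1) that l by (metis nth_map)
  have \<sigma>: "e div 2 < length vs" "\<sigma> ! e div 2 < length vs" if "e < length \<sigma>" for e
    using wiring_nth_less[OF assms(2) that] assms(2) that by (auto simp: wiring_def)
  show ?thesis
    unfolding gadget_pieces_def encode_gadgets_def edges_of_def spells_concat
    by (simp add: spells_Sym) (rule arg_cong[where f = concat], rule map_cong, auto simp: n \<sigma> spells_Sym)
qed

definition conf :: "tape \<Rightarrow> tape \<Rightarrow> tape \<Rightarrow> tape \<Rightarrow> tape \<Rightarrow> tape \<Rightarrow> tape \<Rightarrow> store" where
  "conf t0 t1 t2 t3 t4 t5 t6 = (\<lambda>k. if k = 0 then t0 else if k = Suc 0 then t1 else if k = 2 then t2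
     else if k = 3 then t3 else if k = 4 then t4 else if k = 5 then t5 else if k = 6 then t6 else blank)"

lemma conf_simps [simp]:
  "conf t0 t1 t2 t3 t4 t5 t6 0 = t0" "conf t0 t1 t2 t3 t4 t5 t6 (Suc 0) = t1"
  "conf t0 t1 t2 t3 t4 t5 t6 2 = t2" "conf t0 t1 t2 t3 t4 t5 t6 3 = t3"
  "conf t0 t1 t2 t3 t4 t5 t6 4 = t4" "conf t0 t1 t2 t3 t4 t5 t6 5 = t5"
  "conf t0 t1 t2 t3 t4 t5 t6 6 = t6"
  "(conf t0 t1 t2 t3 t4 t5 t6)(0 := t) = conf t t1 t2 t3 t4 t5 t6"
  "(conf t0 t1 t2 t3 t4 t5 t6)(Suc 0 := t) = conf t0 t t2 t3 t4 t5 t6"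
  "(conf t0 t1 t2 t3 t4 t5 t6)(2 := t) = conf t0 t1 t t3 t4 t5 t6"
  "(conf t0 t1 t2 t3 t4 t5 t6)(3 := t) = conf t0 t1 t2 t t4 t5 t6"
  "(conf t0 t1 t2 t3 t4 t5 t6)(4 := t) = conf t0 t1 t2 t3 t t5 t6"
  "(conf t0 t1 t2 t3 t4 t5 t6)(5 := t) = conf t0 t1 t2 t3 t4 t t6"
  "(conf t0 t1 t2 t3 t4 t5 t6)(6 := t) = conf t0 t1 t2 t3 t4 t5 t"
  by (auto simp: conf_def fun_eq_iff)

lemma input_store_conf:
  "input_store w = conf (Tp [] w) (Tp [] []) (Tp [] []) (Tp [] []) (Tp [] []) (Tp [] []) (Tp [] [])"
  by (auto simp: input_store_def conf_def blank_Tp fun_eq_iff) (simp_all add: Tp_def)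

definition U :: "nat \<Rightarrow> tape" where
  "U n = Tp (replicate n 1) []"

abbreviation pieces_ok :: "piece list \<Rightarrow> bool" where
  "pieces_ok ps \<equiv> (\<forall>k. Unary k \<in> set ps \<longrightarrow> k = 4 \<or> k = 5)"

text \<open>The counters on the tapes 4 and 5; \<open>pieces_ok\<close> ensures that no other tape
  is asked for.\<close>

definition indices :: "nat \<Rightarrow> nat \<Rightarrow> nat \<Rightarrow> nat" where
  "indices i j k = (if k = 4 then i else j)"

definition emit_time :: "piece list \<Rightarrow> nat \<Rightarrow> nat" where
  "emit_time ps N = length ps * (7 * N + 4) + 1"

lemma runs_emit_1:
  assumes "pieces_ok ps" "i \<le> N" "j \<le> N"
  shows "runs (emit 1 ps) (conf t0 (Tp w []) t2 t3 (U i) (U j) t6) (emit_time ps N)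
    (conf t0 (Tp (w @ spells (indices i j) ps) []) t2 t3 (U i) (U j) t6)"
proof -
  have "runs (emit 1 ps) (conf t0 (Tp w []) t2 t3 (U i) (U j) t6) (length ps * (7 * N + 4) + 1)
    ((conf t0 (Tp w []) t2 t3 (U i) (U j) t6)(1 := Tp (w @ spells (indices i j) ps) []))"
  proof (rule runs_emit)
    fix k assume "Unary k \<in> set ps"
    then have "k = 4 \<or> k = 5" using assms(1) by auto
    then show "k \<noteq> 1 \<and> conf t0 (Tp w []) t2 t3 (U i) (U j) t6 k = Tp (replicate (indices i j k) 1) [] \<and> indices i j k \<le> N"
      using assms(2,3) by (auto simp: U_def indices_def)
  qed simp
  then show ?thesis by (simp add: emit_time_def)
qed

lemma runs_emit_3:
  assumes "pieces_ok ps" "i \<le> N" "j \<le> N"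
  shows "runs (emit 3 ps) (conf t0 t1 t2 (Tp w []) (U i) (U j) t6) (emit_time ps N)
    (conf t0 t1 t2 (Tp (w @ spells (indices i j) ps) []) (U i) (U j) t6)"
proof -
  have "runs (emit 3 ps) (conf t0 t1 t2 (Tp w []) (U i) (U j) t6) (length ps * (7 * N + 4) + 1)
    ((conf t0 t1 t2 (Tp w []) (U i) (U j) t6)(3 := Tp (w @ spells (indices i j) ps) []))"
  proof (rule runs_emit)
    fix k assume "Unary k \<in> set ps"
    then have "k = 4 \<or> k = 5" using assms(1) by auto
    then show "k \<noteq> 3 \<and> conf t0 t1 t2 (Tp w []) (U i) (U j) t6 k = Tp (replicate (indices i j k) 1) [] \<and> indices i j k \<le> N"
      using assms(2,3) by (auto simp: U_def indices_def)
  qed simp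
  then show ?thesis by (simp add: emit_time_def)
qed

lemma runs_count:
  assumes "c + m \<le> N"
  shows "runs (repeat m (increment 6)) (conf t0 t1 t2 t3 t4 t5 (Tp [] (binary c))) (m * (6 * N + 10) + 1)
    (conf t0 t1 t2 t3 t4 t5 (Tp [] (binary (c + m))))"
  using runs_repeat_increment[of "conf t0 t1 t2 t3 t4 t5 (Tp [] (binary c))" 6 c m N] assms by simp

lemma runs_put_U4: "runs (put 4 1) (conf t0 t1 t2 t3 (U i) t5 t6) 1 (conf t0 t1 t2 t3 (U (Suc i)) t5 t6)"
  using runs_put[of "conf t0 t1 t2 t3 (U i) t5 t6" 4 "replicate i 1" "[]" 1]
  by (simp add: U_def replicate_append_same)

lemma runs_put_U5: "runs (put 5 1) (conf t0 t1 t2 t3 t4 (U i) t6) 1 (conf t0 t1 t2 t3 t4 (U (Suc i)) t6)"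
  using runs_put[of "conf t0 t1 t2 t3 t4 (U i) t6" 5 "replicate i 1" "[]" 1]
  by (simp add: U_def replicate_append_same)

section \<open>Comparing the variables of two tokens\<close>

definition skip_sign :: "nat \<Rightarrow> prog" where
  "skip_sign k = Cond k k (\<lambda>s _. s \<in> {1, 2}) (move_right k) nop"

definition lockstep :: prog where
  "lockstep = Loop 0 2 (\<lambda>s s'. s = s' \<and> s \<in> {1, 2}) (move_right 0 ;; move_right 2)"

text \<open>An end marker has no sign and consists of the symbol 4, so the test leaves the head
  where it is.\<close>

lemma runs_skip_sign:
  assumes "st k = Tp l (encode_token t @ r)"
  shows "runs (skip_sign k) st 3 (st(k := Tp (l @ token_sign t) (token_bits t @ [token_end t] @ r)))"
proof (cases t)
  case End
  have "runs nop st 1 st" by (rule runs_nop)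
  then have "runs (skip_sign k) st (1 + 2) st"
    unfolding skip_sign_def by (intro runs_Cond_False) (use assms End in auto)
  moreover have "st(k := Tp (l @ token_sign t) (token_bits t @ [token_end t] @ r)) = st"
    using assms End by auto
  ultimately show ?thesis by (simp add: numeral_3_eq_3)
next
  case (Lit x)
  then obtain s where s: "token_sign t = [s]" "s \<in> {1, 2}" by (cases t rule: token_sign.cases) auto
  then have st: "st k = Tp l (s # token_bits t @ [token_end t] @ r)"
    using assms by (simp add: encode_token_split)
  have "runs (skip_sign k) st (1 + 2) (st(k := Tp (l @ [s]) (token_bits t @ [token_end t] @ r)))"
    unfolding skip_sign_def by (intro runs_Cond_True runs_move_right) (use st s in auto)
  then show ?thesis using s by (simp add: numeral_3_eq_3)
qed

text \<open>The heads run along the common prefix \<open>c\<close> and stop at the first difference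
  or at a terminator. Terminators are not digits, so the two symbols then read agree exactly if both
  numerals have ended, with the same terminator.\<close>

lemma runs_lockstep:
  assumes "st 0 = Tp l (b @ [e] @ r)" "st 2 = Tp l' (b' @ [e'] @ r')"
    and "set b \<subseteq> {1, 2}" "set b' \<subseteq> {1, 2}" "e \<notin> {1, 2}" "e' \<notin> {1, 2}"
  shows "\<exists>c d d'. b = c @ d \<and> b' = c @ d' \<and>
    (head_symbol (d @ [e]) = head_symbol (d' @ [e']) \<longleftrightarrow> b = b' \<and> e = e') \<and>
    runs lockstep st (4 * length b + 1) (st(0 := Tp (l @ c) (d @ [e] @ r), 2 := Tp (l' @ c) (d' @ [e'] @ r')))"
  using assms
proof (induction b arbitrary: b' l l' st)
  case Nil
  have "runs lockstep st 1 st"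
    unfolding lockstep_def by (rule runs_Loop_False) (use Nil in auto)
  moreover have "st(0 := Tp (l @ []) ([] @ [e] @ r), 2 := Tp (l' @ []) (b' @ [e'] @ r')) = st"
    using Nil by (auto simp: fun_eq_iff)
  moreover have "head_symbol ([] @ [e]) = head_symbol (b' @ [e']) \<longleftrightarrow> [] = b' \<and> e = e'"
    using Nil by (cases b') auto
  ultimately show ?case by (intro exI[of _ "[]"] exI[of _ b']) (simp only: append_Nil list.size mult_0_right add_0 simp_thms)
next
  case (Cons x b)
  show ?case
  proof (cases "\<exists>b''. b' = x # b''")
    case False
    have ne: "head_symbol ((x # b) @ [e]) \<noteq> head_symbol (b' @ [e'])"
      using Cons.prems False by (cases b') auto
    have "runs lockstep st 1 st"
      unfolding lockstep_def by (rule runs_Loop_False) (use Cons.prems ne in \<open>cases b'; auto\<close>)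
    then have "runs lockstep st (4 * length (x # b) + 1) st" by (rule runs_mono) simp
    moreover have "st(0 := Tp (l @ []) ((x # b) @ [e] @ r), 2 := Tp (l' @ []) (b' @ [e'] @ r')) = st"
      using Cons.prems by (auto simp: fun_eq_iff)
    ultimately show ?thesis using ne False
      by - (rule exI[of _ "[]"], rule exI[of _ "x # b"], rule exI[of _ b'], auto simp: fun_upd_def)
  next
    case True
    then obtain b'' where b': "b' = x # b''" by auto
    let ?st1 = "st(0 := Tp (l @ [x]) (b @ [e] @ r))"
    let ?st = "?st1(2 := Tp (l' @ [x]) (b'' @ [e'] @ r'))"
    have "\<exists>c d d'. b = c @ d \<and> b'' = c @ d' \<and>
      (head_symbol (d @ [e]) = head_symbol (d' @ [e']) \<longleftrightarrow> b = b'' \<and> e = e') \<and>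
      runs lockstep ?st (4 * length b + 1)
        (?st(0 := Tp ((l @ [x]) @ c) (d @ [e] @ r), 2 := Tp ((l' @ [x]) @ c) (d' @ [e'] @ r')))"
      by (rule Cons.IH) (use Cons.prems b' in auto)
    then obtain c d d' where cd: "b = c @ d" "b'' = c @ d'"
      "head_symbol (d @ [e]) = head_symbol (d' @ [e']) \<longleftrightarrow> b = b'' \<and> e = e'"
      and run: "runs lockstep ?st (4 * length b + 1)
        (?st(0 := Tp ((l @ [x]) @ c) (d @ [e] @ r), 2 := Tp ((l' @ [x]) @ c) (d' @ [e'] @ r')))"
      by blast
    have m: "runs (move_right 0 ;; move_right 2) st (1 + 1) ?st"
      by (rule runs_Seq[where st' = ?st1]; rule runs_move_right) (use Cons.prems b' in auto)
    have "runs lockstep st (1 + 1 + 2 + (4 * length b + 1))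
        (?st(0 := Tp ((l @ [x]) @ c) (d @ [e] @ r), 2 := Tp ((l' @ [x]) @ c) (d' @ [e'] @ r')))"
      unfolding lockstep_def
      by (rule runs_Loop_True[OF _ m run[unfolded lockstep_def]]) (use Cons.prems b' in auto)
    moreover have "?st(0 := Tp ((l @ [x]) @ c) (d @ [e] @ r), 2 := Tp ((l' @ [x]) @ c) (d' @ [e'] @ r')) =
        st(0 := Tp (l @ x # c) (d @ [e] @ r), 2 := Tp (l' @ x # c) (d' @ [e'] @ r'))"
      by (auto simp: fun_eq_iff)
    ultimately have "runs lockstep st (1 + 1 + 2 + (4 * length b + 1))
        (st(0 := Tp (l @ x # c) (d @ [e] @ r), 2 := Tp (l' @ x # c) (d' @ [e'] @ r')))"
      by (simp only:)
    then have "runs lockstep st (4 * length (x # b) + 1)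
        (st(0 := Tp (l @ x # c) (d @ [e] @ r), 2 := Tp (l' @ x # c) (d' @ [e'] @ r')))"
      by (rule runs_mono) simp
    then show ?thesis using cd b'
      by - (rule exI[of _ "x # c"], rule exI[of _ d], rule exI[of _ d'], simp add: fun_upd_def)
  qed
qed

section \<open>Positions in the encoded input\<close>

definition scanned :: "token list \<Rightarrow> nat \<Rightarrow> word" where
  "scanned ts i = encode_tokens (take i ts)"

definition remaining :: "token list \<Rightarrow> nat \<Rightarrow> word" where
  "remaining ts i = encode_tokens (drop i ts)"

lemma remaining_Cons: "i < length ts \<Longrightarrow> remaining ts i = encode_token (ts ! i) @ remaining ts (Suc i)"
  by (simp add: remaining_def encode_tokens_def Cons_nth_drop_Suc[symmetric])

lemma scanned_Suc: "i < length ts \<Longrightarrow> scanned ts (Suc i) = scanned ts i @ encode_token (ts ! i)"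
  by (simp add: scanned_def encode_tokens_def take_Suc_conv_app_nth)

lemma scanned_remaining: "scanned ts i @ remaining ts i = encode_tokens ts"
  unfolding scanned_def remaining_def encode_tokens_def by (metis append_take_drop_id concat_append map_append)

lemma scanned_0: "scanned ts 0 = []" and remaining_0: "remaining ts 0 = encode_tokens ts"
  and remaining_length: "remaining ts (length ts) = []" and scanned_length: "scanned ts (length ts) = encode_tokens ts"
  by (simp_all add: scanned_def remaining_def encode_tokens_def)

text \<open>Tokens end with 3 or 4, so rewinding over the symbols 1 and 2 stops at the start of the
  current token, after passing its sign.\<close>

lemma last_scanned: "i \<le> length ts \<Longrightarrow> scanned ts i \<noteq> [] \<Longrightarrow> last (scanned ts i) \<notin> {1, 2}"
  using token_end_cases[of "ts ! (i - 1)"]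
  by (cases i) (auto simp: scanned_0 scanned_Suc encode_token_split)

lemma head_remaining: "i < length ts \<Longrightarrow> head_symbol (remaining ts i) \<noteq> 0"
  by (cases "ts ! i" rule: token_sign.cases) (simp_all add: remaining_Cons)

lemma length_encode_token: "i < length ts \<Longrightarrow> length (encode_token (ts ! i)) \<le> length (encode_tokens ts)"
  using scanned_remaining[of ts i] by (metis remaining_Cons length_append le_add1 le_add2 le_trans)

text \<open>Every token takes at least one symbol, so the input length bounds the number of tokens
  and the unary counters.\<close>

lemma length_tokens: "length ts \<le> length (encode_tokens ts)"
proof (induction ts)
  case (Cons t ts)
  then show ?case by (simp add: encode_tokens_def encode_token_split)
qed simp

lemma zero_not_in_encode_tokens: "0 \<notin> set (encode_tokens ts)"
  using set_encode_token by (fastforce simp: encode_tokens_def)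

section \<open>The inner loop, one cell at a time\<close>

abbreviation I_pieces :: "piece list" where "I_pieces \<equiv> [Unary 4]"
abbreviation J_pieces :: "piece list" where "J_pieces \<equiv> [Unary 5]"

definition row_class_pieces :: "piece list" where
  "row_class_pieces = class_pieces (map (\<lambda>r. node_pieces r I_pieces J_pieces) [0, 1, 2, 3])"

definition chain_pieces :: "piece list" where
  "chain_pieces = gadget_pieces eq_wire [node_pieces 1 I_pieces J_pieces, node_pieces 0 I_pieces (J_pieces @ [Sym 1])]"

definition same_pieces :: "piece list" where
  "same_pieces = gadget_pieces eq_wire [node_pieces 2 I_pieces J_pieces, node_pieces 3 J_pieces I_pieces]"

definition different_pieces :: "piece list" where
  "different_pieces = gadget_pieces eq_wire [node_pieces 2 I_pieces J_pieces, node_pieces 3 I_pieces J_pieces]"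

text \<open>Tape 0 is taken back to the start of token \<open>i\<close>, whereas tape 2 proceeds to
  the next token. The four increments are the maxima of the two gadgets of a cell.\<close>

definition cell_prog :: prog where
  "cell_prog =
     emit 1 row_class_pieces ;; emit 3 chain_pieces ;;
     skip_sign 0 ;; skip_sign 2 ;; lockstep ;;
     Cond 0 2 (=) (emit 3 same_pieces) (emit 3 different_pieces) ;;
     skip 2 {1, 2} ;; move_right 2 ;; rewind 0 {1, 2} ;;
     repeat 4 (increment 6) ;; put 5 1"

text \<open>\<open>N\<close> bounds the length of the input and \<open>K\<close> the counter of the
  threshold. The bracketing follows that of \<open>;;\<close>, so that \<open>runs_Seq\<close>
  produces this expression literally.\<close>

definition cell_time :: "nat \<Rightarrow> nat \<Rightarrow> nat" where
  "cell_time N K =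
     emit_time row_class_pieces N + (emit_time chain_pieces N +
     (3 + (3 + ((4 * N + 1) +
     ((emit_time same_pieces N + emit_time different_pieces N + 2) +
     ((3 * N + 1) + (1 + ((3 * N + 3) +
     ((4 * (6 * K + 10) + 1) + 1)))))))))"

lemma pieces_ok_node_pieces:
  "Unary k \<in> set (node_pieces r A B) \<longleftrightarrow> Unary k \<in> set A \<or> Unary k \<in> set B"
  by (auto simp: node_pieces_def)

lemma pieces_ok_class_pieces:
  "Unary k \<in> set (class_pieces us) \<longleftrightarrow> (\<exists>u \<in> set us. Unary k \<in> set u)"
  by (auto simp: class_pieces_def)

lemma pieces_ok_gadget_pieces:
  assumes "Unary k \<in> set (gadget_pieces \<sigma> us)" "wiring \<sigma> us"
  shows "\<exists>u \<in> set us. Unary k \<in> set u"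
proof -
  obtain e where e: "e < length \<sigma>" "Unary k \<in> set (us ! (e div 2)) \<or> Unary k \<in> set (us ! (\<sigma> ! e div 2))"
    using assms(1) by (auto simp: gadget_pieces_def)
  have "e div 2 < length us" "\<sigma> ! e div 2 < length us"
    using wiring_nth_less[OF assms(2) e(1)] assms(2) e(1) by (auto simp: wiring_def)
  then show ?thesis using e(2) nth_mem by blast
qed

lemma runs_cell:
  assumes i: "i < length ts" and j: "j < length ts" and N: "length (encode_tokens ts) \<le> N" and K: "c + 4 \<le> K"
  shows "runs cell_prog
    (conf (Tp (scanned ts i) (remaining ts i)) (Tp w1 []) (Tp (scanned ts j) (remaining ts j)) (Tp w3 []) (U i) (U j) (Tp [] (binary c)))
    (cell_time N K)
    (conf (Tp (scanned ts i) (remaining ts i)) (Tp (w1 @ encode_classes [row_class i j]) [])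
      (Tp (scanned ts (Suc j)) (remaining ts (Suc j))) (Tp (w3 @ encode_gadgets (cell_gadgets ts i j)) [])
      (U i) (U (Suc j)) (Tp [] (binary (c + 4))))"
proof -
  let ?ti = "ts ! i" and ?tj = "ts ! j"
  let ?u = "indices i j"
  let ?w1 = "w1 @ encode_classes [row_class i j]"
  let ?g1 = "(eq_wire, [node 1 i j, node 0 i (Suc j)])"
  let ?g2 = "(eq_wire, [node 2 i j, if key ?ti = key ?tj then node 3 j i else node 3 i j])"
  let ?c = "Tp [] (binary c)"
  have iN: "i \<le> N" and jN: "j \<le> N" using i j N length_tokens[of ts] by auto
  have sI: "spells ?u I_pieces = replicate i 1" and sJ: "spells ?u J_pieces = replicate j 1"
    and sJ1: "spells ?u (J_pieces @ [Sym 1]) = replicate (Suc j) 1"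
    by (simp_all add: indices_def replicate_append_same)
  have s1: "spells ?u row_class_pieces = encode_classes [row_class i j]"
    unfolding row_class_pieces_def
    by (rule spells_class_pieces) (simp add: row_class_def spells_node_pieces[OF sI sJ])
  have s2: "spells ?u chain_pieces = encode_gadgets [?g1]"
    unfolding chain_pieces_def
    by (rule spells_gadget_pieces[OF _ wiring_eq_wire])
      (simp only: list.map spells_node_pieces[OF sI sJ] spells_node_pieces[OF sI sJ1])
  have s3: "spells ?u same_pieces = encode_gadgets [(eq_wire, [node 2 i j, node 3 j i])]"
    unfolding same_pieces_def
    by (rule spells_gadget_pieces[OF _ wiring_eq_wire])
      (simp add: spells_node_pieces[OF sI sJ] spells_node_pieces[OF sJ sI] del: spells_simps)
  have s4: "spells ?u different_pieces = encode_gadgets [(eq_wire, [node 2 i j, node 3 i j])]"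
    unfolding different_pieces_def
    by (rule spells_gadget_pieces[OF _ wiring_eq_wire])
      (simp add: spells_node_pieces[OF sI sJ] del: spells_simps)
  have ok: "pieces_ok row_class_pieces" "pieces_ok chain_pieces" "pieces_ok same_pieces" "pieces_ok different_pieces"
    unfolding row_class_pieces_def chain_pieces_def same_pieces_def different_pieces_def
    by (auto simp: pieces_ok_class_pieces pieces_ok_node_pieces
        dest!: pieces_ok_gadget_pieces[OF _ wiring_eq_wire])
  have li: "length (token_sign ?ti @ token_bits ?ti) \<le> N" and lj: "length (token_sign ?tj @ token_bits ?tj) \<le> N"
    using length_encode_token[OF i] length_encode_token[OF j] N by (auto simp: encode_token_split)
  let ?Ti = "remaining ts (Suc i)" and ?Tj = "remaining ts (Suc j)"
  let ?S0 = "conf (Tp (scanned ts i) (remaining ts i)) (Tp w1 []) (Tp (scanned ts j) (remaining ts j)) (Tp w3 []) (U i) (U j) ?c"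
  let ?S1 = "conf (Tp (scanned ts i) (remaining ts i)) (Tp ?w1 []) (Tp (scanned ts j) (remaining ts j)) (Tp w3 []) (U i) (U j) ?c"
  have r1: "runs (emit 1 row_class_pieces) ?S0 (emit_time row_class_pieces N) ?S1"
    using runs_emit_1[OF ok(1) iN jN] unfolding s1 .
  let ?w3 = "w3 @ encode_gadgets [?g1]"
  let ?S2 = "conf (Tp (scanned ts i) (remaining ts i)) (Tp ?w1 []) (Tp (scanned ts j) (remaining ts j)) (Tp ?w3 []) (U i) (U j) ?c"
  have r2: "runs (emit 3 chain_pieces) ?S1 (emit_time chain_pieces N) ?S2"
    using runs_emit_3[OF ok(2) iN jN] unfolding s2 .
  let ?S3 = "conf (Tp (scanned ts i @ token_sign ?ti) (token_bits ?ti @ [token_end ?ti] @ ?Ti))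
      (Tp ?w1 []) (Tp (scanned ts j) (remaining ts j)) (Tp ?w3 []) (U i) (U j) ?c"
  have r3: "runs (skip_sign 0) ?S2 3 ?S3"
    using runs_skip_sign[of ?S2 0 "scanned ts i" ?ti ?Ti] remaining_Cons[OF i] by simp
  let ?S4 = "conf (Tp (scanned ts i @ token_sign ?ti) (token_bits ?ti @ [token_end ?ti] @ ?Ti)) (Tp ?w1 [])
      (Tp (scanned ts j @ token_sign ?tj) (token_bits ?tj @ [token_end ?tj] @ ?Tj)) (Tp ?w3 []) (U i) (U j) ?c"
  have r4: "runs (skip_sign 2) ?S3 3 ?S4"
    using runs_skip_sign[of ?S3 2 "scanned ts j" ?tj ?Tj] remaining_Cons[OF j] by simp
  have e: "token_end ?ti \<notin> {1, 2}" "token_end ?tj \<notin> {1, 2}"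
    using token_end_cases[of ?ti] token_end_cases[of ?tj] by auto
  have "\<exists>b d d'. token_bits ?ti = b @ d \<and> token_bits ?tj = b @ d' \<and>
    (head_symbol (d @ [token_end ?ti]) = head_symbol (d' @ [token_end ?tj]) \<longleftrightarrow>
      token_bits ?ti = token_bits ?tj \<and> token_end ?ti = token_end ?tj) \<and>
    runs lockstep ?S4 (4 * length (token_bits ?ti) + 1)
      (?S4(0 := Tp ((scanned ts i @ token_sign ?ti) @ b) (d @ [token_end ?ti] @ ?Ti),
           2 := Tp ((scanned ts j @ token_sign ?tj) @ b) (d' @ [token_end ?tj] @ ?Tj)))"
    by (rule runs_lockstep) (use e set_token_bits in simp_all)
  then obtain b d d' where bd: "token_bits ?ti = b @ d" "token_bits ?tj = b @ d'"
    and same: "head_symbol (d @ [token_end ?ti]) = head_symbol (d' @ [token_end ?tj]) \<longleftrightarrow>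
      token_bits ?ti = token_bits ?tj \<and> token_end ?ti = token_end ?tj"
    and run: "runs lockstep ?S4 (4 * length (token_bits ?ti) + 1)
      (?S4(0 := Tp ((scanned ts i @ token_sign ?ti) @ b) (d @ [token_end ?ti] @ ?Ti),
           2 := Tp ((scanned ts j @ token_sign ?tj) @ b) (d' @ [token_end ?tj] @ ?Tj)))"
    by blast
  let ?A = "Tp (scanned ts i @ token_sign ?ti @ b) (d @ [token_end ?ti] @ ?Ti)"
  let ?B = "Tp (scanned ts j @ token_sign ?tj @ b) (d' @ [token_end ?tj] @ ?Tj)"
  let ?S5 = "conf ?A (Tp ?w1 []) ?B (Tp ?w3 []) (U i) (U j) ?c"
  have r5: "runs lockstep ?S4 (4 * N + 1) ?S5"
    using runs_mono[OF run, of "4 * N + 1"] li by simp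
  \<comment> \<open>The terminators keep both words nonempty, so the rest of the tape does not
    affect the symbols read.\<close>
  have same': "head_symbol (d @ [token_end ?ti] @ ?Ti) = head_symbol (d' @ [token_end ?tj] @ ?Tj) \<longleftrightarrow> key ?ti = key ?tj"
    unfolding same_key_iff same[symmetric] by (cases d; cases d') auto
  let ?w3' = "?w3 @ encode_gadgets [?g2]"
  let ?S6 = "conf ?A (Tp ?w1 []) ?B (Tp ?w3' []) (U i) (U j) ?c"
  have r6: "runs (Cond 0 2 (=) (emit 3 same_pieces) (emit 3 different_pieces)) ?S5
      (emit_time same_pieces N + emit_time different_pieces N + 2) ?S6"
  proof (cases "key ?ti = key ?tj")
    case True
    have "runs (emit 3 same_pieces) ?S5 (emit_time same_pieces N)
      (conf ?A (Tp ?w1 []) ?B (Tp (?w3 @ encode_gadgets [(eq_wire, [node 2 i j, node 3 j i])]) []) (U i) (U j) ?c)"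
      using runs_emit_3[OF ok(3) iN jN] unfolding s3 .
    then have "runs (emit 3 same_pieces) ?S5 (emit_time same_pieces N) ?S6"
      by (simp only: True simp_thms if_True if_False)
    then have "runs (Cond 0 2 (=) (emit 3 same_pieces) (emit 3 different_pieces)) ?S5
      (emit_time same_pieces N + 2) ?S6"
      by (intro runs_Cond_True) (use True same' in auto)
    then show ?thesis by (rule runs_mono) simp
  next
    case False
    have "runs (emit 3 different_pieces) ?S5 (emit_time different_pieces N)
      (conf ?A (Tp ?w1 []) ?B (Tp (?w3 @ encode_gadgets [(eq_wire, [node 2 i j, node 3 i j])]) []) (U i) (U j) ?c)"
      using runs_emit_3[OF ok(4) iN jN] unfolding s4 .
    then have "runs (emit 3 different_pieces) ?S5 (emit_time different_pieces N) ?S6"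
      by (simp only: False simp_thms if_True if_False)
    then have "runs (Cond 0 2 (=) (emit 3 same_pieces) (emit 3 different_pieces)) ?S5
      (emit_time different_pieces N + 2) ?S6"
      by (intro runs_Cond_False) (use False same' in auto)
    then show ?thesis by (rule runs_mono) simp
  qed
  let ?S7 = "conf ?A (Tp ?w1 []) (Tp (scanned ts j @ token_sign ?tj @ b @ d') ([token_end ?tj] @ ?Tj)) (Tp ?w3' []) (U i) (U j) ?c"
  have "runs (skip 2 {1, 2}) ?S6 (3 * length d' + 1) ?S7"
    using runs_skip[of ?S6 2 "scanned ts j @ token_sign ?tj @ b" d' "[token_end ?tj] @ ?Tj" "{1, 2}"]
      set_token_bits[of ?tj] e bd by simp
  then have r7: "runs (skip 2 {1, 2}) ?S6 (3 * N + 1) ?S7"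
    by (rule runs_mono) (use lj bd in simp)
  let ?S8 = "conf ?A (Tp ?w1 []) (Tp (scanned ts (Suc j)) ?Tj) (Tp ?w3' []) (U i) (U j) ?c"
  have r8: "runs (move_right 2) ?S7 1 ?S8"
    using runs_move_right[of ?S7 2 "scanned ts j @ token_sign ?tj @ b @ d'" "token_end ?tj" ?Tj] bd
    by (simp add: scanned_Suc[OF j] encode_token_split)
  let ?S9 = "conf (Tp (scanned ts i) (remaining ts i)) (Tp ?w1 []) (Tp (scanned ts (Suc j)) ?Tj) (Tp ?w3' []) (U i) (U j) ?c"
  have "runs (rewind 0 {1, 2}) ?S8 (3 * length (token_sign ?ti @ b) + 3)
    (?S8(0 := Tp (scanned ts i) ((token_sign ?ti @ b) @ d @ [token_end ?ti] @ ?Ti)))"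
    by (rule runs_rewind) (use set_token_sign[of ?ti] set_token_bits[of ?ti] bd last_scanned[of i ts] i in auto)
  moreover have "?S8(0 := Tp (scanned ts i) ((token_sign ?ti @ b) @ d @ [token_end ?ti] @ ?Ti)) = ?S9"
    using bd by (simp add: remaining_Cons[OF i] encode_token_split)
  ultimately have "runs (rewind 0 {1, 2}) ?S8 (3 * length (token_sign ?ti @ b) + 3) ?S9"
    by (simp only:)
  then have r9: "runs (rewind 0 {1, 2}) ?S8 (3 * N + 3) ?S9"
    by (rule runs_mono) (use li bd in simp)
  let ?S10 = "conf (Tp (scanned ts i) (remaining ts i)) (Tp ?w1 []) (Tp (scanned ts (Suc j)) ?Tj) (Tp ?w3' []) (U i) (U j) (Tp [] (binary (c + 4)))"
  have r10: "runs (repeat 4 (increment 6)) ?S9 (4 * (6 * K + 10) + 1) ?S10"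
    by (rule runs_count[OF K])
  let ?S11 = "conf (Tp (scanned ts i) (remaining ts i)) (Tp ?w1 []) (Tp (scanned ts (Suc j)) ?Tj) (Tp ?w3' []) (U i) (U (Suc j)) (Tp [] (binary (c + 4)))"
  have r11: "runs (put 5 1) ?S10 1 ?S11"
    by (rule runs_put_U5)
  have w: "?w3' = w3 @ encode_gadgets (cell_gadgets ts i j)"
    unfolding cell_gadgets_def using encode_gadgets_simps(2)[of "[?g1]" "[?g2]"] by simp
  show ?thesis
    unfolding cell_prog_def cell_time_def w[symmetric]
    by (intro runs_Seq[OF r1] runs_Seq[OF r2] runs_Seq[OF r3] runs_Seq[OF r4] runs_Seq[OF r5] runs_Seq[OF r6]
        runs_Seq[OF r7] runs_Seq[OF r8] runs_Seq[OF r9] runs_Seq[OF r10] r11)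
qed

section \<open>The outer loop, one token at a time\<close>

definition token_pieces :: "token \<Rightarrow> piece list" where
  "token_pieces t = gadget_pieces (token_wire t)
     [node_pieces 4 I_pieces [], node_pieces 5 I_pieces [],
      node_pieces 6 (I_pieces @ [Sym 1]) [], node_pieces 7 (I_pieces @ [Sym 1]) [],
      node_pieces 0 I_pieces [], node_pieces 1 I_pieces J_pieces]"

text \<open>Emitted after the inner loop, when tape 5 holds the number of tokens; here and in
  \<open>token_pieces\<close>, \<open>J_pieces\<close> therefore denotes the last column.\<close>

definition last_class_pieces :: "piece list" where
  "last_class_pieces = class_pieces [node_pieces 0 I_pieces J_pieces, node_pieces 1 I_pieces J_pieces]"

definition clause_class_pieces :: "piece list \<Rightarrow> piece list" where
  "clause_class_pieces A = class_pieces (map (\<lambda>r. node_pieces r A []) [4, 5, 6, 7])"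

definition row_end_pieces :: "piece list" where
  "row_end_pieces = last_class_pieces @ clause_class_pieces (I_pieces @ [Sym 1])"

text \<open>The first symbol of a token tells its kind. The variable 0 is a dummy, as
  \<open>token_wire\<close> looks only at the sign. The three increments are the maximum of the
  token gadget.\<close>

definition token_prog :: prog where
  "token_prog =
     Loop 2 2 (\<lambda>s _. s \<noteq> 0) cell_prog ;;
     Cond 0 0 (\<lambda>s _. s = 2) (emit 3 (token_pieces (Lit (Pos 0))))
       (Cond 0 0 (\<lambda>s _. s = 1) (emit 3 (token_pieces (Lit (Neg 0)))) (emit 3 (token_pieces End))) ;;
     emit 1 row_end_pieces ;; repeat 3 (increment 6) ;; erase 5 ;; put 4 1 ;;
     skip 0 {1, 2} ;; move_right 0 ;; rewind 2 {0<..}"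

definition token_emit_time :: "nat \<Rightarrow> nat" where
  "token_emit_time N = emit_time (token_pieces (Lit (Pos 0))) N + emit_time (token_pieces (Lit (Neg 0))) N +
     emit_time (token_pieces End) N + 4"

definition token_time :: "nat \<Rightarrow> nat \<Rightarrow> nat" where
  "token_time N K =
     (N * (cell_time N K + 2) + 1) + (token_emit_time N + (emit_time row_end_pieces N +
     ((3 * (6 * K + 10) + 1) + ((3 * N + 3) + (1 + ((3 * N + 1) + (1 + (3 * N + 3))))))))"

lemma pieces_ok_token_pieces: "pieces_ok (token_pieces t)"
  unfolding token_pieces_def
  by (auto simp: pieces_ok_node_pieces dest!: pieces_ok_gadget_pieces[OF _ wiring_token_wire])

lemma runs_token:
  assumes i: "i < length ts" and N: "length (encode_tokens ts) \<le> N" and K: "c + 4 * length ts + 3 \<le> K"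
  shows "runs token_prog
    (conf (Tp (scanned ts i) (remaining ts i)) (Tp w1 []) (Tp [] (encode_tokens ts)) (Tp w3 []) (U i) (U 0) (Tp [] (binary c)))
    (token_time N K)
    (conf (Tp (scanned ts (Suc i)) (remaining ts (Suc i)))
      (Tp (w1 @ encode_classes (map (row_class i) [0..<length ts] @ [last_class (length ts) i, clause_class (Suc i)])) [])
      (Tp [] (encode_tokens ts)) (Tp (w3 @ encode_gadgets (row_gadgets ts i)) [])
      (U (Suc i)) (U 0) (Tp [] (binary (c + (4 * length ts + 3)))))"
proof -
  let ?n = "length ts" and ?t = "ts ! i"
  let ?u = "indices i ?n"
  have nN: "?n \<le> N" and iN: "i \<le> N" using i N length_tokens[of ts] by auto
  let ?T0 = "Tp (scanned ts i) (remaining ts i)"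
  define S where "S j = conf ?T0 (Tp (w1 @ encode_classes (map (row_class i) [0..<j])) [])
    (Tp (scanned ts j) (remaining ts j)) (Tp (w3 @ encode_gadgets (concat (map (cell_gadgets ts i) [0..<j]))) [])
    (U i) (U j) (Tp [] (binary (c + 4 * j)))" for j
  have "runs (Loop 2 2 (\<lambda>s _. s \<noteq> 0) cell_prog) (S 0) (?n * (cell_time N K + 2) + 1) (S ?n)"
  proof (rule runs_Loop)
    fix j assume j: "j < ?n"
    show "read_tape (S j 2) \<noteq> 0" using head_remaining[OF j] by (simp add: S_def)
    have "c + 4 * j + 4 \<le> K" using K j by simp
    then show "runs cell_prog (S j) (cell_time N K) (S (Suc j))"
      using runs_cell[of i ts j N "c + 4 * j" K "w1 @ encode_classes (map (row_class i) [0..<j])"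
          "w3 @ encode_gadgets (concat (map (cell_gadgets ts i) [0..<j]))"] i j N
      by (simp add: S_def encode_classes_simps encode_gadgets_simps ac_simps)
  next
    show "\<not> read_tape (S ?n 2) \<noteq> 0" by (simp add: S_def remaining_length)
  qed
  then have r1: "runs (Loop 2 2 (\<lambda>s _. s \<noteq> 0) cell_prog) (S 0) (N * (cell_time N K + 2) + 1) (S ?n)"
    by (rule runs_mono) (intro add_right_mono mult_le_mono1 nN)
  have S0: "S 0 = conf ?T0 (Tp w1 []) (Tp [] (encode_tokens ts)) (Tp w3 []) (U i) (U 0) (Tp [] (binary c))"
    by (simp add: S_def encode_classes_simps encode_gadgets_simps scanned_0 remaining_0)
  let ?w1 = "w1 @ encode_classes (map (row_class i) [0..<?n])"
  let ?w3 = "w3 @ encode_gadgets (concat (map (cell_gadgets ts i) [0..<?n]))"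
  let ?c = "c + 4 * ?n"
  have Sn: "S ?n = conf ?T0 (Tp ?w1 []) (Tp (encode_tokens ts) []) (Tp ?w3 []) (U i) (U ?n) (Tp [] (binary ?c))"
    by (simp add: S_def scanned_length remaining_length)
  have sI: "spells ?u I_pieces = replicate i 1" and sJ: "spells ?u J_pieces = replicate ?n 1"
    and sI1: "spells ?u (I_pieces @ [Sym 1]) = replicate (Suc i) 1" and s0: "spells ?u [] = replicate 0 1"
    by (simp_all add: indices_def replicate_append_same)
  note sp = spells_node_pieces[OF sI sJ] spells_node_pieces[OF sI s0] spells_node_pieces[OF sI1 s0]
  have st: "spells ?u (token_pieces t) = encode_gadgets [(token_wire t,
     [node 4 i 0, node 5 i 0, node 6 (Suc i) 0, node 7 (Suc i) 0, node 0 i 0, node 1 i ?n])]" for t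
    unfolding token_pieces_def by (rule spells_gadget_pieces[OF _ wiring_token_wire]) (simp only: list.map sp)
  let ?g = "encode_gadgets [token_gadget ts i]"
  let ?S2 = "conf ?T0 (Tp ?w1 []) (Tp (encode_tokens ts) []) (Tp (?w3 @ ?g) []) (U i) (U ?n) (Tp [] (binary ?c))"
  have emit: "runs (emit 3 (token_pieces t)) (S ?n) (emit_time (token_pieces t) N) ?S2"
    if "token_wire t = token_wire ?t" for t
    using runs_emit_3[OF pieces_ok_token_pieces iN nN, of t] unfolding st that Sn token_gadget_def .
  let ?D = "Cond 0 0 (\<lambda>s _. s = 1) (emit 3 (token_pieces (Lit (Neg 0)))) (emit 3 (token_pieces End))"
  have rd: "read_tape (S ?n 0) = (case ?t of Lit (Pos x) \<Rightarrow> 2 | Lit (Neg x) \<Rightarrow> 1 | End \<Rightarrow> 4)"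
    by (cases ?t rule: token_sign.cases) (simp_all add: Sn remaining_Cons[OF i])
  have r2: "runs (Cond 0 0 (\<lambda>s _. s = 2) (emit 3 (token_pieces (Lit (Pos 0)))) ?D) (S ?n) (token_emit_time N) ?S2"
  proof (cases ?t rule: token_sign.cases)
    case (1 x)
    have "runs (Cond 0 0 (\<lambda>s _. s = 2) (emit 3 (token_pieces (Lit (Pos 0)))) ?D) (S ?n)
        (emit_time (token_pieces (Lit (Pos 0))) N + 2) ?S2"
      by (rule runs_Cond_True, use rd 1 in simp, rule emit, use 1 in simp)
    then show ?thesis by (rule runs_mono) (simp add: token_emit_time_def)
  next
    case (2 x)
    have "runs ?D (S ?n) (emit_time (token_pieces (Lit (Neg 0))) N + 2) ?S2"
      by (rule runs_Cond_True, use rd 2 in simp, rule emit, use 2 in simp)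
    then have "runs (Cond 0 0 (\<lambda>s _. s = 2) (emit 3 (token_pieces (Lit (Pos 0)))) ?D) (S ?n)
        (emit_time (token_pieces (Lit (Neg 0))) N + 2 + 2) ?S2"
      by (rule runs_Cond_False[rotated]) (use rd 2 in simp)
    then show ?thesis by (rule runs_mono) (simp add: token_emit_time_def)
  next
    case 3
    have "runs ?D (S ?n) (emit_time (token_pieces End) N + 2) ?S2"
      by (rule runs_Cond_False, use rd 3 in simp, rule emit, use 3 in simp)
    then have "runs (Cond 0 0 (\<lambda>s _. s = 2) (emit 3 (token_pieces (Lit (Pos 0)))) ?D) (S ?n)
        (emit_time (token_pieces End) N + 2 + 2) ?S2"
      by (rule runs_Cond_False[rotated]) (use rd 3 in simp)
    then show ?thesis by (rule runs_mono) (simp add: token_emit_time_def)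
  qed
  have "spells ?u last_class_pieces = encode_classes [last_class ?n i]"
    unfolding last_class_pieces_def by (rule spells_class_pieces) (simp only: list.map sp last_class_def)
  moreover have "spells ?u (clause_class_pieces (I_pieces @ [Sym 1])) = encode_classes [clause_class (Suc i)]"
    unfolding clause_class_pieces_def
    by (rule spells_class_pieces) (simp only: list.map sp clause_class_def)
  ultimately have sr: "spells ?u row_end_pieces = encode_classes [last_class ?n i, clause_class (Suc i)]"
    using encode_classes_simps(2)[of "[last_class ?n i]" "[clause_class (Suc i)]"]
    by (simp only: row_end_pieces_def spells_simps append.simps)
  have "pieces_ok row_end_pieces"
    unfolding row_end_pieces_def last_class_pieces_def clause_class_pieces_def
    by (auto simp: pieces_ok_class_pieces pieces_ok_node_pieces)
  note r3 = runs_emit_1[OF this iN nN, where w = ?w1, unfolded sr]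
  let ?w1' = "?w1 @ encode_classes [last_class ?n i, clause_class (Suc i)]"
  let ?S4 = "conf ?T0 (Tp ?w1' []) (Tp (encode_tokens ts) []) (Tp (?w3 @ ?g) []) (U i) (U ?n) (Tp [] (binary (?c + 3)))"
  have r4: "runs (repeat 3 (increment 6))
      (conf ?T0 (Tp ?w1' []) (Tp (encode_tokens ts) []) (Tp (?w3 @ ?g) []) (U i) (U ?n) (Tp [] (binary ?c)))
      (3 * (6 * K + 10) + 1) ?S4"
    by (rule runs_count[OF K])
  let ?S5 = "conf ?T0 (Tp ?w1' []) (Tp (encode_tokens ts) []) (Tp (?w3 @ ?g) []) (U i) (U 0) (Tp [] (binary (?c + 3)))"
  have "runs (erase 5) ?S4 (3 * length (replicate ?n (1 :: nat)) + 3) (?S4(5 := Tp [] []))"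
    by (rule runs_erase) (simp_all add: U_def)
  moreover have "?S4(5 := Tp [] []) = ?S5" by (simp add: U_def)
  ultimately have "runs (erase 5) ?S4 (3 * length (replicate ?n (1 :: nat)) + 3) ?S5" by (simp only:)
  then have r5: "runs (erase 5) ?S4 (3 * N + 3) ?S5" by (rule runs_mono) (use nN in simp)
  let ?S6 = "conf ?T0 (Tp ?w1' []) (Tp (encode_tokens ts) []) (Tp (?w3 @ ?g) []) (U (Suc i)) (U 0) (Tp [] (binary (?c + 3)))"
  have r6: "runs (put 4 1) ?S5 1 ?S6" by (rule runs_put_U4)
  let ?R = "remaining ts (Suc i)"
  let ?S7 = "conf (Tp (scanned ts i @ token_sign ?t @ token_bits ?t) ([token_end ?t] @ ?R)) (Tp ?w1' [])
    (Tp (encode_tokens ts) []) (Tp (?w3 @ ?g) []) (U (Suc i)) (U 0) (Tp [] (binary (?c + 3)))"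
  have e: "token_end ?t \<notin> {1, 2}" using token_end_cases[of ?t] by auto
  have "runs (skip 0 {1, 2}) ?S6 (3 * length (token_sign ?t @ token_bits ?t) + 1) ?S7"
    using runs_skip[of ?S6 0 "scanned ts i" "token_sign ?t @ token_bits ?t" "[token_end ?t] @ ?R" "{1, 2}"]
      set_token_sign[of ?t] set_token_bits[of ?t] e
    by (simp add: remaining_Cons[OF i] encode_token_split)
  then have r7: "runs (skip 0 {1, 2}) ?S6 (3 * N + 1) ?S7"
    by (rule runs_mono) (use length_encode_token[OF i] N in \<open>simp add: encode_token_split\<close>)
  let ?T8 = "Tp (scanned ts (Suc i)) ?R"
  let ?S8 = "conf ?T8 (Tp ?w1' []) (Tp (encode_tokens ts) []) (Tp (?w3 @ ?g) []) (U (Suc i)) (U 0) (Tp [] (binary (?c + 3)))"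
  have r8: "runs (move_right 0) ?S7 1 ?S8"
    using runs_move_right[of ?S7 0 "scanned ts i @ token_sign ?t @ token_bits ?t" "token_end ?t" ?R]
    by (simp add: scanned_Suc[OF i] encode_token_split)
  let ?S9 = "conf ?T8 (Tp ?w1' []) (Tp [] (encode_tokens ts)) (Tp (?w3 @ ?g) []) (U (Suc i)) (U 0) (Tp [] (binary (?c + 3)))"
  have "set (encode_tokens ts) \<subseteq> {0<..}"
    using zero_not_in_encode_tokens[of ts] by (auto intro!: gr0I)
  then have "runs (rewind 2 {0<..}) ?S8 (3 * length (encode_tokens ts) + 3) ?S9"
    using runs_rewind[of ?S8 2 "[]" "encode_tokens ts" "[]" "{0<..}"] by simp
  then have r9: "runs (rewind 2 {0<..}) ?S8 (3 * N + 3) ?S9" by (rule runs_mono) (use N in simp)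
  have w1: "w1 @ encode_classes (map (row_class i) [0..<?n] @ [last_class ?n i, clause_class (Suc i)]) = ?w1'"
    by (simp only: encode_classes_simps append_assoc)
  have w3: "w3 @ encode_gadgets (row_gadgets ts i) = ?w3 @ ?g"
    by (simp only: row_gadgets_def encode_gadgets_simps append_assoc)
  have "runs token_prog (S 0) (token_time N K) ?S9"
    unfolding token_prog_def token_time_def
    by (intro runs_Seq[OF r1] runs_Seq[OF r2] runs_Seq[OF r3] runs_Seq[OF r4] runs_Seq[OF r5] runs_Seq[OF r6]
        runs_Seq[OF r7] runs_Seq[OF r8] r9)
  then show ?thesis unfolding S0 w1 w3 add.assoc .
qed

section \<open>The whole program and its output\<close>

definition start_pieces :: "piece list" where
  "start_pieces = clause_class_pieces []"

definition final_pieces :: "piece list" where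
  "final_pieces = gadget_pieces loop_wire
     [node_pieces 6 [] [], node_pieces 7 [] [], node_pieces 4 I_pieces [], node_pieces 5 I_pieces []]"

text \<open>The eight increments are the share of the final gadget in the threshold, which is
  counted along the way instead of being multiplied out. The edges of that gadget come last, when
  tape 4 holds the number of tokens.\<close>

definition start_prog :: prog where
  "start_prog =
     copy 0 2 ;; rewind 0 {0<..} ;; rewind 2 {0<..} ;; emit 1 start_pieces ;; repeat 8 (increment 6) ;;
     Loop 0 0 (\<lambda>s _. s \<noteq> 0) token_prog ;; emit 3 final_pieces"

text \<open>The encoding lists all classes before all edges, while the loops produce both together;
  so the edges are collected on tape 3 and appended here.\<close>

definition finish_prog :: prog where
  "finish_prog = put 1 5 ;; append_tape 3 1 ;; put 1 5 ;; append_tape 6 1 ;; put 1 3"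

definition start_time :: "nat \<Rightarrow> nat" where
  "start_time N =
     (4 * N + 1) + ((3 * N + 3) + ((3 * N + 3) + (emit_time start_pieces N +
     ((8 * (6 * max_cycles N + 10) + 1) + ((N * (token_time N (max_cycles N) + 2) + 1) +
     emit_time final_pieces N)))))"

definition total_time :: "nat \<Rightarrow> nat" where
  "total_time N = start_time N + (1 + ((7 * start_time N + 4) + (1 + ((4 * max_cycles N + 4) + 1))))"

lemma max_cycles_mono: "n \<le> N \<Longrightarrow> max_cycles n \<le> max_cycles N"
  unfolding max_cycles_def by (intro add_mono mult_le_mono) auto

lemma runs_start:
  fixes ts
  defines "n \<equiv> length ts" and "x \<equiv> encode_tokens ts"
  shows "runs start_prog (input_store x) (start_time (length x))
    (conf (Tp x []) (Tp (encode_classes (class_lists n)) []) (Tp [] x) (Tp (encode_gadgets (gadgets ts)) [])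
      (U n) (U 0) (Tp [] (binary (max_cycles n))))"
proof -
  let ?N = "length x" and ?B = "Tp [] []"
  have nN: "n \<le> ?N" unfolding n_def x_def by (rule length_tokens)
  have x0: "0 \<notin> set x" unfolding x_def by (rule zero_not_in_encode_tokens)
  then have xp: "set x \<subseteq> {0<..}" by (auto intro!: gr0I)
  have r1: "runs (copy 0 2) (input_store x) (4 * ?N + 1) (conf (Tp x []) ?B (Tp x []) ?B ?B ?B ?B)"
    using runs_copy[of "input_store x" 0 "[]" x 2 "[]"] x0 by (simp add: input_store_conf)
  have r2: "runs (rewind 0 {0<..}) (conf (Tp x []) ?B (Tp x []) ?B ?B ?B ?B) (3 * ?N + 3)
      (conf (Tp [] x) ?B (Tp x []) ?B ?B ?B ?B)"
    using runs_rewind[of "conf (Tp x []) ?B (Tp x []) ?B ?B ?B ?B" 0 "[]" x "[]" "{0<..}"] xp by simp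
  have r3: "runs (rewind 2 {0<..}) (conf (Tp [] x) ?B (Tp x []) ?B ?B ?B ?B) (3 * ?N + 3)
      (conf (Tp [] x) ?B (Tp [] x) ?B (U 0) (U 0) ?B)"
    using runs_rewind[of "conf (Tp [] x) ?B (Tp x []) ?B ?B ?B ?B" 2 "[]" x "[]" "{0<..}"] xp by (simp add: U_def)
  have "pieces_ok start_pieces"
    unfolding start_pieces_def clause_class_pieces_def
    by (auto simp: pieces_ok_class_pieces pieces_ok_node_pieces)
  note emit1 = runs_emit_1[OF this, of 0 ?N 0]
  have s0: "spells u [] = replicate 0 1" for u by simp
  have "spells (indices 0 0) start_pieces = encode_classes [clause_class 0]"
    unfolding start_pieces_def clause_class_pieces_def
    by (rule spells_class_pieces) (simp only: list.map spells_node_pieces[OF s0 s0] clause_class_def)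
  then have r4: "runs (emit 1 start_pieces) (conf (Tp [] x) ?B (Tp [] x) ?B (U 0) (U 0) ?B) (emit_time start_pieces ?N)
      (conf (Tp [] x) (Tp (encode_classes [clause_class 0]) []) (Tp [] x) ?B (U 0) (U 0) (Tp [] (binary 0)))"
    using emit1[of "Tp [] x" "[]" "Tp [] x" ?B ?B] by (simp add: binary_0)
  \<comment> \<open>The store before row \<open>i\<close>. A row raises the counter by 4 for each of
    its \<open>n\<close> cells and by 3 for its token.\<close>
  define S where "S i = conf (Tp (scanned ts i) (remaining ts i))
    (Tp (encode_classes [clause_class 0] @ encode_classes (concat (map (\<lambda>i. map (row_class i) [0..<n] @
      [last_class n i, clause_class (Suc i)]) [0..<i]))) [])
    (Tp [] x) (Tp (encode_gadgets (concat (map (row_gadgets ts) [0..<i]))) [])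
    (U i) (U 0) (Tp [] (binary (8 + i * (4 * n + 3))))" for i
  have r5: "runs (repeat 8 (increment 6))
      (conf (Tp [] x) (Tp (encode_classes [clause_class 0]) []) (Tp [] x) ?B (U 0) (U 0) (Tp [] (binary 0)))
      (8 * (6 * max_cycles ?N + 10) + 1) (S 0)"
    using runs_count[of 0 8 "max_cycles ?N"]
    by (simp add: S_def scanned_0 remaining_0 x_def encode_classes_simps encode_gadgets_simps max_cycles_def)
  have "runs (Loop 0 0 (\<lambda>s _. s \<noteq> 0) token_prog) (S 0) (n * (token_time ?N (max_cycles ?N) + 2) + 1) (S n)"
  proof (rule runs_Loop)
    fix i assume "i < n"
    then have i: "i < length ts" by (simp add: n_def)
    show "read_tape (S i 0) \<noteq> 0" using head_remaining[OF i] by (simp add: S_def)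
    have "8 + i * (4 * n + 3) + 4 * n + 3 = 8 + Suc i * (4 * n + 3)" by simp
    also have "\<dots> \<le> 8 + n * (4 * n + 3)" using \<open>i < n\<close> by (intro add_left_mono mult_le_mono1) simp
    also have "\<dots> = max_cycles n" by (simp add: max_cycles_def algebra_simps)
    also have "\<dots> \<le> max_cycles ?N" by (rule max_cycles_mono[OF nN])
    finally show "runs token_prog (S i) (token_time ?N (max_cycles ?N)) (S (Suc i))"
      using runs_token[OF i, of ?N "8 + i * (4 * n + 3)" "max_cycles ?N"
          "encode_classes [clause_class 0] @ encode_classes (concat (map (\<lambda>i. map (row_class i) [0..<n] @
            [last_class n i, clause_class (Suc i)]) [0..<i]))"
          "encode_gadgets (concat (map (row_gadgets ts) [0..<i]))"]
      by (simp add: S_def n_def x_def encode_classes_simps encode_gadgets_simps ac_simps)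
  next
    show "\<not> read_tape (S n 0) \<noteq> 0" by (simp add: S_def n_def remaining_length)
  qed
  then have r6: "runs (Loop 0 0 (\<lambda>s _. s \<noteq> 0) token_prog) (S 0) (?N * (token_time ?N (max_cycles ?N) + 2) + 1) (S n)"
    by (rule runs_mono) (intro add_right_mono mult_le_mono1 nN)
  have okf: "pieces_ok final_pieces"
    unfolding final_pieces_def
    by (auto simp: pieces_ok_node_pieces dest!: pieces_ok_gadget_pieces[OF _ wiring_loop_wire])
  have sI: "spells (indices n 0) I_pieces = replicate n 1" by (simp add: indices_def)
  have sf: "spells (indices n 0) final_pieces = encode_gadgets [final_gadget n]"
    unfolding final_pieces_def final_gadget_def
    by (rule spells_gadget_pieces[OF _ wiring_loop_wire])
      (simp only: list.map spells_node_pieces[OF s0 s0] spells_node_pieces[OF sI s0])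
  let ?w1 = "encode_classes [clause_class 0] @ encode_classes (concat (map (\<lambda>i. map (row_class i) [0..<n] @
      [last_class n i, clause_class (Suc i)]) [0..<n]))"
  have w1: "encode_classes (class_lists n) = ?w1"
    unfolding class_lists_def encode_classes_simps(2)[symmetric] by (simp only: append.simps)
  have w3: "encode_gadgets (gadgets ts) =
      encode_gadgets (concat (map (row_gadgets ts) [0..<n])) @ encode_gadgets [final_gadget n]"
    by (simp only: gadgets_def encode_gadgets_simps n_def)
  have K: "8 + n * (4 * n + 3) = max_cycles n" by (simp add: max_cycles_def algebra_simps)
  have r7: "runs (emit 3 final_pieces) (S n) (emit_time final_pieces ?N)
    (conf (Tp x []) (Tp (encode_classes (class_lists n)) []) (Tp [] x) (Tp (encode_gadgets (gadgets ts)) [])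
      (U n) (U 0) (Tp [] (binary (max_cycles n))))"
    using runs_emit_3[OF okf nN, of 0] unfolding sf S_def w1 w3 K
    by (simp add: n_def x_def scanned_length remaining_length)
  show ?thesis
    unfolding start_prog_def start_time_def
    by (intro runs_Seq[OF r1] runs_Seq[OF r2] runs_Seq[OF r3] runs_Seq[OF r4] runs_Seq[OF r5] runs_Seq[OF r6] r7)
qed

lemma set_encode_number: "set (encode_number n) \<subseteq> {1, 2, 3}"
  using set_binary[of n] by (auto simp: encode_number_def)

lemma zero_not_in_encode_gadgets: "0 \<notin> set (encode_gadgets gs)"
proof -
  have "0 \<notin> set (encode_number m)" for m using set_encode_number[of m] by auto
  then have "0 \<notin> set (encode_edge e)" for e by (cases e) simp
  then show ?thesis by (auto simp: encode_gadgets_def)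
qed

lemma runs_main:
  fixes ts
  defines "x \<equiv> encode_tokens ts"
  shows "\<exists>st. runs (start_prog ;; finish_prog) (input_store x) (total_time (length x)) st \<and>
    fst (st 1) = word_content (encode_routing_instance (reduction ts))"
proof -
  let ?N = "length x" and ?n = "length ts"
  let ?w1 = "encode_classes (class_lists ?n)" and ?w3 = "encode_gadgets (gadgets ts)"
  let ?k = "binary (max_cycles ?n)"
  let ?S = "conf (Tp x []) (Tp ?w1 []) (Tp [] x) (Tp ?w3 []) (U ?n) (U 0) (Tp [] ?k)"
  have r0: "runs start_prog (input_store x) (start_time ?N) ?S"
    unfolding x_def by (rule runs_start)
  then obtain t where t: "t \<le> start_time ?N" "exec start_prog (input_store x) t ?S"
    by (auto simp: runs_def)
  \<comment> \<open>The edge tape starts blank, so its content is no longer than the time spent so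
    far.\<close>
  have "confined 0 (input_store x 3)"
    by (simp add: confined_def input_store_def blank_def word_content_def)
  from exec_confined[OF t(2) this] have "length ?w3 \<le> t"
    by (simp add: confined_def Tp_def)
  then have l3: "length ?w3 \<le> start_time ?N" using t(1) by simp
  have "?n \<le> ?N" unfolding x_def by (rule length_tokens)
  then have lk: "length ?k \<le> max_cycles ?N" using length_binary max_cycles_mono le_trans by blast
  have k0: "0 \<notin> set ?k" using set_binary[of "max_cycles ?n"] by auto
  let ?S1 = "conf (Tp x []) (Tp (?w1 @ [5]) []) (Tp [] x) (Tp ?w3 []) (U ?n) (U 0) (Tp [] ?k)"
  have r1: "runs (put 1 5) ?S 1 ?S1" using runs_put[of ?S 1 ?w1 "[]" 5] by simp
  let ?S2 = "conf (Tp x []) (Tp (?w1 @ [5] @ ?w3) []) (Tp [] x) (Tp ?w3 []) (U ?n) (U 0) (Tp [] ?k)"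
  have "runs (append_tape 3 1) ?S1 (7 * length ?w3 + 4 * length ([] :: word) + 4) ?S2"
    using runs_append_tape[of ?S1 3 ?w3 "[]" 1 "?w1 @ [5]"] zero_not_in_encode_gadgets by simp
  then have r2: "runs (append_tape 3 1) ?S1 (7 * start_time ?N + 4) ?S2"
    by (rule runs_mono) (use l3 in simp)
  let ?S3 = "conf (Tp x []) (Tp (?w1 @ [5] @ ?w3 @ [5]) []) (Tp [] x) (Tp ?w3 []) (U ?n) (U 0) (Tp [] ?k)"
  have r3: "runs (put 1 5) ?S2 1 ?S3" using runs_put[of ?S2 1 "?w1 @ [5] @ ?w3" "[]" 5] by simp
  let ?S4 = "conf (Tp x []) (Tp (?w1 @ [5] @ ?w3 @ [5] @ ?k) []) (Tp [] x) (Tp ?w3 []) (U ?n) (U 0) (Tp ?k [])"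
  have "runs (append_tape 6 1) ?S3 (7 * length ([] :: word) + 4 * length ?k + 4) ?S4"
    using runs_append_tape[of ?S3 6 "[]" ?k 1 "?w1 @ [5] @ ?w3 @ [5]"] k0 by simp
  then have r4: "runs (append_tape 6 1) ?S3 (4 * max_cycles ?N + 4) ?S4"
    by (rule runs_mono) (use lk in simp)
  let ?w = "?w1 @ [5] @ ?w3 @ [5] @ ?k @ [3]"
  let ?S5 = "conf (Tp x []) (Tp ?w []) (Tp [] x) (Tp ?w3 []) (U ?n) (U 0) (Tp ?k [])"
  have r5: "runs (put 1 3) ?S4 1 ?S5"
    using runs_put[of ?S4 1 "?w1 @ [5] @ ?w3 @ [5] @ ?k" "[]" 3] by simp
  have "runs (start_prog ;; finish_prog) (input_store x) (total_time ?N) ?S5"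
    unfolding finish_prog_def total_time_def
    by (intro runs_Seq[OF r0] runs_Seq[OF r1] runs_Seq[OF r2] runs_Seq[OF r3] runs_Seq[OF r4] r5)
  moreover have "fst (?S5 1) = word_content (encode_routing_instance (reduction ts))"
    by (simp add: Tp_def encode_reduction encode_number_def)
  ultimately show ?thesis by blast
qed

section \<open>Tapes and symbols of the program\<close>

lemma node_pieces_well_formed:
  "list_all (piece_ok 7 6) A \<Longrightarrow> list_all (piece_ok 7 6) B \<Longrightarrow> list_all (piece_ok 7 6) (node_pieces r A B)"
  by (auto simp: node_pieces_def list_all_iff)

lemma class_pieces_well_formed:
  "\<forall>u \<in> set us. list_all (piece_ok 7 6) u \<Longrightarrow> list_all (piece_ok 7 6) (class_pieces us)"
  by (auto simp: class_pieces_def list_all_iff)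

lemma gadget_pieces_well_formed:
  assumes "\<forall>u \<in> set us. list_all (piece_ok 7 6) u" "wiring \<sigma> us"
  shows "list_all (piece_ok 7 6) (gadget_pieces \<sigma> us)"
proof -
  have n: "list_all (piece_ok 7 6) (map Sym (encode_number m))" for m
    using set_encode_number[of m] by (auto simp: list_all_iff)
  have "list_all (piece_ok 7 6) (us ! (e div 2))" "list_all (piece_ok 7 6) (us ! (\<sigma> ! e div 2))"
    if "e < length \<sigma>" for e
  proof -
    have "e div 2 < length us" "\<sigma> ! e div 2 < length us"
      using wiring_nth_less[OF assms(2) that] assms(2) that by (auto simp: wiring_def)
    then show "list_all (piece_ok 7 6) (us ! (e div 2))" "list_all (piece_ok 7 6) (us ! (\<sigma> ! e div 2))"
      using assms(1) by simp_all
  qed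
  then have "\<forall>e < length \<sigma>. list_all (piece_ok 7 6) (us ! (e div 2) @ map Sym (encode_number (e mod 2 + 1)) @
     us ! (\<sigma> ! e div 2) @ map Sym (encode_number (\<sigma> ! e mod 2 + 1)))"
    using n by simp
  then show ?thesis unfolding gadget_pieces_def by (fastforce simp: list_all_iff)
qed

text \<open>Seven tapes, and the symbols 0 to 5, where 5 is the section mark of the output.\<close>

lemma well_formed_main: "well_formed 7 6 (start_prog ;; finish_prog)"
proof -
  note pieces = row_class_pieces_def chain_pieces_def same_pieces_def different_pieces_def token_pieces_def
    row_end_pieces_def last_class_pieces_def clause_class_pieces_def start_pieces_def final_pieces_def
  note wf = gadget_pieces_well_formed[OF _ wiring_eq_wire] gadget_pieces_well_formed[OF _ wiring_token_wire]
    gadget_pieces_well_formed[OF _ wiring_loop_wire] class_pieces_well_formed node_pieces_well_formed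
  have "list_all (piece_ok 7 6) row_class_pieces" "list_all (piece_ok 7 6) chain_pieces"
    "list_all (piece_ok 7 6) same_pieces" "list_all (piece_ok 7 6) different_pieces"
    "list_all (piece_ok 7 6) row_end_pieces" "list_all (piece_ok 7 6) start_pieces"
    "list_all (piece_ok 7 6) final_pieces" "\<And>t. list_all (piece_ok 7 6) (token_pieces t)"
    unfolding pieces by (simp_all add: wf)
  then show ?thesis
    by (simp add: start_prog_def finish_prog_def token_prog_def cell_prog_def well_formed_emit
        well_formed_repeat skip_sign_def lockstep_def)
qed


section \<open>Polynomial time\<close>

text \<open>The time bounds are built from constants and the input length by sums and products, so
  closure properties replace writing down a polynomial.\<close>

definition poly_bounded :: "(nat \<Rightarrow> nat) \<Rightarrow> bool" where
  "poly_bounded f \<longleftrightarrow> (\<exists>p. \<forall>n. f n \<le> poly p n)"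

lemma poly_bounded_const: "poly_bounded (\<lambda>_. c)"
  unfolding poly_bounded_def by (rule exI[of _ "[:c:]"]) simp

lemma poly_bounded_id: "poly_bounded (\<lambda>n. n)"
  unfolding poly_bounded_def by (rule exI[of _ "[:0, 1:]"]) simp

lemma poly_bounded_add:
  assumes "poly_bounded f" "poly_bounded g"
  shows "poly_bounded (\<lambda>n. f n + g n)"
proof -
  from assms obtain p q where "\<forall>n. f n \<le> poly p n" "\<forall>n. g n \<le> poly q n"
    unfolding poly_bounded_def by blast
  then show ?thesis unfolding poly_bounded_def by (intro exI[of _ "p + q"]) (simp add: add_mono)
qed

lemma poly_bounded_mult:
  assumes "poly_bounded f" "poly_bounded g"
  shows "poly_bounded (\<lambda>n. f n * g n)"
proof -
  from assms obtain p q where "\<forall>n. f n \<le> poly p n" "\<forall>n. g n \<le> poly q n"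
    unfolding poly_bounded_def by blast
  then show ?thesis unfolding poly_bounded_def by (intro exI[of _ "p * q"]) (simp add: mult_le_mono)
qed

lemma poly_bounded_total_time: "poly_bounded total_time"
proof -
  have "poly_bounded (\<lambda>N. total_time N)"
    unfolding total_time_def start_time_def token_time_def token_emit_time_def cell_time_def
      emit_time_def max_cycles_def
    by (intro poly_bounded_add poly_bounded_mult poly_bounded_const poly_bounded_id)
  then show ?thesis .
qed

lemma polynomial_time_reduction:
  "polynomial_time_transformation three_SAT Width6_Valency2_Maximal_Routing (\<lambda>\<phi>. reduction (tokens \<phi>))"
proof -
  let ?M = "compile 7 6 (start_prog ;; finish_prog)"
  obtain p where p: "\<And>n. total_time n \<le> poly p n"
    using poly_bounded_total_time unfolding poly_bounded_def by blast
  have "set (encode_cnf \<phi>) \<subseteq> {0<..<num_symbols ?M}" for \<phi>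
    using set_encode_token by (fastforce simp: encode_cnf_tokens encode_tokens_def compile_def)
  moreover have "outputs_within ?M (encode_cnf \<phi>) (encode_routing_instance (reduction (tokens \<phi>)))
      (poly p (length (encode_cnf \<phi>)))" for \<phi>
  proof -
    obtain st t where t: "t \<le> total_time (length (encode_cnf \<phi>))"
      and ex: "exec (start_prog ;; finish_prog) (input_store (encode_cnf \<phi>)) t st"
      and out: "fst (st 1) = word_content (encode_routing_instance (reduction (tokens \<phi>)))"
      using runs_main[of "tokens \<phi>"] unfolding encode_cnf_tokens runs_def by blast
    show ?thesis
      by (rule outputs_within_compile[OF ex well_formed_main _ le_trans[OF t p] out]) simp
  qed
  ultimately show ?thesis
    unfolding polynomial_time_transformation_def polynomial_time_computable_def
    using turing_machine_compile[OF well_formed_main]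
    by (intro exI[of _ ?M] exI[of _ p]) (simp add: three_SAT_def Width6_Valency2_Maximal_Routing_def)
qed

theorem theorem6:
  "\<exists>f. polynomial_time_transformation three_SAT Width6_Valency2_Maximal_Routing f \<and>
       parsimonious_transformation three_SAT Width6_Valency2_Maximal_Routing f"
  using polynomial_time_reduction parsimonious_reduction by blast

end
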